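(* For every $\epsilon>0$ there exists a constant $C_\epsilon>0$ such that for all $\mu>0$ $$\|\Pi_{\mu,\sqrt{\mathcal L_M}}\|_{\mathscr L(L^2(M),L^4(M))}=\|\Pi_{\mu,\sqrt{\mathcal L_M}}\|_{\mathscr L(L^{4/3}(M),L^2(M))}\le C_\epsilon\,\mu^{\frac12+\epsilon},$$ where $M$ is the standard three-dimensional Heisenberg nilmanifold, $\mathcal L_M$ its canonical sub-Laplacian and $\Pi_{\mu,\sqrt{\mathcal L_M}}$ the spectral projector of $\sqrt{\mathcal L_M}$ at $\mu$.
   Context: The Heisenberg group $\mathbb H_1$ is $\mathbb R^3$ with the group law $(a,b,c)(a',b',c')=(a+a',b+b',c+c'+ab')$. Let $\Gamma=\mathbb Z^3\subset\mathbb H_1$ (a discrete subgroup) and $M=\Gamma\backslash\mathbb H_1=\{\dot x=\Gamma x : x\in\mathbb H_1\}$, a compact smooth manifold. Functions on $M$ are identified with functions $f$ on $\mathbb H_1$ that satisfy $f(\gamma x)=f(x)$ for all $\gamma\in\Gamma$. $M$ carries the measure $d\dot x$ that coincides with Lebesgue measure $da\,db\,dc$ on the fundamental domain $[0,1)^3$ (so $M$ has volume $1$), and $L^p(M)$ is taken with respect to this measure. The left-invariant vector fields $A=\partial_a$, $B=\partial_b+a\partial_c$ on $\mathbb H_1$ descend to vector fields $A_M,B_M$ on $M$. The canonical sub-Laplacian is $\mathcal L_M=-(A_M^2+B_M^2)$; it is non-negative and essentially self-adjoint on $C^\infty(M)\subset L^2(M)$, and $\mathcal L_M$ also denotes its self-adjoint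 extension. Its spectrum is discrete, consisting of eigenvalues of finite multiplicity with smooth eigenfunctions. $\Pi_{\mu,\sqrt{\mathcal L_M}}$ is the orthogonal projection of $L^2(M)$ onto the eigenspace $\ker(\mathcal L_M-\mu^2)$ (it is $0$ if $\mu$ is not an eigenvalue of $\sqrt{\mathcal L_M}$). Since this eigenspace is finite dimensional and consists of smooth functions, the projection also acts on $L^{4/3}(M)$ via $f\mapsto\sum_j\left(\int_M f\overline{e_j}\,d\dot x\right)e_j$ for an orthonormal basis $(e_j)$ of the eigenspace. $\|\cdot\|_{\mathscr L(X,Y)}$ is the operator norm from $X$ to $Y$. *)

theory Defs
  imports "HOL-Analysis.Analysis"
begin

type_synonym heis = "real \<times> real \<times> real"

definition heis_mult :: "heis \<Rightarrow> heis \<Rightarrow> heis" where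
  "heis_mult x y =
     (case (x, y) of ((a, b, c), (a', b', c')) \<Rightarrow> (a + a', b + b', c + c' + a * b'))"

definition heis_lattice :: "heis set" where
  "heis_lattice = \<int> \<times> \<int> \<times> \<int>"

(* Functions on the nilmanifold M, the space of cosets of heis_lattice acting on the left,
   are represented by their pullbacks to the Heisenberg group. *)
definition nil_invariant :: "(heis \<Rightarrow> complex) \<Rightarrow> bool" where
  "nil_invariant f \<longleftrightarrow> (\<forall>\<gamma>\<in>heis_lattice. \<forall>x. f (heis_mult \<gamma> x) = f x)"

definition nil_measure :: "heis measure" where
  "nil_measure = restrict_space lborel ({0..<1} \<times> {0..<1} \<times> {0..<1})"

(* Elements of L^p(M) are represented by everywhere defined functions, without passing to
   classes modulo null sets; all norms below are insensitive to null sets. *)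
definition nil_Lp :: "real \<Rightarrow> (heis \<Rightarrow> complex) set" where
  "nil_Lp p = {f. nil_invariant f \<and> f \<in> borel_measurable borel \<and>
     integrable nil_measure (\<lambda>x. cmod (f x) powr p)}"

definition nil_norm :: "real \<Rightarrow> (heis \<Rightarrow> complex) \<Rightarrow> ennreal" where
  "nil_norm p f =
     (if f \<in> nil_Lp p
      then ennreal ((LINT x|nil_measure. cmod (f x) powr p) powr (1 / p)) else \<infinity>)"

definition nil_inner :: "(heis \<Rightarrow> complex) \<Rightarrow> (heis \<Rightarrow> complex) \<Rightarrow> complex" where
  "nil_inner f g = (LINT x|nil_measure. f x * cnj (g x))"

(* For T linear up to null sets, the value is infinite unless T maps L^p(M) into L^q(M). *)
definition nil_opnorm ::
    "real \<Rightarrow> real \<Rightarrow> ((heis \<Rightarrow> complex) \<Rightarrow> (heis \<Rightarrow> complex)) \<Rightarrow> ennreal" where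
  "nil_opnorm p q T = (SUP f\<in>{f \<in> nil_Lp p. nil_norm p f \<le> 1}. nil_norm q (T f))"

primrec cont_diff :: "nat \<Rightarrow> (heis \<Rightarrow> complex) \<Rightarrow> bool" where
  "cont_diff 0 f \<longleftrightarrow> continuous_on UNIV f"
| "cont_diff (Suc k) f \<longleftrightarrow>
     (\<forall>x. f differentiable (at x)) \<and>
     (\<forall>v. cont_diff k (\<lambda>x. frechet_derivative f (at x) v))"

definition nil_smooth :: "(heis \<Rightarrow> complex) set" where
  "nil_smooth = {f. nil_invariant f \<and> (\<forall>k. cont_diff k f)}"

definition field_A :: "(heis \<Rightarrow> complex) \<Rightarrow> heis \<Rightarrow> complex" where
  "field_A f x = frechet_derivative f (at x) (1, 0, 0)"

definition field_B :: "(heis \<Rightarrow> complex) \<Rightarrow> heis \<Rightarrow> complex" where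
  "field_B f x = frechet_derivative f (at x) (0, 1, 0)
     + of_real (fst x) * frechet_derivative f (at x) (0, 0, 1)"

definition sublaplacian :: "(heis \<Rightarrow> complex) \<Rightarrow> heis \<Rightarrow> complex" where
  "sublaplacian f x = - (field_A (field_A f) x + field_B (field_B f) x)"

(* The graph of the closure of the sub-Laplacian in L^2(M), initially defined on smooth
   functions.  As that operator is essentially self-adjoint, the closure is its unique
   self-adjoint extension. *)
definition sublaplacian_closure :: "(heis \<Rightarrow> complex) \<Rightarrow> (heis \<Rightarrow> complex) \<Rightarrow> bool" where
  "sublaplacian_closure f g \<longleftrightarrow> f \<in> nil_Lp 2 \<and> g \<in> nil_Lp 2 \<and>
     (\<exists>\<phi> :: nat \<Rightarrow> heis \<Rightarrow> complex. (\<forall>n. \<phi> n \<in> nil_smooth) \<and>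
        (\<lambda>n. nil_norm 2 (\<lambda>x. \<phi> n x - f x)) \<longlonglongrightarrow> 0 \<and>
        (\<lambda>n. nil_norm 2 (\<lambda>x. sublaplacian (\<phi> n) x - g x)) \<longlonglongrightarrow> 0)"

definition eigenspace :: "real \<Rightarrow> (heis \<Rightarrow> complex) set" where
  "eigenspace \<mu> = {f. sublaplacian_closure f (\<lambda>x. of_real (\<mu>\<^sup>2) * f x)}"

(* The orthogonal projection onto the eigenspace; the choice is among functions that agree
   almost everywhere. *)
definition spec_proj :: "real \<Rightarrow> (heis \<Rightarrow> complex) \<Rightarrow> (heis \<Rightarrow> complex)" where
  "spec_proj \<mu> f =
     (SOME g. g \<in> eigenspace \<mu> \<and>
        (\<forall>h\<in>eigenspace \<mu>. nil_inner (\<lambda>x. f x - g x) h = 0))"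

definition eigenspace_onb :: "real \<Rightarrow> (heis \<Rightarrow> complex) set \<Rightarrow> bool" where
  "eigenspace_onb \<mu> S \<longleftrightarrow> finite S \<and> S \<subseteq> eigenspace \<mu> \<inter> nil_smooth \<and>
     (\<forall>e\<in>S. \<forall>e'\<in>S. nil_inner e e' = (if e = e' then 1 else 0)) \<and>
     (\<forall>f\<in>eigenspace \<mu>. \<exists>c. AE x in nil_measure. f x = (\<Sum>e\<in>S. c e * e x))"

(* The action of the projection on L^(4/3)(M), where orthogonality to the eigenspace is
   replaced by the expansion in an orthonormal basis of smooth eigenfunctions; the result
   does not depend on the chosen basis. *)
definition spec_proj_ext :: "real \<Rightarrow> (heis \<Rightarrow> complex) \<Rightarrow> (heis \<Rightarrow> complex)" where
  "spec_proj_ext \<mu> f =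
     (\<lambda>x. \<Sum>e\<in>(SOME S. eigenspace_onb \<mu> S). nil_inner f e * e x)"

end

theory Submission
  imports Defs "HOL-Probability.Levy" "HOL-Library.Nat_Bijection"
    "HOL-Computational_Algebra.Polynomial" "HOL-Computational_Algebra.Primes"
begin

text \<open>
  The central Fourier decomposition splits an eigenspace into components \<open>f\<close> of weight \<open>k\<close>, that
  is, \<open>f (a, b, c) = exp (2 \<pi> \<i> k c) f (a, b, 0)\<close>. Then \<open>\<bar>f\<bar>\<^sup>2\<close> depends on \<open>(a, b)\<close> only and its partial
  derivatives are bounded by \<open>2 \<bar>A f\<bar> \<bar>f\<bar>\<close> and \<open>2 \<bar>B f\<bar> \<bar>f\<bar>\<close>, so Ladyzhenskaya's inequality in the plane
  and \<open>\<parallel>A f\<parallel>\<^sup>2 + \<parallel>B f\<parallel>\<^sup>2 = \<mu>\<^sup>2 \<parallel>f\<parallel>\<^sup>2\<close> give \<open>\<parallel>f\<parallel>\<^sub>4\<^sup>4 \<le> (1 + 2 \<mu>)\<^sup>2 \<parallel>f\<parallel>\<^sub>2\<^sup>4\<close>.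
  A weight \<open>k \<noteq> 0\<close> occurs only if \<open>2 \<pi> \<bar>k\<bar> (2 j + 1) = \<mu>\<^sup>2\<close> for some \<open>j\<close>; then \<open>\<bar>k\<bar>\<close> divides the integer
  \<open>\<mu>\<^sup>2 / (2 \<pi>)\<close>, and the divisor bound leaves only \<open>O(\<mu>\<^sup>\<epsilon>)\<close> weights.
  The quantization of \<open>\<mu>\<^sup>2\<close>, the finite dimension of the eigenspaces and the smoothness of their elements
  all follow from one explicit complete system of eigenfunctions: characters of the torus for
  \<open>k = 0\<close>, and periodizations of Hermite functions for \<open>k \<noteq> 0\<close>.
\<close>

section \<open>Lebesgue measure on the fundamental domain\<close>

text \<open>Duality reduces both operator norms to one inequality between the L^4 and L^2 norms of
  smooth eigenfunctions. The exponent 1/2 is the fourth root of the \<open>\<mu>\<^sup>2\<close>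
  that a single weight contributes. Summing over weights costs the cube of their number, and the
  divisor bound turns this into \<epsilon>. As \<mu> tends to 0 the claimed bound tends to 0 but
  \<open>1 + 2 * \<mu>\<close> does not, so for 0 < \<mu> < 1 the absence of eigenvalues is used
  instead. The obstacle is that \<open>eigenspace\<close> is defined through the closure of the
  operator, so its elements are a priori only in L^2. Their regularity comes from testing: symmetry
  makes them orthogonal to every smooth eigenfunction with another eigenvalue, and completeness then
  leaves a finite combination of explicit ones. For k nonzero, completeness becomes a statement on
  the line. After unfolding, a Fourier coefficient in (b, c) is a function of a real variable.
  Orthogonality to the Hermite functions annihilates all its moments against a Gaussian, and
  exponential integrability carries this over to the Fourier transform.\<close>

definition unit_lborel :: "real measure" where
  "unit_lborel = restrict_space lborel {0..<1}"

lemma space_unit_lborel [simp]: "space unit_lborel = {0..<1}"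
  by (simp add: unit_lborel_def space_restrict_space)

lemma prob_space_unit_lborel: "prob_space unit_lborel"
  by (rule prob_spaceI) (simp add: unit_lborel_def emeasure_restrict_space space_restrict_space)

interpretation unit_lborel: prob_space unit_lborel
  by (rule prob_space_unit_lborel)

lemma pair_restrict_space:
  assumes "sigma_finite_measure M" "sigma_finite_measure N" "A \<in> sets M" "B \<in> sets N"
  shows "restrict_space M A \<Otimes>\<^sub>M restrict_space N B = restrict_space (M \<Otimes>\<^sub>M N) (A \<times> B)"
proof -
  interpret M: sigma_finite_measure M by fact
  interpret N: sigma_finite_measure N by fact
  interpret MN: pair_sigma_finite M N ..
  have sA: "sigma_finite_measure (restrict_space M A)"
    by (rule sigma_finite_measure_restrict_space) fact+
  have sB: "sigma_finite_measure (restrict_space N B)"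
    by (rule sigma_finite_measure_restrict_space) fact+
  have AB: "A \<times> B \<in> sets (M \<Otimes>\<^sub>M N)" using assms by auto
  have AM: "A \<inter> space M = A" "B \<inter> space N = B"
    using assms sets.sets_into_space by blast+
  show ?thesis
  proof (rule pair_measure_eqI[OF sA sB])
    have sp: "space (restrict_space M A \<Otimes>\<^sub>M restrict_space N B) = A \<times> B"
      using AM by (simp add: space_pair_measure space_restrict_space)
    have "sets (restrict_space (M \<Otimes>\<^sub>M N) (A \<times> B)) \<subseteq> sets (restrict_space M A \<Otimes>\<^sub>M restrict_space N B)"
    proof
      fix X assume "X \<in> sets (restrict_space (M \<Otimes>\<^sub>M N) (A \<times> B))"
      then obtain Y where Y: "Y \<in> sets (M \<Otimes>\<^sub>M N)" "X = (A \<times> B) \<inter> Y"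
        by (auto simp: sets_restrict_space)
      have "id \<in> measurable (restrict_space M A \<Otimes>\<^sub>M restrict_space N B) (M \<Otimes>\<^sub>M N)"
      proof -
        have 1: "fst \<in> measurable (restrict_space M A \<Otimes>\<^sub>M restrict_space N B) M"
          by (rule measurable_compose[OF measurable_fst]) (simp add: measurable_restrict_space1)
        have 2: "snd \<in> measurable (restrict_space M A \<Otimes>\<^sub>M restrict_space N B) N"
          by (rule measurable_compose[OF measurable_snd]) (simp add: measurable_restrict_space1)
        show ?thesis using measurable_Pair[OF 1 2] by (simp add: id_def)
      qed
      from measurable_sets[OF this Y(1)] sp Y(2)
      show "X \<in> sets (restrict_space M A \<Otimes>\<^sub>M restrict_space N B)"
        by (simp add: Int_commute)
    qed
    moreover have "sets (restrict_space M A \<Otimes>\<^sub>M restrict_space N B) \<subseteq> sets (restrict_space (M \<Otimes>\<^sub>M N) (A \<times> B))"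
    proof -
      have "X \<times> Y \<in> sets (restrict_space (M \<Otimes>\<^sub>M N) (A \<times> B))"
        if "X \<in> sets (restrict_space M A)" "Y \<in> sets (restrict_space N B)" for X Y
      proof -
        have "X \<in> sets M" "X \<subseteq> A" "Y \<in> sets N" "Y \<subseteq> B"
          using that assms by (auto simp: sets_restrict_space)
        then show ?thesis using AB by (auto simp: sets_restrict_space_iff)
      qed
      then have "{a \<times> b |a b. a \<in> sets (restrict_space M A) \<and> b \<in> sets (restrict_space N B)}
          \<subseteq> sets (restrict_space (M \<Otimes>\<^sub>M N) (A \<times> B))" by blast
      from sets.sigma_sets_subset[OF this]
      show ?thesis
        using AM by (simp add: sets_pair_measure space_restrict_space space_pair_measure Times_Int_Times)
    qed
    ultimately show "sets (restrict_space M A \<Otimes>\<^sub>M restrict_space N B) = sets (restrict_space (M \<Otimes>\<^sub>M N) (A \<times> B))"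
      by blast
    fix X Y assume "X \<in> sets (restrict_space M A)" "Y \<in> sets (restrict_space N B)"
    then have XY: "X \<in> sets M" "X \<subseteq> A" "Y \<in> sets N" "Y \<subseteq> B"
      using assms by (auto simp: sets_restrict_space)
    then have "X \<times> Y \<subseteq> A \<times> B" by auto
    then show "emeasure (restrict_space M A) X * emeasure (restrict_space N B) Y =
        emeasure (restrict_space (M \<Otimes>\<^sub>M N) (A \<times> B)) (X \<times> Y)"
      using XY AB assms by (simp add: emeasure_restrict_space N.emeasure_pair_measure_Times)
  qed
qed

lemma sigma_finite_lborel: "sigma_finite_measure (lborel :: 'a::euclidean_space measure)"
  ..

text \<open>The product form makes Fubini available one coordinate at a time.\<close>

lemma nil_measure_eq: "nil_measure = unit_lborel \<Otimes>\<^sub>M (unit_lborel \<Otimes>\<^sub>M unit_lborel)"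
proof -
  have [measurable]: "{0..<1::real} \<times> {0..<1::real} \<in> sets borel"
    by (simp add: borel_prod[symmetric])
  show ?thesis
    unfolding unit_lborel_def nil_measure_def
    by (simp add: pair_restrict_space lborel_prod sigma_finite_lborel)
qed

interpretation unit_lborel2: pair_prob_space unit_lborel unit_lborel ..

interpretation unit_lborel3: pair_prob_space unit_lborel "unit_lborel \<Otimes>\<^sub>M unit_lborel" ..

interpretation nil: prob_space nil_measure
  unfolding nil_measure_eq by (rule unit_lborel3.prob_space_axioms)

lemma space_nil_measure: "space nil_measure = {0..<1} \<times> {0..<1} \<times> {0..<1}"
  by (simp add: nil_measure_def space_restrict_space)

lemma borel_measurable_nil:
  "f \<in> borel_measurable borel \<Longrightarrow> f \<in> borel_measurable nil_measure"
  by (simp add: nil_measure_def measurable_restrict_space1)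

lemma borel_measurable_unit_lborel:
  "f \<in> borel_measurable borel \<Longrightarrow> f \<in> borel_measurable unit_lborel"
  by (simp add: unit_lborel_def measurable_restrict_space1)

section \<open>Periodic functions and translates of the fundamental domain\<close>

lemma periodic_int:
  fixes g :: "real \<Rightarrow> 'a"
  assumes "\<And>x. g (x + 1) = g x"
  shows "g (x + of_int n) = g x"
proof -
  have nat: "g (y + of_nat k) = g y" for y k
    by (induction k) (simp_all add: assms[of "y + of_nat _", symmetric] add_ac)
  show ?thesis
  proof (cases "n \<ge> 0")
    case True
    then show ?thesis using nat[of x "nat n"] by simp
  next
    case False
    then show ?thesis using nat[of "x + of_int n" "nat (- n)"] by simp
  qed
qed

lemma periodic_frac:
  fixes g :: "real \<Rightarrow> 'a"
  assumes "\<And>x. g (x + 1) = g x"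
  shows "g (frac x) = g x"
  using periodic_int[of g "frac x" "\<lfloor>x\<rfloor>"] assms by (simp add: frac_def)

text \<open>Only the fractional part s of t matters. The translated window [s, 1 + s) is cut at 1,
  and periodicity moves the piece beyond 1 back to [0, s).\<close>

lemma nn_integral_unit_lborel_shift:
  fixes G :: "real \<Rightarrow> ennreal"
  assumes [measurable]: "G \<in> borel_measurable borel" and per: "\<And>x. G (x + 1) = G x"
  shows "(\<integral>\<^sup>+c. G (c + t) \<partial>unit_lborel) = (\<integral>\<^sup>+c. G c \<partial>unit_lborel)"
proof -
  define s where "s = frac t"
  have s: "0 \<le> s" "s < 1" by (auto simp: s_def frac_lt_1)
  have shift: "G (c + t) = G (c + s)" for c
    using periodic_int[of G "c + s" "\<lfloor>t\<rfloor>"] per by (simp add: s_def frac_def)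
  have "(\<integral>\<^sup>+c. G (c + t) \<partial>unit_lborel) = (\<integral>\<^sup>+c. G (c + s) * indicator {0..<1} c \<partial>lborel)"
    by (simp add: shift unit_lborel_def nn_integral_restrict_space)
  also have "\<dots> = (\<integral>\<^sup>+c. G c * indicator {s..<1 + s} c \<partial>lborel)"
    by (subst (2) nn_integral_real_affine[where c=1 and t=s])
      (auto intro!: nn_integral_cong simp: indicator_def add_ac)
  also have "\<dots> = (\<integral>\<^sup>+c. G c * indicator {s..<1} c + G c * indicator {1..<1 + s} c \<partial>lborel)"
    using s by (intro nn_integral_cong) (auto simp: indicator_def)
  also have "\<dots> = (\<integral>\<^sup>+c. G c * indicator {s..<1} c \<partial>lborel) + (\<integral>\<^sup>+c. G c * indicator {1..<1 + s} c \<partial>lborel)"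
    by (rule nn_integral_add) auto
  also have "(\<integral>\<^sup>+c. G c * indicator {1..<1 + s} c \<partial>lborel) = (\<integral>\<^sup>+c. G c * indicator {0..<s} c \<partial>lborel)"
    by (subst nn_integral_real_affine[where c=1 and t=1])
      (auto intro!: nn_integral_cong simp: indicator_def per add.commute[of 1])
  also have "(\<integral>\<^sup>+c. G c * indicator {s..<1} c \<partial>lborel) + (\<integral>\<^sup>+c. G c * indicator {0..<s} c \<partial>lborel)
      = (\<integral>\<^sup>+c. G c * indicator {s..<1} c + G c * indicator {0..<s} c \<partial>lborel)"
    by (rule nn_integral_add[symmetric]) auto
  also have "\<dots> = (\<integral>\<^sup>+c. G c * indicator {0..<1} c \<partial>lborel)"
    using s by (intro nn_integral_cong) (auto simp: indicator_def)
  also have "\<dots> = (\<integral>\<^sup>+c. G c \<partial>unit_lborel)"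
    by (simp add: unit_lborel_def nn_integral_restrict_space)
  finally show ?thesis .
qed

lemma nn_integral_nil_fubini:
  fixes G :: "heis \<Rightarrow> ennreal"
  assumes [measurable]: "G \<in> borel_measurable borel"
  shows "(\<integral>\<^sup>+x. G x \<partial>nil_measure) =
    (\<integral>\<^sup>+a. (\<integral>\<^sup>+b. (\<integral>\<^sup>+c. G (a, b, c) \<partial>unit_lborel) \<partial>unit_lborel) \<partial>unit_lborel)"
proof -
  have G: "G \<in> borel_measurable (unit_lborel \<Otimes>\<^sub>M unit_lborel \<Otimes>\<^sub>M unit_lborel)"
    using borel_measurable_nil[OF assms] by (simp add: nil_measure_eq)
  have "(\<lambda>y. G (a, y)) \<in> borel_measurable (unit_lborel \<Otimes>\<^sub>M unit_lborel)"
    if "a \<in> space unit_lborel" for a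
    by (rule measurable_compose[OF measurable_Pair1'[OF that] G])
  then have "(\<integral>\<^sup>+y. G (a, y) \<partial>(unit_lborel \<Otimes>\<^sub>M unit_lborel)) =
     (\<integral>\<^sup>+b. (\<integral>\<^sup>+c. G (a, b, c) \<partial>unit_lborel) \<partial>unit_lborel)" if "a \<in> space unit_lborel" for a
    using unit_lborel.nn_integral_fst[of "\<lambda>y. G (a, fst y, snd y)" unit_lborel] that by simp
  then show ?thesis
    unfolding nil_measure_eq unit_lborel2.nn_integral_fst[OF G, symmetric]
    by (intro nn_integral_cong) simp
qed

lemma nn_integral_lborel_translate:
  fixes H :: "'a::euclidean_space \<Rightarrow> ennreal"
  assumes [measurable]: "H \<in> borel_measurable borel"
  shows "(\<integral>\<^sup>+x. H (x + t) \<partial>lborel) = (\<integral>\<^sup>+x. H x \<partial>lborel)"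
proof -
  have "(\<integral>\<^sup>+x. H x \<partial>distr lborel borel ((+) t)) = (\<integral>\<^sup>+x. H (t + x) \<partial>lborel)"
    by (rule nn_integral_distr) auto
  then show ?thesis by (simp add: lborel_distr_plus add.commute)
qed

text \<open>The cube moved by m along the a axis; these cubes tile the line times the unit square.
  Up to reduction of c modulo 1 this is the image of the cube under the lattice element (m, 0,
  0).\<close>

definition nil_strip :: "int \<Rightarrow> heis set" where
  "nil_strip m = {of_int m..<of_int m + 1} \<times> {0..<1} \<times> {0..<1}"

lemma sets_nil_strip [measurable]: "nil_strip m \<in> sets borel"
  unfolding nil_strip_def by (simp add: borel_prod[symmetric])

text \<open>Left multiplication by (m, 0, 0) also shears c by m b. For fixed a and b the shear is a
  rotation of the circle in c, which the inner integral does not see; an ordinary translation in a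
  remains.\<close>

lemma nn_integral_nil_strip:
  fixes G :: "heis \<Rightarrow> ennreal"
  assumes [measurable]: "G \<in> borel_measurable borel"
    and per: "\<And>a b c. G (a, b, c + 1) = G (a, b, c)"
  shows "(\<integral>\<^sup>+x. G x * indicator (nil_strip m) x \<partial>lborel) =
    (\<integral>\<^sup>+(a, b, c). G (a + of_int m, b, c + of_int m * b) \<partial>nil_measure)"
proof -
  have [measurable]: "(\<lambda>c. G (a, b, c)) \<in> borel_measurable borel" for a b
    by (rule measurable_compose[OF _ assms(1)]) (simp add: borel_prod[symmetric])
  have tr: "(\<lambda>(a, b, c). (a + of_int m, b, c + of_int m * b)) \<in> borel_measurable (borel :: heis measure)"
    by (simp add: borel_prod[symmetric] split_beta)
  have Gm2: "(\<lambda>(a, b, c). G (a + of_int m, b, c + of_int m * b)) \<in> borel_measurable borel"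
    using measurable_compose[OF tr assms(1)] by (simp add: split_beta)
  have tr2: "(\<lambda>(a, b, c). (a + of_int m, b, c)) \<in> borel_measurable (borel :: heis measure)"
    by (simp add: borel_prod[symmetric] split_beta)
  have Gm3: "(\<lambda>(a, b, c). G (a + of_int m, b, c)) \<in> borel_measurable borel"
    using measurable_compose[OF tr2 assms(1)] by (simp add: split_beta')
  have "(\<integral>\<^sup>+(a, b, c). G (a + of_int m, b, c + of_int m * b) \<partial>nil_measure) =
     (\<integral>\<^sup>+a. (\<integral>\<^sup>+b. (\<integral>\<^sup>+c. G (a + of_int m, b, c + of_int m * b) \<partial>unit_lborel) \<partial>unit_lborel) \<partial>unit_lborel)"
    by (subst nn_integral_nil_fubini[OF Gm2]) simp
  also have "\<dots> = (\<integral>\<^sup>+a. (\<integral>\<^sup>+b. (\<integral>\<^sup>+c. G (a + of_int m, b, c) \<partial>unit_lborel) \<partial>unit_lborel) \<partial>unit_lborel)"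
    by (subst nn_integral_unit_lborel_shift) (auto simp: per)
  also have "\<dots> = (\<integral>\<^sup>+(a, b, c). G (a + of_int m, b, c) \<partial>nil_measure)"
    by (subst nn_integral_nil_fubini[OF Gm3]) simp
  also have "\<dots> = (\<integral>\<^sup>+x. G (x + (of_int m, 0, 0)) * indicator (nil_strip m) (x + (of_int m, 0, 0)) \<partial>lborel)"
    unfolding nil_measure_def
  proof (subst nn_integral_restrict_space)
    show "{0..<1} \<times> {0..<1} \<times> {0..<1} \<inter> space lborel \<in> sets (lborel :: heis measure)"
      using sets_nil_strip[of 0] by (simp add: nil_strip_def)
  qed (auto simp: nil_strip_def indicator_def split_beta intro!: nn_integral_cong)
  also have "\<dots> = (\<integral>\<^sup>+x. G x * indicator (nil_strip m) x \<partial>lborel)"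
    by (rule nn_integral_lborel_translate) auto
  finally show ?thesis by simp
qed

text \<open>Left translation by (m, 0, 0), with c reduced modulo 1 so that the cube lands in the
  strip.\<close>

definition nil_shift :: "int \<Rightarrow> heis \<Rightarrow> heis" where
  "nil_shift m = (\<lambda>(a, b, c). (a + of_int m, b, frac (c + of_int m * b)))"

lemma borel_measurable_nil_shift [measurable]: "nil_shift m \<in> borel_measurable borel"
  unfolding nil_shift_def by (simp add: borel_prod[symmetric] split_beta frac_def)

text \<open>Stated for measures so that Bochner integrals can be transported as well. It is the
  nonnegative formula above, applied to an indicator made periodic in c.\<close>

lemma distr_nil_shift:
  "distr nil_measure (restrict_space lborel (nil_strip m)) (nil_shift m) = restrict_space lborel (nil_strip m)"
proof (rule measure_eqI)
  have "nil_shift m \<in> measurable nil_measure lborel"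
    using borel_measurable_nil[OF borel_measurable_nil_shift] by simp
  then have ms: "nil_shift m \<in> measurable nil_measure (restrict_space lborel (nil_strip m))"
    by (intro measurable_restrict_space2)
      (auto simp: space_nil_measure nil_shift_def nil_strip_def frac_lt_1)
  fix X assume "X \<in> sets (distr nil_measure (restrict_space lborel (nil_strip m)) (nil_shift m))"
  then have X: "X \<in> sets (restrict_space lborel (nil_strip m))" by simp
  then have XB [measurable]: "X \<in> sets borel" and Xs: "X \<subseteq> nil_strip m"
    by (auto simp: sets_restrict_space)
  define G :: "heis \<Rightarrow> ennreal" where "G = (\<lambda>(a, b, c). indicator X (a, b, frac c))"
  have fr: "(\<lambda>(a, b, c). (a, b, frac c)) \<in> borel_measurable (borel :: heis measure)"
    by (simp add: borel_prod[symmetric] split_beta frac_def)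
  have Gm: "G \<in> borel_measurable borel"
    using measurable_compose[OF fr borel_measurable_indicator[OF XB]] by (simp add: G_def split_beta')
  have "emeasure (distr nil_measure (restrict_space lborel (nil_strip m)) (nil_shift m)) X
     = (\<integral>\<^sup>+x. indicator X x \<partial>distr nil_measure (restrict_space lborel (nil_strip m)) (nil_shift m))"
    using X by simp
  also have "\<dots> = (\<integral>\<^sup>+x. indicator X (nil_shift m x) \<partial>nil_measure)"
    using X by (intro nn_integral_distr[OF ms]) auto
  also have "\<dots> = (\<integral>\<^sup>+(a, b, c). G (a + of_int m, b, c + of_int m * b) \<partial>nil_measure)"
    by (simp add: G_def nil_shift_def split_beta')
  also have "\<dots> = (\<integral>\<^sup>+x. G x * indicator (nil_strip m) x \<partial>lborel)"
    by (rule nn_integral_nil_strip[symmetric, OF Gm]) (simp add: G_def frac_1_eq)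
  also have "\<dots> = (\<integral>\<^sup>+x. indicator X x \<partial>lborel)"
    using Xs by (intro nn_integral_cong) (auto simp: G_def nil_strip_def indicator_def frac_eq)
  also have "\<dots> = emeasure (restrict_space lborel (nil_strip m)) X"
    using Xs by (simp add: emeasure_restrict_space)
  finally show "emeasure (distr nil_measure (restrict_space lborel (nil_strip m)) (nil_shift m)) X =
     emeasure (restrict_space lborel (nil_strip m)) X" .
qed simp

lemma integral_nil_strip:
  fixes g :: "heis \<Rightarrow> 'a::{banach, second_countable_topology}"
  assumes [measurable]: "g \<in> borel_measurable borel"
    and per: "\<And>a b c. g (a, b, c + 1) = g (a, b, c)"
  shows "(LINT x:nil_strip m|lborel. g x) =
      (LINT (a, b, c)|nil_measure. g (a + of_int m, b, c + of_int m * b))"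
proof -
  have "nil_shift m \<in> measurable nil_measure lborel"
    using borel_measurable_nil[OF borel_measurable_nil_shift] by simp
  then have ms: "nil_shift m \<in> measurable nil_measure (restrict_space lborel (nil_strip m))"
    by (intro measurable_restrict_space2)
      (auto simp: space_nil_measure nil_shift_def nil_strip_def frac_lt_1)
  have gm: "g \<in> borel_measurable (restrict_space lborel (nil_strip m))"
    by (simp add: measurable_restrict_space1)
  have eq: "g (nil_shift m x) = (case x of (a, b, c) \<Rightarrow> g (a + of_int m, b, c + of_int m * b))" for x
    by (cases x) (use periodic_frac[of "\<lambda>c. g (_, _, c)"] per in \<open>auto simp: nil_shift_def\<close>)
  show ?thesis
    unfolding set_lebesgue_integral_def
    using integral_distr[OF ms gm]
    by (simp add: distr_nil_shift eq integral_restrict_space)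
qed

section \<open>Lebesgue spaces on the nilmanifold\<close>

text \<open>Young's inequality for f and g scaled to norm one. If one norm is zero this scaling is
  impossible, but then the product vanishes almost everywhere.\<close>

lemma Hoelder:
  fixes f g :: "'a \<Rightarrow> real"
  assumes pq: "p > 1" "q > 1" "1 / p + 1 / q = 1"
    and [measurable]: "f \<in> borel_measurable M" "g \<in> borel_measurable M"
    and nonneg: "\<And>x. 0 \<le> f x" "\<And>x. 0 \<le> g x"
    and int: "integrable M (\<lambda>x. f x powr p)" "integrable M (\<lambda>x. g x powr q)"
  shows "integrable M (\<lambda>x. f x * g x)"
    and "(LINT x|M. f x * g x) \<le> (LINT x|M. f x powr p) powr (1 / p) * (LINT x|M. g x powr q) powr (1 / q)"
proof -
  have young: "f x * g x \<le> f x powr p / p + g x powr q / q" for x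
    by (rule Youngs_inequality) (use pq nonneg in auto)
  have sum_int: "integrable M (\<lambda>x. f x powr p / p + g x powr q / q)"
    using int by auto
  show fg: "integrable M (\<lambda>x. f x * g x)"
    by (rule Bochner_Integration.integrable_bound[OF sum_int])
      (use young nonneg in \<open>auto intro!: AE_I2 order_trans[OF _ abs_ge_self] simp: abs_mult\<close>)
  define F where "F = (LINT x|M. f x powr p)"
  define G where "G = (LINT x|M. g x powr q)"
  have F0: "F \<ge> 0" and G0: "G \<ge> 0" by (auto simp: F_def G_def)
  have zero: "(LINT x|M. f x * g x) = 0" if "F = 0 \<or> G = 0"
  proof -
    have "AE x in M. f x * g x = 0"
      using that
    proof
      assume "F = 0"
      then have "AE x in M. f x powr p = 0"
        using integral_nonneg_eq_0_iff_AE[OF int(1)] by (simp add: F_def)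
      then show ?thesis by eventually_elim simp
    next
      assume "G = 0"
      then have "AE x in M. g x powr q = 0"
        using integral_nonneg_eq_0_iff_AE[OF int(2)] by (simp add: G_def)
      then show ?thesis by eventually_elim simp
    qed
    then show ?thesis by (simp add: integral_eq_zero_AE)
  qed
  show "(LINT x|M. f x * g x) \<le> (LINT x|M. f x powr p) powr (1 / p) * (LINT x|M. g x powr q) powr (1 / q)"
  proof (cases "F = 0 \<or> G = 0")
    case True
    then show ?thesis using zero by (auto simp: F_def G_def)
  next
    case False
    then have pos: "F > 0" "G > 0" using F0 G0 by auto
    define a where "a = F powr (1 / p)"
    define b where "b = G powr (1 / q)"
    have ab: "a > 0" "b > 0" "a powr p = F" "b powr q = G"
      using pos pq by (auto simp: a_def b_def powr_powr)
    have "(LINT x|M. f x * g x) / (a * b) = (LINT x|M. (f x / a) * (g x / b))"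
      by simp
    also have "\<dots> \<le> (LINT x|M. f x powr p / F / p + g x powr q / G / q)"
    proof (rule integral_mono)
      show "integrable M (\<lambda>x. (f x / a) * (g x / b))" using fg by simp
      show "integrable M (\<lambda>x. f x powr p / F / p + g x powr q / G / q)" using int by auto
      fix x
      show "(f x / a) * (g x / b) \<le> f x powr p / F / p + g x powr q / G / q"
        using Youngs_inequality[OF pq, of "f x / a" "g x / b"] nonneg[of x] ab
        by (simp add: powr_divide)
    qed
    also have "\<dots> = 1 / p + 1 / q"
      using int pos by (simp add: F_def[symmetric] G_def[symmetric])
    finally have "(LINT x|M. f x * g x) / (a * b) \<le> 1" using pq by simp
    then show ?thesis using ab by (simp add: a_def b_def F_def G_def divide_le_eq)
  qed
qed

lemma borel_measurable_cnj [measurable (raw)]: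
  assumes "f \<in> borel_measurable M" shows "(\<lambda>x. cnj (f x)) \<in> borel_measurable M"
  by (rule measurable_compose[OF assms borel_measurable_continuous_onI]) (intro continuous_intros)

text \<open>A real number, for arithmetic without infinite values. A diverging integral has the
  default value 0 here, so this is the norm only together with membership in
  \<open>nil_Lp p\<close>.\<close>

definition nil_rnorm :: "real \<Rightarrow> (heis \<Rightarrow> complex) \<Rightarrow> real" where
  "nil_rnorm p f = (LINT x|nil_measure. cmod (f x) powr p) powr (1 / p)"

lemma nil_rnorm_nonneg [simp]: "nil_rnorm p f \<ge> 0"
  by (simp add: nil_rnorm_def)

lemma nil_norm_eq: "f \<in> nil_Lp p \<Longrightarrow> nil_norm p f = ennreal (nil_rnorm p f)"
  by (simp add: nil_norm_def nil_rnorm_def)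

lemma nil_LpD:
  assumes "f \<in> nil_Lp p"
  shows "nil_invariant f" "f \<in> borel_measurable borel" "f \<in> borel_measurable nil_measure"
    "integrable nil_measure (\<lambda>x. cmod (f x) powr p)"
  using assms borel_measurable_nil by (auto simp: nil_Lp_def)

lemma
  assumes pq: "p > 1" "q > 1" "1 / p + 1 / q = 1" and f: "f \<in> nil_Lp p" and g: "g \<in> nil_Lp q"
  shows nil_Lp_integrable_mult: "integrable nil_measure (\<lambda>x. f x * cnj (g x))"
    and nil_Hoelder: "cmod (nil_inner f g) \<le> nil_rnorm p f * nil_rnorm q g"
    and nil_Hoelder_abs: "(LINT x|nil_measure. cmod (f x) * cmod (g x)) \<le> nil_rnorm p f * nil_rnorm q g"
proof -
  note [measurable] = nil_LpD(3)[OF f] nil_LpD(3)[OF g]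
  have 1: "integrable nil_measure (\<lambda>x. cmod (f x) * cmod (g x))"
    by (rule Hoelder[OF pq]) (use f g in \<open>auto dest: nil_LpD(4)\<close>)
  show 2: "integrable nil_measure (\<lambda>x. f x * cnj (g x))"
    by (rule Bochner_Integration.integrable_bound[OF 1]) (auto simp: norm_mult)
  show 3: "(LINT x|nil_measure. cmod (f x) * cmod (g x)) \<le> nil_rnorm p f * nil_rnorm q g"
    unfolding nil_rnorm_def
    by (rule Hoelder[OF pq]) (use f g in \<open>auto dest: nil_LpD(4)\<close>)
  show "cmod (nil_inner f g) \<le> nil_rnorm p f * nil_rnorm q g"
    unfolding nil_inner_def
    by (rule order_trans[OF integral_norm_bound]) (use 3 in \<open>simp add: norm_mult\<close>)
qed

lemmas nil_L2_integrable_mult = nil_Lp_integrable_mult[of 2 2, simplified]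
lemmas nil_Cauchy_Schwarz = nil_Hoelder[of 2 2, simplified]
lemmas nil_Cauchy_Schwarz_abs = nil_Hoelder_abs[of 2 2, simplified]

lemma nil_invariant_add: "nil_invariant f \<Longrightarrow> nil_invariant g \<Longrightarrow> nil_invariant (\<lambda>x. f x + g x)"
  and nil_invariant_mult: "nil_invariant f \<Longrightarrow> nil_invariant g \<Longrightarrow> nil_invariant (\<lambda>x. f x * g x)"
  and nil_invariant_cmult: "nil_invariant f \<Longrightarrow> nil_invariant (\<lambda>x. c * f x)"
  and nil_invariant_cnj: "nil_invariant f \<Longrightarrow> nil_invariant (\<lambda>x. cnj (f x))"
  and nil_invariant_const: "nil_invariant (\<lambda>x. c)"
  by (auto simp: nil_invariant_def)

lemma nil_L2_iff:
  "f \<in> nil_Lp 2 \<longleftrightarrow> nil_invariant f \<and> f \<in> borel_measurable borel \<and>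
     integrable nil_measure (\<lambda>x. (cmod (f x))\<^sup>2)"
  by (simp add: nil_Lp_def)

lemma nil_L2_cmult: "f \<in> nil_Lp 2 \<Longrightarrow> (\<lambda>x. c * f x) \<in> nil_Lp 2"
  by (auto simp: nil_L2_iff nil_invariant_cmult norm_mult power_mult_distrib)

lemma nil_L2_add:
  assumes "f \<in> nil_Lp 2" "g \<in> nil_Lp 2" shows "(\<lambda>x. f x + g x) \<in> nil_Lp 2"
proof -
  note [measurable] = nil_LpD(3)[OF assms(1)] nil_LpD(3)[OF assms(2)]
  have "integrable nil_measure (\<lambda>x. (cmod (f x + g x))\<^sup>2)"
  proof (rule Bochner_Integration.integrable_bound)
    show "integrable nil_measure (\<lambda>x. 2 * (cmod (f x))\<^sup>2 + 2 * (cmod (g x))\<^sup>2)"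
      using assms by (auto simp: nil_L2_iff)
    have "(cmod (f x + g x))\<^sup>2 \<le> 2 * (cmod (f x))\<^sup>2 + 2 * (cmod (g x))\<^sup>2" for x
    proof -
      have "(cmod (f x + g x))\<^sup>2 \<le> (cmod (f x) + cmod (g x))\<^sup>2"
        by (intro power_mono norm_triangle_ineq) auto
      also have "\<dots> \<le> 2 * (cmod (f x))\<^sup>2 + 2 * (cmod (g x))\<^sup>2"
        using sum_squares_bound[of "cmod (f x)" "cmod (g x)"] by (simp add: power2_sum)
      finally show ?thesis .
    qed
    then show "AE x in nil_measure. norm ((cmod (f x + g x))\<^sup>2) \<le> norm (2 * (cmod (f x))\<^sup>2 + 2 * (cmod (g x))\<^sup>2)"
      by auto
  qed auto
  then show ?thesis using assms by (auto simp: nil_L2_iff nil_invariant_add)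
qed

lemma nil_L2_diff: "f \<in> nil_Lp 2 \<Longrightarrow> g \<in> nil_Lp 2 \<Longrightarrow> (\<lambda>x. f x - g x) \<in> nil_Lp 2"
  using nil_L2_add[of f "\<lambda>x. - 1 * g x"] nil_L2_cmult[of g "-1"] by simp

lemma nil_L2_zero: "(\<lambda>x. 0) \<in> nil_Lp 2"
  by (simp add: nil_L2_iff nil_invariant_const)

lemma nil_L2_sum: "(\<And>i. i \<in> I \<Longrightarrow> F i \<in> nil_Lp 2) \<Longrightarrow> (\<lambda>x. \<Sum>i\<in>I. F i x) \<in> nil_Lp 2"
  by (induction I rule: infinite_finite_induct) (auto intro: nil_L2_add nil_L2_zero)

lemma nil_inner_cnj: "nil_inner g f = cnj (nil_inner f g)"
proof -
  have "(\<lambda>x. g x * cnj (f x)) = (\<lambda>x. cnj (f x * cnj (g x)))"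
    by (simp add: fun_eq_iff mult.commute)
  then show ?thesis unfolding nil_inner_def by (simp only: Bochner_Integration.integral_cnj)
qed

lemma nil_inner_cmult_left: "nil_inner (\<lambda>x. c * f x) g = c * nil_inner f g"
  by (simp add: nil_inner_def mult.assoc)

lemma nil_inner_cmult_right: "nil_inner f (\<lambda>x. c * g x) = cnj c * nil_inner f g"
  by (simp add: nil_inner_def mult.left_commute)

lemma nil_inner_diff_left:
  "f \<in> nil_Lp 2 \<Longrightarrow> g \<in> nil_Lp 2 \<Longrightarrow> h \<in> nil_Lp 2 \<Longrightarrow>
    nil_inner (\<lambda>x. f x - g x) h = nil_inner f h - nil_inner g h"
  by (simp add: nil_inner_def left_diff_distrib nil_L2_integrable_mult)

lemma nil_inner_add_left:
  "f \<in> nil_Lp 2 \<Longrightarrow> g \<in> nil_Lp 2 \<Longrightarrow> h \<in> nil_Lp 2 \<Longrightarrow>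
    nil_inner (\<lambda>x. f x + g x) h = nil_inner f h + nil_inner g h"
  by (simp add: nil_inner_def distrib_right nil_L2_integrable_mult)

lemma nil_inner_sum_left:
  assumes "\<And>i. i \<in> I \<Longrightarrow> F i \<in> nil_Lp 2" "h \<in> nil_Lp 2"
  shows "nil_inner (\<lambda>x. \<Sum>i\<in>I. F i x) h = (\<Sum>i\<in>I. nil_inner (F i) h)"
  using assms unfolding nil_inner_def
  by (simp add: sum_distrib_right Bochner_Integration.integral_sum nil_L2_integrable_mult)

lemma nil_inner_sum_right:
  assumes "p > 1" "q > 1" "1 / p + 1 / q = 1" "\<And>i. i \<in> I \<Longrightarrow> F i \<in> nil_Lp q" "h \<in> nil_Lp p"
  shows "nil_inner h (\<lambda>x. \<Sum>i\<in>I. F i x) = (\<Sum>i\<in>I. nil_inner h (F i))"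
  using assms unfolding nil_inner_def
  by (simp add: sum_distrib_left Bochner_Integration.integral_sum nil_Lp_integrable_mult[OF assms(1-3)])

lemma nil_inner_cong_AE:
  assumes "AE x in nil_measure. f x = f' x" "f \<in> borel_measurable borel" "f' \<in> borel_measurable borel"
    "h \<in> borel_measurable borel"
  shows "nil_inner f h = nil_inner f' h"
  unfolding nil_inner_def
proof (rule integral_cong_AE)
  show "AE x in nil_measure. f x * cnj (h x) = f' x * cnj (h x)"
    using assms(1) by eventually_elim simp
qed (use assms(2-)[THEN borel_measurable_nil] in auto)

lemma nil_rnorm_cong_AE:
  assumes "AE x in nil_measure. f x = f' x" "f \<in> borel_measurable borel" "f' \<in> borel_measurable borel"
  shows "nil_rnorm p f = nil_rnorm p f'"
  unfolding nil_rnorm_def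
proof (rule arg_cong[where f = "\<lambda>x. x powr _"], rule integral_cong_AE)
  show "AE x in nil_measure. cmod (f x) powr p = cmod (f' x) powr p"
    using assms(1) by eventually_elim simp
qed (use assms(2-)[THEN borel_measurable_nil] in auto)

lemma nil_rnorm_2_eq: "nil_rnorm 2 f = sqrt (LINT x|nil_measure. (cmod (f x))\<^sup>2)"
  by (simp add: nil_rnorm_def powr_half_sqrt)

lemma nil_inner_self: "nil_inner f f = of_real ((nil_rnorm 2 f)\<^sup>2)"
  unfolding nil_inner_def nil_rnorm_2_eq
  by (simp add: complex_norm_square[symmetric] del: of_real_power)

lemma nil_rnorm_2_eq_0:
  assumes "f \<in> nil_Lp 2" "nil_rnorm 2 f = 0" shows "AE x in nil_measure. f x = 0"
proof -
  have "(LINT x|nil_measure. (cmod (f x))\<^sup>2) = 0"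
    using assms(2) by (simp add: nil_rnorm_2_eq)
  then have "AE x in nil_measure. (cmod (f x))\<^sup>2 = 0"
    using assms(1) by (subst (asm) integral_nonneg_eq_0_iff_AE) (auto simp: nil_L2_iff)
  then show ?thesis by eventually_elim simp
qed

text \<open>By Cauchy-Schwarz, norm convergence implies weak convergence. This is how identities for
  smooth functions pass to the closed operator.\<close>

lemma nil_inner_tendsto:
  assumes \<phi>: "\<And>n. \<phi> n \<in> nil_Lp 2" and f: "f \<in> nil_Lp 2" and h: "h \<in> nil_Lp 2"
    and lim: "(\<lambda>n. nil_norm 2 (\<lambda>x. \<phi> n x - f x)) \<longlonglongrightarrow> 0"
  shows "(\<lambda>n. nil_inner (\<phi> n) h) \<longlonglongrightarrow> nil_inner f h"
proof (rule LIM_zero_cancel, rule Lim_null_comparison)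
  have "(\<lambda>n. ennreal (nil_rnorm 2 (\<lambda>x. \<phi> n x - f x))) \<longlonglongrightarrow> ennreal 0"
    using lim by (simp add: nil_norm_eq nil_L2_diff \<phi> f)
  then have "(\<lambda>n. nil_rnorm 2 (\<lambda>x. \<phi> n x - f x)) \<longlonglongrightarrow> 0"
    by (subst (asm) tendsto_ennreal_iff) auto
  then show "(\<lambda>n. nil_rnorm 2 (\<lambda>x. \<phi> n x - f x) * nil_rnorm 2 h) \<longlonglongrightarrow> 0"
    by (intro tendsto_mult_left_zero)
  show "\<forall>\<^sub>F n in sequentially. norm (nil_inner (\<phi> n) h - nil_inner f h)
      \<le> nil_rnorm 2 (\<lambda>x. \<phi> n x - f x) * nil_rnorm 2 h"
    using nil_Cauchy_Schwarz[OF nil_L2_diff[OF \<phi> f] h]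
    by (simp add: nil_inner_diff_left \<phi> f h)
qed

lemma nil_Lp_bounded:
  assumes "nil_invariant f" "f \<in> borel_measurable borel" "\<And>x. x \<in> space nil_measure \<Longrightarrow> cmod (f x) \<le> B" "p > 0"
  shows "f \<in> nil_Lp p"
proof -
  have "integrable nil_measure (\<lambda>x. cmod (f x) powr p)"
  proof (rule nil.integrable_const_bound[where B = "B powr p"])
    show "AE x in nil_measure. norm (cmod (f x) powr p) \<le> B powr p"
      using assms(3,4) by (auto intro!: AE_I2 powr_mono2)
  qed (use borel_measurable_nil[OF assms(2)] in auto)
  then show ?thesis using assms by (auto simp: nil_Lp_def)
qed

lemma nil_Lp_continuous:
  assumes "nil_invariant f" "continuous_on UNIV f" "p > 0"
  shows "f \<in> nil_Lp p"
proof -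
  have "compact ({0..1} \<times> {0..1} \<times> {0..1} :: heis set)"
    by (rule compact_Times, rule compact_Icc, rule compact_Times, rule compact_Icc, rule compact_Icc)
  then have "compact (f ` ({0..1} \<times> {0..1} \<times> {0..1}))"
    by (rule compact_continuous_image[rotated]) (rule continuous_on_subset[OF assms(2) subset_UNIV])
  then have "bounded (f ` ({0..1} \<times> {0..1} \<times> {0..1}))"
    by (rule compact_imp_bounded)
  then obtain B where B: "\<forall>y \<in> f ` ({0..1} \<times> {0..1} \<times> {0..1}). cmod y \<le> B"
    unfolding bounded_iff by blast
  have "cmod (f x) \<le> B" if "x \<in> space nil_measure" for x
    using B that by (auto simp: space_nil_measure)
  moreover have "f \<in> borel_measurable borel"
    using assms(2) by (rule borel_measurable_continuous_onI)
  ultimately show ?thesis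
    using nil_Lp_bounded assms by blast
qed

section \<open>Smooth functions and left-invariant fields\<close>

declare split_paired_All [simp del] split_paired_Ex [simp del]

lemma cont_diff_imp_continuous: "cont_diff k f \<Longrightarrow> continuous_on UNIV f"
  by (cases k) (auto simp: continuous_on_eq_continuous_at intro: differentiable_imp_continuous_within)

lemma cont_diff_SucI:
  assumes "\<And>x. (f has_derivative f' x) (at x)" "\<And>v. cont_diff k (\<lambda>x. f' x v)"
  shows "cont_diff (Suc k) f"
proof -
  have "frechet_derivative f (at x) = f' x" for x
    using frechet_derivative_at[OF assms(1)] by simp
  moreover have "f differentiable (at x)" for x
    using assms(1) by (rule differentiableI)
  ultimately show ?thesis using assms(2) by simp
qed

lemma cont_diff_Suc_imp: "cont_diff (Suc k) f \<Longrightarrow> cont_diff k f"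
proof (induction k arbitrary: f)
  case 0
  then show ?case using cont_diff_imp_continuous[OF 0] by simp
next
  case (Suc k)
  then have "f differentiable (at x)" "cont_diff (Suc k) (\<lambda>x. frechet_derivative f (at x) v)" for x v
    by (subst (asm) cont_diff.simps, blast)+
  then show ?case using Suc.IH by (subst cont_diff.simps) blast
qed

lemma has_derivative_frechet:
  "cont_diff (Suc k) f \<Longrightarrow> (f has_derivative frechet_derivative f (at x)) (at x)"
  using frechet_derivative_works by auto

lemma cont_diff_const: "cont_diff k (\<lambda>x. c)"
proof (induction k arbitrary: c)
  case (Suc k)
  then show ?case by (intro cont_diff_SucI[where f' = "\<lambda>_ _. 0"]) (auto intro: Suc)
qed simp

lemma cont_diff_add: "cont_diff k f \<Longrightarrow> cont_diff k g \<Longrightarrow> cont_diff k (\<lambda>x. f x + g x)"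
proof (induction k arbitrary: f g)
  case (Suc k)
  show ?case
    by (rule cont_diff_SucI[OF has_derivative_add[OF has_derivative_frechet[OF Suc.prems(1)]
            has_derivative_frechet[OF Suc.prems(2)]]])
      (use Suc in auto)
qed (auto intro: continuous_intros)

lemma cont_diff_mult: "cont_diff k f \<Longrightarrow> cont_diff k g \<Longrightarrow> cont_diff k (\<lambda>x. f x * g x)"
proof (induction k arbitrary: f g)
  case (Suc k)
  show ?case
    by (rule cont_diff_SucI[OF has_derivative_mult[OF has_derivative_frechet[OF Suc.prems(1)]
            has_derivative_frechet[OF Suc.prems(2)]]])
      (intro cont_diff_add Suc.IH cont_diff_Suc_imp[OF Suc.prems(1)] cont_diff_Suc_imp[OF Suc.prems(2)];
       use Suc.prems in simp)
qed (auto intro: continuous_intros)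

lemma cont_diff_cnj: "cont_diff k f \<Longrightarrow> cont_diff k (\<lambda>x. cnj (f x))"
proof (induction k arbitrary: f)
  case (Suc k)
  show ?case
    by (rule cont_diff_SucI[OF bounded_linear.has_derivative[OF bounded_linear_cnj
            has_derivative_frechet[OF Suc.prems]]])
      (use Suc in auto)
qed (auto intro: continuous_intros)

lemma cont_diff_fst: "cont_diff k (\<lambda>x. of_real (fst x))"
proof (cases k)
  case (Suc j)
  have "((\<lambda>x. complex_of_real (fst x)) has_derivative (\<lambda>h. of_real (fst h))) (at x)" for x :: heis
    by (intro bounded_linear_imp_has_derivative bounded_linear_compose[OF bounded_linear_of_real bounded_linear_fst])
  then show ?thesis unfolding Suc by (rule cont_diff_SucI) (rule cont_diff_const)
qed (auto intro: continuous_intros)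

text \<open>A vector field is given by its coefficient vector w at each point, so that the product
  rule and integration by parts are proved once for A, B and the central field.\<close>

definition lie_field :: "(heis \<Rightarrow> heis) \<Rightarrow> (heis \<Rightarrow> complex) \<Rightarrow> heis \<Rightarrow> complex" where
  "lie_field w f x = frechet_derivative f (at x) (w x)"

text \<open>The fields A, B and their commutator, the derivative in c.\<close>

definition left_fields :: "(heis \<Rightarrow> heis) set" where
  "left_fields = {\<lambda>x. (1, 0, 0), \<lambda>x. (0, 1, fst x), \<lambda>x. (0, 0, 1)}"

lemma left_fieldsI [simp]:
  "(\<lambda>x. (1, 0, 0)) \<in> left_fields" "(\<lambda>x. (0, 1, fst x)) \<in> left_fields" "(\<lambda>x. (0, 0, 1)) \<in> left_fields"
  by (auto simp: left_fields_def)

definition field_C :: "(heis \<Rightarrow> complex) \<Rightarrow> heis \<Rightarrow> complex" where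
  "field_C f x = frechet_derivative f (at x) (0, 0, 1)"

lemma nil_smooth_iff: "f \<in> nil_smooth \<longleftrightarrow> nil_invariant f \<and> (\<forall>k. cont_diff k f)"
  by (auto simp: nil_smooth_def)

lemma nil_smooth_has_derivative:
  "f \<in> nil_smooth \<Longrightarrow> (f has_derivative frechet_derivative f (at x)) (at x)"
  by (rule has_derivative_frechet[of 0]) (simp add: nil_smooth_iff)

lemma nil_smooth_linear: "f \<in> nil_smooth \<Longrightarrow> linear (frechet_derivative f (at x))"
  using has_derivative_linear[OF nil_smooth_has_derivative] .

lemma frechet_derivative_B:
  assumes "f \<in> nil_smooth"
  shows "frechet_derivative f (at x) (0, 1, t) =
      frechet_derivative f (at x) (0, 1, 0) + of_real t * frechet_derivative f (at x) (0, 0, 1)"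
  using linear_add[OF nil_smooth_linear[OF assms], of x "(0, 1, 0)" "(0, 0, t)"]
    linear_scale[OF nil_smooth_linear[OF assms], of x t "(0, 0, 1)"]
  by (simp add: scaleR_conv_of_real)

lemma nil_smooth_continuous: "f \<in> nil_smooth \<Longrightarrow> continuous_on UNIV f"
  by (rule cont_diff_imp_continuous[of 0]) (simp add: nil_smooth_iff)

lemma nil_smooth_borel: "f \<in> nil_smooth \<Longrightarrow> f \<in> borel_measurable borel"
  by (rule borel_measurable_continuous_onI[OF nil_smooth_continuous])

lemma nil_smooth_Lp: "f \<in> nil_smooth \<Longrightarrow> p > 0 \<Longrightarrow> f \<in> nil_Lp p"
  by (rule nil_Lp_continuous[OF _ nil_smooth_continuous]) (simp_all add: nil_smooth_iff)

lemma nil_smooth_mult: "f \<in> nil_smooth \<Longrightarrow> g \<in> nil_smooth \<Longrightarrow> (\<lambda>x. f x * g x) \<in> nil_smooth"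
  and nil_smooth_add: "f \<in> nil_smooth \<Longrightarrow> g \<in> nil_smooth \<Longrightarrow> (\<lambda>x. f x + g x) \<in> nil_smooth"
  and nil_smooth_cnj: "f \<in> nil_smooth \<Longrightarrow> (\<lambda>x. cnj (f x)) \<in> nil_smooth"
  and nil_smooth_const: "(\<lambda>x. c) \<in> nil_smooth"
  by (auto simp: nil_smooth_iff cont_diff_mult cont_diff_add cont_diff_cnj cont_diff_const
      nil_invariant_mult nil_invariant_add nil_invariant_cnj nil_invariant_const)

lemma nil_smooth_cmult: "f \<in> nil_smooth \<Longrightarrow> (\<lambda>x. c * f x) \<in> nil_smooth"
  by (intro nil_smooth_mult nil_smooth_const)

lemma nil_smooth_sum: "(\<And>i. i \<in> I \<Longrightarrow> F i \<in> nil_smooth) \<Longrightarrow> (\<lambda>x. \<Sum>i\<in>I. F i x) \<in> nil_smooth"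
  by (induction I rule: infinite_finite_induct) (auto intro: nil_smooth_add nil_smooth_const)

text \<open>The derivative of a smooth function descends to the nilmanifold because the field
  commutes with left translations: differentiate f composed with L, where L is translation by a
  lattice element.\<close>

lemma lie_field_smooth:
  assumes f: "f \<in> nil_smooth" and w: "w \<in> left_fields"
  shows "lie_field w f \<in> nil_smooth"
proof -
  have D: "cont_diff k (\<lambda>x. frechet_derivative f (at x) v)" for k v
    using f by (auto simp: nil_smooth_iff dest: spec[of _ "Suc k"])
  have smooth: "cont_diff k (lie_field w f)" for k
    using w unfolding left_fields_def lie_field_def
    by (auto simp: frechet_derivative_B[OF f, of _ "fst _"] intro!: D cont_diff_add cont_diff_mult cont_diff_fst)
  have "lie_field w f (heis_mult \<gamma> x) = lie_field w f x" if \<gamma>: "\<gamma> \<in> heis_lattice" for \<gamma> x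
  proof -
    obtain m n k where \<gamma>_eq: "\<gamma> = (m, n, k)" by (cases \<gamma>)
    define L where "L = heis_mult \<gamma>"
    have L_eq: "L = (\<lambda>x. (m + fst x, n + fst (snd x), k + snd (snd x) + m * fst (snd x)))"
      by (auto simp: L_def \<gamma>_eq heis_mult_def)
    have dL: "(L has_derivative (\<lambda>h. (fst h, fst (snd h), snd (snd h) + m * fst (snd h)))) (at x)"
      unfolding L_eq by (auto intro!: derivative_eq_intros)
    have "((\<lambda>x. f (L x)) has_derivative
        (\<lambda>h. frechet_derivative f (at (L x)) (fst h, fst (snd h), snd (snd h) + m * fst (snd h)))) (at x)"
      by (rule has_derivative_compose[OF dL nil_smooth_has_derivative[OF f]])
    moreover have "(\<lambda>x. f (L x)) = f"
      using f \<gamma> by (auto simp: nil_smooth_iff nil_invariant_def L_def)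
    ultimately have "(f has_derivative
        (\<lambda>h. frechet_derivative f (at (L x)) (fst h, fst (snd h), snd (snd h) + m * fst (snd h)))) (at x)"
      by simp
    note frechet_derivative_at[OF this]
    then have eq: "frechet_derivative f (at x) h =
        frechet_derivative f (at (L x)) (fst h, fst (snd h), snd (snd h) + m * fst (snd h))" for h
      by (rule fun_cong[OF sym])
    \<comment> \<open>The differential of \<open>L\<close> carries \<open>w x\<close> to
      \<open>w (L x)\<close> for each of the three fields, which is their left invariance.\<close>
    show ?thesis
      using w unfolding left_fields_def lie_field_def
      by (auto simp: eq L_def[symmetric]) (simp_all add: L_eq add.commute)
  qed
  then show ?thesis using smooth by (auto simp: nil_smooth_iff nil_invariant_def)
qed

lemma field_A_eq: "field_A f = lie_field (\<lambda>x. (1, 0, 0)) f"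
  by (simp add: fun_eq_iff field_A_def lie_field_def)

lemma field_C_eq: "field_C f = lie_field (\<lambda>x. (0, 0, 1)) f"
  by (simp add: fun_eq_iff field_C_def lie_field_def)

lemma field_B_eq: "f \<in> nil_smooth \<Longrightarrow> field_B f = lie_field (\<lambda>x. (0, 1, fst x)) f"
  by (simp add: fun_eq_iff field_B_def lie_field_def frechet_derivative_B[of f _ "fst _"])

lemma lie_field_mult:
  "f \<in> nil_smooth \<Longrightarrow> g \<in> nil_smooth \<Longrightarrow>
    lie_field w (\<lambda>x. f x * g x) = (\<lambda>x. f x * lie_field w g x + lie_field w f x * g x)"
  using has_derivative_mult[OF nil_smooth_has_derivative nil_smooth_has_derivative, THEN frechet_derivative_at, symmetric]
  by (simp add: fun_eq_iff lie_field_def)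

lemma lie_field_add:
  "f \<in> nil_smooth \<Longrightarrow> g \<in> nil_smooth \<Longrightarrow>
    lie_field w (\<lambda>x. f x + g x) = (\<lambda>x. lie_field w f x + lie_field w g x)"
  using has_derivative_add[OF nil_smooth_has_derivative nil_smooth_has_derivative, THEN frechet_derivative_at, symmetric]
  by (simp add: fun_eq_iff lie_field_def)

lemma lie_field_cnj:
  "f \<in> nil_smooth \<Longrightarrow> lie_field w (\<lambda>x. cnj (f x)) = (\<lambda>x. cnj (lie_field w f x))"
  using bounded_linear.has_derivative[OF bounded_linear_cnj nil_smooth_has_derivative, THEN frechet_derivative_at, symmetric]
  by (simp add: fun_eq_iff lie_field_def)

lemma lie_field_const: "lie_field w (\<lambda>x. c) = (\<lambda>x. 0)"
  by (simp add: fun_eq_iff lie_field_def frechet_derivative_const)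

lemma lie_field_cmult:
  "f \<in> nil_smooth \<Longrightarrow> lie_field w (\<lambda>x. c * f x) = (\<lambda>x. c * lie_field w f x)"
  by (simp add: lie_field_mult nil_smooth_const lie_field_const)

section \<open>Integration by parts for the left-invariant fields\<close>

lemma distr_unit_lborel_shift: "distr unit_lborel unit_lborel (\<lambda>c. frac (c + t)) = unit_lborel"
proof (rule measure_eqI)
  have "(\<lambda>c. frac (c + t)) \<in> borel_measurable borel"
    by (simp add: frac_def)
  then have m: "(\<lambda>c. frac (c + t)) \<in> measurable unit_lborel unit_lborel"
    unfolding unit_lborel_def
    by (intro measurable_restrict_space2) (auto simp: frac_lt_1 measurable_restrict_space1)
  fix X assume "X \<in> sets (distr unit_lborel unit_lborel (\<lambda>c. frac (c + t)))"
  then have X: "X \<in> sets unit_lborel" by simp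
  then have XB: "X \<in> sets borel" and Xs: "X \<subseteq> {0..<1}"
    by (auto simp: unit_lborel_def sets_restrict_space)
  have fr: "(\<lambda>c::real. frac c) \<in> borel_measurable borel" by (simp add: frac_def)
  have "emeasure (distr unit_lborel unit_lborel (\<lambda>c. frac (c + t))) X
     = (\<integral>\<^sup>+x. indicator X x \<partial>distr unit_lborel unit_lborel (\<lambda>c. frac (c + t)))"
    using X by simp
  also have "\<dots> = (\<integral>\<^sup>+c. indicator X (frac (c + t)) \<partial>unit_lborel)"
    using X by (intro nn_integral_distr[OF m]) auto
  also have "\<dots> = (\<integral>\<^sup>+c. indicator X (frac c) \<partial>unit_lborel)"
    by (rule nn_integral_unit_lborel_shift[of "\<lambda>c. indicator X (frac c)"])
      (use measurable_compose[OF fr borel_measurable_indicator[OF XB]] in \<open>simp_all add: frac_1_eq\<close>)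
  also have "\<dots> = (\<integral>\<^sup>+c. indicator X c \<partial>unit_lborel)"
    by (intro nn_integral_cong) (auto simp: frac_eq)
  also have "\<dots> = emeasure unit_lborel X" using X by simp
  finally show "emeasure (distr unit_lborel unit_lborel (\<lambda>c. frac (c + t))) X = emeasure unit_lborel X" .
qed simp

lemma integral_unit_lborel_shift:
  fixes g :: "real \<Rightarrow> complex"
  assumes "g \<in> borel_measurable borel" and per: "\<And>x. g (x + 1) = g x"
  shows "(LINT c|unit_lborel. g (c + t)) = (LINT c|unit_lborel. g c)"
proof -
  have "(\<lambda>c. frac (c + t)) \<in> borel_measurable borel"
    by (simp add: frac_def)
  then have m: "(\<lambda>c. frac (c + t)) \<in> measurable unit_lborel unit_lborel"
    unfolding unit_lborel_def
    by (intro measurable_restrict_space2) (auto simp: frac_lt_1 measurable_restrict_space1)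
  have "(LINT c|unit_lborel. g c) = (LINT c|distr unit_lborel unit_lborel (\<lambda>c. frac (c + t)). g c)"
    by (simp add: distr_unit_lborel_shift)
  also have "\<dots> = (LINT c|unit_lborel. g (frac (c + t)))"
    by (rule integral_distr[OF m borel_measurable_unit_lborel[OF assms(1)]])
  also have "\<dots> = (LINT c|unit_lborel. g (c + t))"
    using periodic_frac[of g] per by simp
  finally show ?thesis by simp
qed

lemma integral_unit_lborel_Icc:
  fixes g :: "real \<Rightarrow> 'a::{banach, second_countable_topology}"
  assumes [measurable]: "g \<in> borel_measurable borel"
  shows "(LINT a|unit_lborel. g a) = (LINT a:{0..1}|lborel. g a)"
proof -
  have "(LINT a|unit_lborel. g a) = (LINT a:{0..<1}|lborel. g a)"
    unfolding unit_lborel_def set_lebesgue_integral_def by (subst integral_restrict_space) auto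
  also have "\<dots> = (LINT a:{0..1}|lborel. g a)"
    unfolding set_lebesgue_integral_def
  proof (rule integral_cong_AE)
    have "AE a in lborel. a \<noteq> (1::real)" by (rule AE_lborel_singleton)
    then show "AE a in lborel. indicat_real {0..<1} a *\<^sub>R g a = indicat_real {0..1} a *\<^sub>R g a"
      by eventually_elim (auto simp: indicator_def)
  qed auto
  finally show ?thesis .
qed

lemma integral_unit_lborel_FTC:
  fixes g :: "real \<Rightarrow> complex"
  assumes "\<And>t. (g has_vector_derivative g' t) (at t)" "continuous_on UNIV g'"
  shows "(LINT a|unit_lborel. g' a) = g 1 - g 0"
proof -
  have "(LINT a|unit_lborel. g' a) = (LINT a:{0..1}|lborel. g' a)"
    by (rule integral_unit_lborel_Icc[OF borel_measurable_continuous_onI[OF assms(2)]])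
  also have "\<dots> = g 1 - g 0"
    unfolding set_lebesgue_integral_def
    by (rule integral_FTC_Icc)
      (auto intro: has_vector_derivative_at_within[OF assms(1)] continuous_on_subset[OF assms(2)])
  finally show ?thesis .
qed

lemma integrable_continuous_on_compact:
  fixes f :: "'a::topological_space \<Rightarrow> 'b::{banach, second_countable_topology}"
  assumes "finite_measure M" "f \<in> borel_measurable M" "space M \<subseteq> K" "compact K" "continuous_on UNIV f"
  shows "integrable M f"
proof -
  interpret finite_measure M by fact
  have "compact (f ` K)"
    using assms(4) by (rule compact_continuous_image[rotated]) (rule continuous_on_subset[OF assms(5) subset_UNIV])
  then have "bounded (f ` K)" by (rule compact_imp_bounded)
  then obtain B where B: "\<forall>y\<in>f ` K. norm y \<le> B" unfolding bounded_iff by blast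
  show ?thesis
  proof (rule integrable_const_bound)
    show "AE x in M. norm (f x) \<le> B" using B assms(3) by (intro AE_I2) blast
  qed fact
qed

lemma unit_lborel_pair_eq:
  "unit_lborel \<Otimes>\<^sub>M unit_lborel = restrict_space lborel ({0..<1} \<times> {0..<1})"
  unfolding unit_lborel_def by (simp add: pair_restrict_space lborel_prod sigma_finite_lborel)

lemma borel_measurable_unit_lborel2:
  "f \<in> borel_measurable borel \<Longrightarrow> f \<in> borel_measurable (unit_lborel \<Otimes>\<^sub>M unit_lborel)"
  by (simp add: unit_lborel_pair_eq measurable_restrict_space1)

lemma integrable_unit_lborel_continuous:
  fixes f :: "real \<Rightarrow> 'b::{banach, second_countable_topology}"
  assumes "continuous_on UNIV f" shows "integrable unit_lborel f"
proof (rule integrable_continuous_on_compact[OF _ _ _ _ assms])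
  show "space unit_lborel \<subseteq> {0..1}" by auto
  show "compact {0..1::real}" by (rule compact_Icc)
qed (use assms unit_lborel.finite_measure_axioms in \<open>auto intro: borel_measurable_unit_lborel borel_measurable_continuous_onI\<close>)

lemma integrable_unit_lborel2_continuous:
  fixes f :: "real \<times> real \<Rightarrow> 'b::{banach, second_countable_topology}"
  assumes "continuous_on UNIV f" shows "integrable (unit_lborel \<Otimes>\<^sub>M unit_lborel) f"
proof (rule integrable_continuous_on_compact[OF _ _ _ _ assms])
  show "space (unit_lborel \<Otimes>\<^sub>M unit_lborel) \<subseteq> {0..1} \<times> {0..1}" by (auto simp: space_pair_measure)
  show "compact ({0..1::real} \<times> {0..1::real})" by (rule compact_Times[OF compact_Icc compact_Icc])
  show "finite_measure (unit_lborel \<Otimes>\<^sub>M unit_lborel)" by unfold_locales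
qed (use assms in \<open>auto intro: borel_measurable_unit_lborel2 borel_measurable_continuous_onI\<close>)

lemma integrable_nil_continuous:
  fixes f :: "heis \<Rightarrow> 'b::{banach, second_countable_topology}"
  assumes "continuous_on UNIV f" shows "integrable nil_measure f"
proof (rule integrable_continuous_on_compact[OF _ _ _ _ assms])
  show "space nil_measure \<subseteq> {0..1} \<times> {0..1} \<times> {0..1}" by (auto simp: space_nil_measure)
  show "compact ({0..1} \<times> {0..1} \<times> {0..1} :: heis set)"
    by (rule compact_Times, rule compact_Icc, rule compact_Times, rule compact_Icc, rule compact_Icc)
qed (use assms nil.finite_measure_axioms in \<open>auto intro: borel_measurable_nil borel_measurable_continuous_onI\<close>)

lemma continuous_on_section:
  assumes "continuous_on UNIV f" "continuous_on UNIV h"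
  shows "continuous_on UNIV (\<lambda>t. f (h t))"
  using continuous_on_compose2[OF assms(1) assms(2)] by simp

lemma
  fixes g :: "heis \<Rightarrow> 'b::{banach, second_countable_topology}"
  assumes g: "continuous_on UNIV g"
  shows nil_fubini_a: "(LINT x|nil_measure. g x) =
      (LINT y|(unit_lborel \<Otimes>\<^sub>M unit_lborel). (LINT a|unit_lborel. g (a, y)))"
    and nil_fubini: "(LINT x|nil_measure. g x) =
      (LINT a|unit_lborel. (LINT y|(unit_lborel \<Otimes>\<^sub>M unit_lborel). g (a, y)))"
proof -
  have i: "integrable (unit_lborel \<Otimes>\<^sub>M (unit_lborel \<Otimes>\<^sub>M unit_lborel)) g"
    using integrable_nil_continuous[OF g] by (simp add: nil_measure_eq)
  show "(LINT x|nil_measure. g x) =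
      (LINT y|(unit_lborel \<Otimes>\<^sub>M unit_lborel). (LINT a|unit_lborel. g (a, y)))"
    using unit_lborel3.integral_snd[of "\<lambda>a y. g (a, y)"] i by (simp add: nil_measure_eq)
  show "(LINT x|nil_measure. g x) =
      (LINT a|unit_lborel. (LINT y|(unit_lborel \<Otimes>\<^sub>M unit_lborel). g (a, y)))"
    using unit_lborel3.integral_fst'[OF i] by (simp add: nil_measure_eq)
qed

lemma
  fixes g :: "real \<times> real \<Rightarrow> 'b::{banach, second_countable_topology}"
  assumes g: "continuous_on UNIV g"
  shows unit_lborel2_fubini_snd: "(LINT x|(unit_lborel \<Otimes>\<^sub>M unit_lborel). g x) =
      (LINT c|unit_lborel. (LINT b|unit_lborel. g (b, c)))"
    and unit_lborel2_fubini: "(LINT x|(unit_lborel \<Otimes>\<^sub>M unit_lborel). g x) =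
      (LINT b|unit_lborel. (LINT c|unit_lborel. g (b, c)))"
  using unit_lborel2.integral_snd[of "\<lambda>b c. g (b, c)"] unit_lborel2.integral_fst'[of g]
    integrable_unit_lborel2_continuous[OF g] by simp_all

lemma nil_invariantD:
  assumes "nil_invariant f"
  shows "f (a + of_int m, b + of_int n, c + of_int k + of_int m * b) = f (a, b, c)"
proof -
  have "f (heis_mult (of_int m, of_int n, of_int k) (a, b, c)) = f (a, b, c)"
    using assms by (auto simp: nil_invariant_def heis_lattice_def)
  then show ?thesis by (simp add: heis_mult_def add_ac)
qed

lemma nil_invariant_periodic_c: "nil_invariant f \<Longrightarrow> f (a, b, c + 1) = f (a, b, c)"
  using nil_invariantD[of f a 0 b 0 c 1] by simp

lemma nil_smooth_vector_derivative:
  assumes f: "f \<in> nil_smooth" and L: "(L has_vector_derivative w) (at t)"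
  shows "((\<lambda>t. f (L t)) has_vector_derivative frechet_derivative f (at (L t)) w) (at t)"
proof -
  have "((\<lambda>t. f (L t)) has_derivative (\<lambda>h. frechet_derivative f (at (L t)) (h *\<^sub>R w))) (at t)"
    using has_derivative_compose[OF L[unfolded has_vector_derivative_def] nil_smooth_has_derivative[OF f]] .
  then show ?thesis
    by (simp add: has_vector_derivative_def linear_scale[OF nil_smooth_linear[OF f]])
qed

lemma nil_smooth_continuous_derivative:
  assumes "f \<in> nil_smooth"
  shows "continuous_on UNIV (\<lambda>x. frechet_derivative f (at x) v)"
  using assms by (auto simp: nil_smooth_iff intro!: cont_diff_imp_continuous[of 0] dest: spec[of _ "Suc 0"])

text \<open>Each partial derivative is integrated along its own coordinate first, and invariance
  cancels the two boundary values. In b and c they coincide pointwise; in a they agree only after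
  integration over c.\<close>

lemma integral_lie_field:
  assumes f: "f \<in> nil_smooth" and w: "w \<in> left_fields"
  shows "(LINT x|nil_measure. lie_field w f x) = 0"
proof -
  have inv: "nil_invariant f" using f by (simp add: nil_smooth_iff)
  have cf: "continuous_on UNIV f" by (rule nil_smooth_continuous[OF f])
  note cD = nil_smooth_continuous_derivative[OF f]
  have A: "(LINT x|nil_measure. frechet_derivative f (at x) (1, 0, 0)) = 0"
  proof -
    have "(LINT a|unit_lborel. frechet_derivative f (at (a, y)) (1, 0, 0)) = f (1, y) - f (0, y)" for y
    proof (rule integral_unit_lborel_FTC)
      show "((\<lambda>t. f (t, y)) has_vector_derivative frechet_derivative f (at (t, y)) (1, 0, 0)) (at t)" for t
        by (rule nil_smooth_vector_derivative[OF f])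
          (auto simp: has_vector_derivative_def zero_prod_def[symmetric] intro!: derivative_eq_intros)
      show "continuous_on UNIV (\<lambda>a. frechet_derivative f (at (a, y)) (1, 0, 0))"
        by (rule continuous_on_section[OF cD]) (intro continuous_intros)
    qed
    then have "(LINT x|nil_measure. frechet_derivative f (at x) (1, 0, 0))
        = (LINT y|(unit_lborel \<Otimes>\<^sub>M unit_lborel). f (1, y) - f (0, y))"
      by (simp add: nil_fubini_a[OF cD])
    also have "\<dots> = (LINT b|unit_lborel. (LINT c|unit_lborel. f (1, b, c) - f (0, b, c)))"
      by (rule unit_lborel2_fubini)
        (intro continuous_intros continuous_on_section[OF cf])
    also have "\<dots> = (LINT b|unit_lborel. 0)"
    proof (intro Bochner_Integration.integral_cong refl)
      fix b
      have c: "continuous_on UNIV (\<lambda>c. f (1, b, c))" "continuous_on UNIV (\<lambda>c. f (0, b, c))"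
        by (intro continuous_intros continuous_on_section[OF cf])+
      \<comment> \<open>The faces a = 0 and a = 1 are glued with a shear in c, which integration
        over a full period removes.\<close>
      have "f (1, b, c) = f (0, b, c + - b)" for c
        using nil_invariantD[OF inv, of 0 1 b 0 "c - b" 0] by simp
      then have "(LINT c|unit_lborel. f (1, b, c)) = (LINT c|unit_lborel. f (0, b, c))"
        using integral_unit_lborel_shift[of "\<lambda>c. f (0, b, c)" "- b"]
          nil_invariant_periodic_c[OF inv] borel_measurable_continuous_onI[OF c(2)] by simp
      then show "(LINT c|unit_lborel. f (1, b, c) - f (0, b, c)) = 0"
        using c by (simp add: integrable_unit_lborel_continuous)
    qed
    finally show ?thesis by simp
  qed
  have B: "(LINT x|nil_measure. frechet_derivative f (at x) (0, 1, 0)) = 0"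
  proof -
    have "(LINT b|unit_lborel. frechet_derivative f (at (a, b, c)) (0, 1, 0)) = f (a, 1, c) - f (a, 0, c)" for a c
    proof (rule integral_unit_lborel_FTC)
      show "((\<lambda>t. f (a, t, c)) has_vector_derivative frechet_derivative f (at (a, t, c)) (0, 1, 0)) (at t)" for t
        by (rule nil_smooth_vector_derivative[OF f])
          (auto simp: has_vector_derivative_def intro!: derivative_eq_intros)
      show "continuous_on UNIV (\<lambda>b. frechet_derivative f (at (a, b, c)) (0, 1, 0))"
        by (rule continuous_on_section[OF cD]) (intro continuous_intros)
    qed
    moreover have "f (a, 1, c) = f (a, 0, c)" for a c
      using nil_invariantD[OF inv, of a 0 0 1 c 0] by simp
    ultimately have "(LINT y|(unit_lborel \<Otimes>\<^sub>M unit_lborel). frechet_derivative f (at (a, y)) (0, 1, 0)) = 0" for a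
      by (subst unit_lborel2_fubini_snd) (auto intro!: continuous_on_section[OF cD] continuous_intros)
    then show ?thesis by (simp add: nil_fubini[OF cD])
  qed
  have C0: "(LINT c|unit_lborel. frechet_derivative f (at (a, b, c)) (0, 0, 1)) = 0" for a b
  proof -
    have "(LINT c|unit_lborel. frechet_derivative f (at (a, b, c)) (0, 0, 1)) = f (a, b, 1) - f (a, b, 0)"
    proof (rule integral_unit_lborel_FTC)
      show "((\<lambda>t. f (a, b, t)) has_vector_derivative frechet_derivative f (at (a, b, t)) (0, 0, 1)) (at t)" for t
        by (rule nil_smooth_vector_derivative[OF f])
          (auto simp: has_vector_derivative_def intro!: derivative_eq_intros)
      show "continuous_on UNIV (\<lambda>c. frechet_derivative f (at (a, b, c)) (0, 0, 1))"
        by (rule continuous_on_section[OF cD]) (intro continuous_intros)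
    qed
    then show ?thesis using nil_invariant_periodic_c[OF inv, of a b 0] by simp
  qed
  \<comment> \<open>The weight \<open>h\<close> depends on a alone, so it leaves the integral over c
    intact. \<open>h\<close> is the identity for the coefficient a in B, and constant 1 for the
    central field.\<close>
  have C: "(LINT x|nil_measure. of_real (h (fst x)) * frechet_derivative f (at x) (0, 0, 1)) = 0"
    if "continuous_on UNIV h" for h :: "real \<Rightarrow> real"
  proof -
    have cont: "continuous_on UNIV (\<lambda>x. of_real (h (fst x)) * frechet_derivative f (at x) (0, 0, 1))"
      by (intro continuous_intros continuous_on_section[OF that] cD)
    have "(LINT y|(unit_lborel \<Otimes>\<^sub>M unit_lborel). frechet_derivative f (at (a, y)) (0, 0, 1)) = 0" for a
      by (subst unit_lborel2_fubini)
        (auto simp: C0 intro!: continuous_intros continuous_on_section[OF cD])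
    then show ?thesis by (simp add: nil_fubini[OF cont])
  qed
  have B': "(LINT x|nil_measure. frechet_derivative f (at x) (0, 1, fst x)) = 0"
  proof -
    have "(LINT x|nil_measure. frechet_derivative f (at x) (0, 1, 0)
        + of_real (fst x) * frechet_derivative f (at x) (0, 0, 1)) = 0"
      using B C[of "\<lambda>a. a"]
      by (subst Bochner_Integration.integral_add)
        (auto intro!: integrable_nil_continuous cD continuous_intros)
    then show ?thesis by (simp add: frechet_derivative_B[OF f, of _ "fst _"])
  qed
  show ?thesis
    using w A B' C[of "\<lambda>_. 1"] by (auto simp: left_fields_def lie_field_def)
qed

text \<open>The derivative of f times the conjugate of g has integral zero. The resulting skew
  symmetry yields the energy identity, the symmetry of the sub-Laplacian and the orthogonality of
  weights.\<close>

lemma nil_inner_lie_field: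
  assumes f: "f \<in> nil_smooth" and g: "g \<in> nil_smooth" and w: "w \<in> left_fields"
  shows "nil_inner (lie_field w f) g = - nil_inner f (lie_field w g)"
proof -
  have 1: "integrable nil_measure (\<lambda>x. f x * cnj (lie_field w g x))"
    "integrable nil_measure (\<lambda>x. lie_field w f x * cnj (g x))"
    by (intro nil_L2_integrable_mult nil_smooth_Lp lie_field_smooth f g w; simp)+
  have "(LINT x|nil_measure. lie_field w (\<lambda>x. f x * cnj (g x)) x) = 0"
    by (intro integral_lie_field nil_smooth_mult nil_smooth_cnj f g w)
  then have "(LINT x|nil_measure. f x * cnj (lie_field w g x) + lie_field w f x * cnj (g x)) = 0"
    by (simp add: lie_field_mult lie_field_cnj nil_smooth_cnj f g)
  then have "nil_inner f (lie_field w g) + nil_inner (lie_field w f) g = 0"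
    using 1 by (simp add: nil_inner_def)
  then show ?thesis by (simp add: add_eq_0_iff)
qed

lemma field_A_smooth: "f \<in> nil_smooth \<Longrightarrow> field_A f \<in> nil_smooth"
  and field_B_smooth: "f \<in> nil_smooth \<Longrightarrow> field_B f \<in> nil_smooth"
  by (simp_all add: field_A_eq field_B_eq lie_field_smooth)

lemma nil_inner_field_A:
  "f \<in> nil_smooth \<Longrightarrow> g \<in> nil_smooth \<Longrightarrow> nil_inner (field_A f) g = - nil_inner f (field_A g)"
  and nil_inner_field_B:
  "f \<in> nil_smooth \<Longrightarrow> g \<in> nil_smooth \<Longrightarrow> nil_inner (field_B f) g = - nil_inner f (field_B g)"
  and nil_inner_field_C:
  "f \<in> nil_smooth \<Longrightarrow> g \<in> nil_smooth \<Longrightarrow> nil_inner (field_C f) g = - nil_inner f (field_C g)"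
  by (simp_all add: field_A_eq field_B_eq field_C_eq nil_inner_lie_field)

lemma sublaplacian_eq:
  "sublaplacian f = (\<lambda>x. -1 * (field_A (field_A f) x + field_B (field_B f) x))"
  by (simp add: fun_eq_iff sublaplacian_def)

lemma sublaplacian_smooth: "f \<in> nil_smooth \<Longrightarrow> sublaplacian f \<in> nil_smooth"
  unfolding sublaplacian_eq by (intro nil_smooth_cmult nil_smooth_add field_A_smooth field_B_smooth)

lemma nil_inner_sublaplacian:
  assumes "f \<in> nil_smooth" "g \<in> nil_smooth"
  shows "nil_inner (sublaplacian f) g =
    nil_inner (field_A f) (field_A g) + nil_inner (field_B f) (field_B g)"
proof -
  have "nil_inner (sublaplacian f) g = - (nil_inner (field_A (field_A f)) g + nil_inner (field_B (field_B f)) g)"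
    unfolding sublaplacian_eq nil_inner_cmult_left
    by (subst nil_inner_add_left) (simp_all add: nil_smooth_Lp field_A_smooth field_B_smooth assms)
  also have "\<dots> = nil_inner (field_A f) (field_A g) + nil_inner (field_B f) (field_B g)"
    by (simp add: nil_inner_field_A nil_inner_field_B field_A_smooth field_B_smooth assms)
  finally show ?thesis .
qed

lemma sublaplacian_symmetric:
  assumes "f \<in> nil_smooth" "g \<in> nil_smooth"
  shows "nil_inner (sublaplacian f) g = nil_inner f (sublaplacian g)"
proof -
  have "nil_inner f (sublaplacian g) = cnj (nil_inner (sublaplacian g) f)" by (rule nil_inner_cnj)
  then show ?thesis
    using nil_inner_cnj[of "field_A f" "field_A g"] nil_inner_cnj[of "field_B f" "field_B g"]
    by (simp add: nil_inner_sublaplacian assms)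
qed

lemma sublaplacian_add:
  assumes "f \<in> nil_smooth" "g \<in> nil_smooth"
  shows "sublaplacian (\<lambda>x. f x + g x) = (\<lambda>x. sublaplacian f x + sublaplacian g x)"
  using assms
  by (simp add: fun_eq_iff sublaplacian_def field_A_eq field_B_eq lie_field_add lie_field_smooth nil_smooth_add)

lemma sublaplacian_cmult:
  assumes "f \<in> nil_smooth"
  shows "sublaplacian (\<lambda>x. c * f x) = (\<lambda>x. c * sublaplacian f x)"
  using assms
  by (simp add: fun_eq_iff sublaplacian_def field_A_eq field_B_eq lie_field_cmult lie_field_smooth
      nil_smooth_cmult algebra_simps)

section \<open>A Ladyzhenskaya inequality on the nilmanifold\<close>

text \<open>One factor F is bounded by a function of a alone, the other by a function of b alone,
  and the integral of the product of these two bounds factorises. This is the two-dimensional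
  Gagliardo argument.\<close>

lemma (in pair_sigma_finite) nn_integral_square_le_product:
  assumes [measurable]: "F \<in> borel_measurable (M1 \<Otimes>\<^sub>M M2)" "FA \<in> borel_measurable (M1 \<Otimes>\<^sub>M M2)"
      "FB \<in> borel_measurable (M1 \<Otimes>\<^sub>M M2)"
    and A: "\<And>a b. a \<in> space M1 \<Longrightarrow> b \<in> space M2 \<Longrightarrow> F (a, b) \<le> (\<integral>\<^sup>+a'. FA (a', b) \<partial>M1)"
    and B: "\<And>a b. a \<in> space M1 \<Longrightarrow> b \<in> space M2 \<Longrightarrow> F (a, b) \<le> (\<integral>\<^sup>+b'. FB (a, b') \<partial>M2)"
  shows "(\<integral>\<^sup>+x. F x * F x \<partial>(M1 \<Otimes>\<^sub>M M2)) \<le>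
    (\<integral>\<^sup>+x. FA x \<partial>(M1 \<Otimes>\<^sub>M M2)) * (\<integral>\<^sup>+x. FB x \<partial>(M1 \<Otimes>\<^sub>M M2))"
proof -
  have "(\<integral>\<^sup>+x. F x * F x \<partial>(M1 \<Otimes>\<^sub>M M2)) = (\<integral>\<^sup>+a. \<integral>\<^sup>+b. F (a, b) * F (a, b) \<partial>M2 \<partial>M1)"
    by (subst M2.nn_integral_fst[symmetric]) auto
  also have "\<dots> \<le> (\<integral>\<^sup>+a. \<integral>\<^sup>+b. (\<integral>\<^sup>+b'. FB (a, b') \<partial>M2) * (\<integral>\<^sup>+a'. FA (a', b) \<partial>M1) \<partial>M2 \<partial>M1)"
    by (intro nn_integral_mono mult_mono A B) auto
  also have "\<dots> = (\<integral>\<^sup>+a. (\<integral>\<^sup>+b'. FB (a, b') \<partial>M2) * (\<integral>\<^sup>+b. \<integral>\<^sup>+a'. FA (a', b) \<partial>M1 \<partial>M2) \<partial>M1)"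
    by (intro nn_integral_cong nn_integral_cmult) measurable
  also have "\<dots> = (\<integral>\<^sup>+a. (\<integral>\<^sup>+b'. FB (a, b') \<partial>M2) \<partial>M1) * (\<integral>\<^sup>+b. \<integral>\<^sup>+a'. FA (a', b) \<partial>M1 \<partial>M2)"
    by (intro nn_integral_multc) measurable
  also have "(\<integral>\<^sup>+a. (\<integral>\<^sup>+b'. FB (a, b') \<partial>M2) \<partial>M1) = (\<integral>\<^sup>+x. FB x \<partial>(M1 \<Otimes>\<^sub>M M2))"
    by (rule M2.nn_integral_fst) auto
  also have "(\<integral>\<^sup>+b. \<integral>\<^sup>+a'. FA (a', b) \<partial>M1 \<partial>M2) = (\<integral>\<^sup>+x. FA x \<partial>(M1 \<Otimes>\<^sub>M M2))"
    by (rule nn_integral_snd) auto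
  finally show ?thesis by (simp add: mult.commute)
qed

lemma measure_unit_lborel [simp]: "measure unit_lborel {0..<1} = 1"
  using unit_lborel.prob_space by simp

text \<open>The value at x exceeds the value at any y by at most the total variation; averaging over
  y gives the claim.\<close>

lemma unit_interval_sup_bound:
  fixes g :: "real \<Rightarrow> real"
  assumes g: "\<And>t. (g has_vector_derivative g' t) (at t)" "continuous_on UNIV g'" and x: "x \<in> {0..1}"
  shows "g x \<le> (LINT t|unit_lborel. g t + \<bar>g' t\<bar>)"
proof -
  have cg: "continuous_on UNIV g"
    using g(1) by (auto simp: continuous_on_eq_continuous_at intro: has_vector_derivative_continuous)
  have ca: "continuous_on UNIV (\<lambda>t. \<bar>g' t\<bar>)" by (intro continuous_intros g(2))
  have si: "set_integrable lborel {0..1} (\<lambda>t. \<bar>g' t\<bar>)"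
    by (rule borel_integrable_atLeastAtMost') (rule continuous_on_subset[OF ca], simp)
  have le: "\<bar>g v - g u\<bar> \<le> (LINT t:{0..1}|lborel. \<bar>g' t\<bar>)" if "0 \<le> u" "u \<le> v" "v \<le> 1" for u v
  proof -
    have "(LINT t:{u..v}|lborel. g' t) = g v - g u"
      unfolding set_lebesgue_integral_def using that
      by (intro integral_FTC_Icc)
        (auto intro: has_vector_derivative_at_within[OF g(1)] continuous_on_subset[OF g(2)])
    moreover have "set_integrable lborel {u..v} g'"
      by (rule borel_integrable_atLeastAtMost') (rule continuous_on_subset[OF g(2)], simp)
    ultimately have "\<bar>g v - g u\<bar> \<le> (LINT t:{u..v}|lborel. \<bar>g' t\<bar>)"
      using set_integral_norm_bound[of lborel "{u..v}" g'] by simp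
    also have "\<dots> \<le> (LINT t:{0..1}|lborel. \<bar>g' t\<bar>)"
      unfolding set_lebesgue_integral_def
    proof (rule integral_mono)
      show "integrable lborel (\<lambda>t. indicat_real {u..v} t *\<^sub>R \<bar>g' t\<bar>)"
        using set_integrable_subset[OF si, of "{u..v}"] that unfolding set_integrable_def by simp
      show "integrable lborel (\<lambda>t. indicat_real {0..1} t *\<^sub>R \<bar>g' t\<bar>)"
        using si unfolding set_integrable_def .
    qed (use that in \<open>auto simp: indicator_def\<close>)
    finally show ?thesis .
  qed
  define D where "D = (LINT t|unit_lborel. \<bar>g' t\<bar>)"
  have D: "D = (LINT t:{0..1}|lborel. \<bar>g' t\<bar>)"
    unfolding D_def by (rule integral_unit_lborel_Icc) (rule borel_measurable_continuous_onI[OF ca])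
  have "g x \<le> g y + D" if "y \<in> {0..1}" for y
    using le[of x y] le[of y x] x that unfolding D by (cases "x \<le> y") auto
  then have "(LINT y|unit_lborel. g x) \<le> (LINT y|unit_lborel. g y + D)"
    using integrable_unit_lborel_continuous[OF cg]
    by (intro integral_mono) auto
  also have "\<dots> = (LINT y|unit_lborel. g y) + D"
    using integrable_unit_lborel_continuous[OF cg] by (simp add: unit_lborel.prob_space)
  finally show ?thesis
    using integrable_unit_lborel_continuous[OF cg] integrable_unit_lborel_continuous[OF ca]
    by (simp add: unit_lborel.prob_space D_def)
qed

definition central_weight :: "int \<Rightarrow> (heis \<Rightarrow> complex) \<Rightarrow> bool" where
  "central_weight k f \<longleftrightarrow> (\<forall>a b c. f (a, b, c) = cis (2 * pi * of_int k * c) * f (a, b, 0))"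

lemma central_weight_cmod: "central_weight k f \<Longrightarrow> cmod (f (a, b, c)) = cmod (f (a, b, 0))"
  unfolding central_weight_def by (metis norm_mult norm_cis mult_1)

lemma central_weight_derivative:
  assumes f: "f \<in> nil_smooth" and w: "central_weight k f"
  shows "frechet_derivative f (at (a, b, c)) (0, 0, 1) = \<i> * of_real (2 * pi * of_int k) * f (a, b, c)"
proof (rule vector_derivative_unique_at)
  show "((\<lambda>t. f (a, b, t)) has_vector_derivative frechet_derivative f (at (a, b, c)) (0, 0, 1)) (at c)"
    by (rule nil_smooth_vector_derivative[OF f])
      (auto simp: has_vector_derivative_def intro!: derivative_eq_intros)
  have "((\<lambda>t. cis (2 * pi * of_int k * t) * f (a, b, 0)) has_vector_derivative
      (2 * pi * of_int k) *\<^sub>R (\<i> * cis (2 * pi * of_int k * c)) * f (a, b, 0)) (at c)"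
    unfolding has_vector_derivative_def
    by (rule has_derivative_eq_rhs, (rule derivative_eq_intros refl)+)
      (auto simp: fun_eq_iff scaleR_conv_of_real algebra_simps)
  moreover have "(\<lambda>t. f (a, b, t)) = (\<lambda>t. cis (2 * pi * of_int k * t) * f (a, b, 0))"
    using w unfolding central_weight_def by blast
  moreover have "(2 * pi * of_int k) *\<^sub>R (\<i> * cis (2 * pi * of_int k * c)) * f (a, b, 0) =
      \<i> * of_real (2 * pi * of_int k) * f (a, b, c)"
    using w unfolding central_weight_def by (metis scaleR_conv_of_real mult.assoc mult.commute)
  ultimately show "((\<lambda>t. f (a, b, t)) has_vector_derivative \<i> * of_real (2 * pi * of_int k) * f (a, b, c)) (at c)"
    by simp
qed

lemma cmod_square_has_vector_derivative:
  fixes g :: "real \<Rightarrow> complex"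
  assumes "(g has_vector_derivative g') (at t)"
  shows "((\<lambda>t. (cmod (g t))\<^sup>2) has_vector_derivative 2 * Re (g' * cnj (g t))) (at t)"
proof -
  have "((\<lambda>t. g t * cnj (g t)) has_vector_derivative g t * cnj g' + g' * cnj (g t)) (at t)"
    by (intro has_vector_derivative_mult has_vector_derivative_cnj assms)
  from bounded_linear.has_vector_derivative[OF bounded_linear_Re this]
  show ?thesis
    by (simp add: complex_norm_square[symmetric] algebra_simps del: of_real_power)
qed

text \<open>The square of |f| is a function on the unit square, and it is bounded by integrals along
  either axis. As f need not vanish anywhere, these bounds keep the term |f|^2 besides the
  derivative; Cauchy-Schwarz turns them into norms.\<close>

lemma nil_Ladyzhenskaya:
  assumes f: "f \<in> nil_smooth" and w: "central_weight k f"
  shows "(LINT x|nil_measure. cmod (f x) ^ 4) \<le>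
    ((nil_rnorm 2 f)\<^sup>2 + 2 * nil_rnorm 2 (field_A f) * nil_rnorm 2 f) *
    ((nil_rnorm 2 f)\<^sup>2 + 2 * nil_rnorm 2 (field_B f) * nil_rnorm 2 f)"
proof -
  note cf = nil_smooth_continuous[OF f] and cA = nil_smooth_continuous[OF field_A_smooth[OF f]]
    and cB = nil_smooth_continuous[OF field_B_smooth[OF f]]
    and cD = nil_smooth_continuous_derivative[OF f]
  \<comment> \<open>\<open>HA\<close> and \<open>HB\<close> dominate |f|^2 plus the absolute value
    of its derivative in a and in b respectively.\<close>
  define HA where "HA x = (cmod (f x))\<^sup>2 + 2 * (cmod (field_A f x) * cmod (f x))" for x
  define HB where "HB x = (cmod (f x))\<^sup>2 + 2 * (cmod (field_B f x) * cmod (f x))" for x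
  have cHA: "continuous_on UNIV HA" and cHB: "continuous_on UNIV HB"
    unfolding HA_def HB_def by (intro continuous_intros cf cA cB)+
  have nn: "HA x \<ge> 0" "HB x \<ge> 0" for x by (auto simp: HA_def HB_def)
  have supA: "(cmod (f (a, b, c)))\<^sup>2 \<le> (LINT t|unit_lborel. HA (t, b, c))" if "a \<in> {0..<1}" for a b c
  proof -
    have vd: "((\<lambda>t. f (t, b, c)) has_vector_derivative frechet_derivative f (at (t, b, c)) (1, 0, 0)) (at t)" for t
      by (rule nil_smooth_vector_derivative[OF f])
        (auto simp: has_vector_derivative_def zero_prod_def[symmetric] intro!: derivative_eq_intros)
    define h where "h t = 2 * Re (frechet_derivative f (at (t, b, c)) (1, 0, 0) * cnj (f (t, b, c)))" for t
    have ch: "continuous_on UNIV h"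
      unfolding h_def by (intro continuous_intros continuous_on_section[OF cD] continuous_on_section[OF cf])
    have cf': "continuous_on UNIV (\<lambda>t. f (t, b, c))" "continuous_on UNIV (\<lambda>t. HA (t, b, c))"
      by (intro continuous_intros continuous_on_section[OF cf] continuous_on_section[OF cHA])+
    have "(cmod (f (a, b, c)))\<^sup>2 \<le> (LINT t|unit_lborel. (cmod (f (t, b, c)))\<^sup>2 + \<bar>h t\<bar>)"
      by (rule unit_interval_sup_bound[OF cmod_square_has_vector_derivative[OF vd, folded h_def] ch])
        (use that in auto)
    also have "\<dots> \<le> (LINT t|unit_lborel. HA (t, b, c))"
    proof (intro integral_mono integrable_unit_lborel_continuous cf' continuous_intros ch)
      fix t
      have "\<bar>h t\<bar> \<le> 2 * cmod (field_A f (t, b, c) * cnj (f (t, b, c)))"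
        unfolding h_def field_A_def using abs_Re_le_cmod[of "frechet_derivative f (at (t, b, c)) (1, 0, 0) * cnj (f (t, b, c))"]
        by (simp add: abs_mult)
      then show "(cmod (f (t, b, c)))\<^sup>2 + \<bar>h t\<bar> \<le> HA (t, b, c)"
        by (simp add: HA_def norm_mult)
    qed
    finally show ?thesis .
  qed
  have supB: "(cmod (f (a, b, c)))\<^sup>2 \<le> (LINT t|unit_lborel. HB (a, t, c))" if "b \<in> {0..<1}" for a b c
  proof -
    have vd: "((\<lambda>t. f (a, t, c)) has_vector_derivative frechet_derivative f (at (a, t, c)) (0, 1, 0)) (at t)" for t
      by (rule nil_smooth_vector_derivative[OF f])
        (auto simp: has_vector_derivative_def intro!: derivative_eq_intros)
    define h where "h t = 2 * Re (frechet_derivative f (at (a, t, c)) (0, 1, 0) * cnj (f (a, t, c)))" for t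
    have ch: "continuous_on UNIV h"
      unfolding h_def by (intro continuous_intros continuous_on_section[OF cD] continuous_on_section[OF cf])
    have cf': "continuous_on UNIV (\<lambda>t. f (a, t, c))" "continuous_on UNIV (\<lambda>t. HB (a, t, c))"
      by (intro continuous_intros continuous_on_section[OF cf] continuous_on_section[OF cHB])+
    have "(cmod (f (a, b, c)))\<^sup>2 \<le> (LINT t|unit_lborel. (cmod (f (a, t, c)))\<^sup>2 + \<bar>h t\<bar>)"
      by (rule unit_interval_sup_bound[OF cmod_square_has_vector_derivative[OF vd, folded h_def] ch])
        (use that in auto)
    also have "\<dots> \<le> (LINT t|unit_lborel. HB (a, t, c))"
    proof (intro integral_mono integrable_unit_lborel_continuous cf' continuous_intros ch)
      fix t
      \<comment> \<open>The central part of \<open>B\<close> multiplies \<open>f\<close> by an imaginary number and does not change \<open>\<bar>f\<bar>\<^sup>2\<close>.\<close>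
      have "Re (of_real a * frechet_derivative f (at (a, t, c)) (0, 0, 1) * cnj (f (a, t, c))) = 0"
        unfolding central_weight_derivative[OF f w]
        by (simp add: algebra_simps)
      then have "h t = 2 * Re (field_B f (a, t, c) * cnj (f (a, t, c)))"
        unfolding h_def field_B_def by (simp add: distrib_right del: times_complex.sel)
      then have "\<bar>h t\<bar> \<le> 2 * cmod (field_B f (a, t, c) * cnj (f (a, t, c)))"
        using abs_Re_le_cmod[of "field_B f (a, t, c) * cnj (f (a, t, c))"]
        by (simp add: abs_mult del: times_complex.sel)
      then show "(cmod (f (a, t, c)))\<^sup>2 + \<bar>h t\<bar> \<le> HB (a, t, c)"
        by (simp add: HB_def norm_mult)
    qed
    finally show ?thesis .
  qed
  define F where "F = (\<lambda>(a, b). ennreal ((cmod (f (a, b, 0)))\<^sup>2))"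
  define FA where "FA = (\<lambda>(a, b). \<integral>\<^sup>+c. ennreal (HA (a, b, c)) \<partial>unit_lborel)"
  define FB where "FB = (\<lambda>(a, b). \<integral>\<^sup>+c. ennreal (HB (a, b, c)) \<partial>unit_lborel)"
  \<comment> \<open>The sup bound holds at every height c with the same left side, because |f| does
    not depend on c. Averaging over c turns the right side into \<open>FA\<close> or
    \<open>FB\<close>.\<close>
  have mono_c: "F (a, b) \<le> (\<integral>\<^sup>+t. \<integral>\<^sup>+c. ennreal (H (p t, q t, c)) \<partial>unit_lborel \<partial>unit_lborel)"
    if H: "continuous_on UNIV H" "\<And>x. H x \<ge> (0::real)"
      and sup: "\<And>c. (cmod (f (a, b, c)))\<^sup>2 \<le> (LINT t|unit_lborel. H (p t, q t, c))"
      and pq: "continuous_on UNIV p" "continuous_on UNIV q" for H p q a b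
  proof -
    have c1: "continuous_on UNIV (\<lambda>t. H (p t, q t, c))" for c
      by (intro continuous_on_section[OF H(1)] continuous_intros pq)
    have c2: "continuous_on UNIV (\<lambda>y. H (p (fst y), q (fst y), snd y))"
      by (intro continuous_on_section[OF H(1)] continuous_intros pq continuous_on_section[OF pq(1)] continuous_on_section[OF pq(2)])
    have meas: "(\<lambda>(t, c). ennreal (H (p t, q t, c))) \<in> borel_measurable (unit_lborel \<Otimes>\<^sub>M unit_lborel)"
      using borel_measurable_unit_lborel2[OF borel_measurable_continuous_onI[OF c2]]
      by (simp add: split_beta')
    have "ennreal ((cmod (f (a, b, 0)))\<^sup>2) \<le> (\<integral>\<^sup>+t. ennreal (H (p t, q t, c)) \<partial>unit_lborel)" for c
      using sup[of c] central_weight_cmod[OF w, of a b c] H(2) integrable_unit_lborel_continuous[OF c1]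
      by (subst nn_integral_eq_integral) (auto intro!: ennreal_leI)
    then have "(\<integral>\<^sup>+c. F (a, b) \<partial>unit_lborel) \<le>
        (\<integral>\<^sup>+c. \<integral>\<^sup>+t. ennreal (H (p t, q t, c)) \<partial>unit_lborel \<partial>unit_lborel)"
      by (intro nn_integral_mono) (simp add: F_def)
    also have "\<dots> = (\<integral>\<^sup>+t. \<integral>\<^sup>+c. ennreal (H (p t, q t, c)) \<partial>unit_lborel \<partial>unit_lborel)"
      by (rule unit_lborel2.Fubini'[OF meas])
    finally show ?thesis by (simp add: unit_lborel.emeasure_space_1[simplified])
  qed
  \<comment> \<open>Integrating the c-averages over the square gives back integrals over the
    nilmanifold.\<close>
  have tot: "(\<integral>\<^sup>+x. (\<integral>\<^sup>+c. ennreal (H (fst x, snd x, c)) \<partial>unit_lborel) \<partial>(unit_lborel \<Otimes>\<^sub>M unit_lborel)) =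
      (\<integral>\<^sup>+x. ennreal (H x) \<partial>nil_measure)"
    and meas: "(\<lambda>x. \<integral>\<^sup>+c. ennreal (H (fst x, snd x, c)) \<partial>unit_lborel) \<in> borel_measurable (unit_lborel \<Otimes>\<^sub>M unit_lborel)"
    if H: "continuous_on UNIV H" for H :: "heis \<Rightarrow> real"
  proof -
    have Hm: "H \<in> borel_measurable borel" by (rule borel_measurable_continuous_onI[OF H])
    have c3: "continuous_on UNIV (\<lambda>y. H (fst (fst y), snd (fst y), snd y))"
      by (intro continuous_on_section[OF H] continuous_intros)
    have "(\<lambda>y. H (fst (fst y), snd (fst y), snd y)) \<in> borel_measurable ((unit_lborel \<Otimes>\<^sub>M unit_lborel) \<Otimes>\<^sub>M unit_lborel)"
      by (rule measurable_compose[of "\<lambda>y. (fst (fst y), snd (fst y), snd y)" _ nil_measure H])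
        (simp add: nil_measure_eq, rule borel_measurable_nil[OF Hm])
    then show m: "(\<lambda>x. \<integral>\<^sup>+c. ennreal (H (fst x, snd x, c)) \<partial>unit_lborel) \<in> borel_measurable (unit_lborel \<Otimes>\<^sub>M unit_lborel)"
      by (intro unit_lborel.borel_measurable_nn_integral) (simp add: split_beta')
    show "(\<integral>\<^sup>+x. (\<integral>\<^sup>+c. ennreal (H (fst x, snd x, c)) \<partial>unit_lborel) \<partial>(unit_lborel \<Otimes>\<^sub>M unit_lborel)) =
      (\<integral>\<^sup>+x. ennreal (H x) \<partial>nil_measure)"
      using Hm by (subst unit_lborel.nn_integral_fst[symmetric, OF m]) (simp add: nn_integral_nil_fubini)
  qed
  have FA_eq: "FA = (\<lambda>x. \<integral>\<^sup>+c. ennreal (HA (fst x, snd x, c)) \<partial>unit_lborel)"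
    and FB_eq: "FB = (\<lambda>x. \<integral>\<^sup>+c. ennreal (HB (fst x, snd x, c)) \<partial>unit_lborel)"
    by (auto simp: FA_def FB_def)
  have cF: "continuous_on UNIV (\<lambda>y. (cmod (f (fst y, snd y, 0)))\<^sup>2)"
    by (intro continuous_intros continuous_on_section[OF cf])
  have F_meas: "F \<in> borel_measurable (unit_lborel \<Otimes>\<^sub>M unit_lborel)"
    using borel_measurable_unit_lborel2[OF borel_measurable_continuous_onI[OF cF]]
    by (simp add: F_def split_beta')
  have "(\<integral>\<^sup>+x. F x * F x \<partial>(unit_lborel \<Otimes>\<^sub>M unit_lborel)) \<le>
      (\<integral>\<^sup>+x. FA x \<partial>(unit_lborel \<Otimes>\<^sub>M unit_lborel)) * (\<integral>\<^sup>+x. FB x \<partial>(unit_lborel \<Otimes>\<^sub>M unit_lborel))"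
  proof (rule unit_lborel2.nn_integral_square_le_product[OF F_meas])
    fix a b assume "a \<in> space unit_lborel" "b \<in> space unit_lborel"
    then show "F (a, b) \<le> (\<integral>\<^sup>+a'. FA (a', b) \<partial>unit_lborel)" "F (a, b) \<le> (\<integral>\<^sup>+b'. FB (a, b') \<partial>unit_lborel)"
      using mono_c[OF cHA nn(1), of a b "\<lambda>t. t" "\<lambda>t. b"] mono_c[OF cHB nn(2), of a b "\<lambda>t. a" "\<lambda>t. t"] supA supB
      by (auto simp: FA_def FB_def continuous_intros)
  qed (use meas[OF cHA] meas[OF cHB] in \<open>auto simp: FA_eq FB_eq\<close>)
  also have "(\<integral>\<^sup>+x. FA x \<partial>(unit_lborel \<Otimes>\<^sub>M unit_lborel)) = ennreal (LINT x|nil_measure. HA x)"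
    using tot[OF cHA] nn integrable_nil_continuous[OF cHA] by (simp add: FA_eq nn_integral_eq_integral)
  also have "(\<integral>\<^sup>+x. FB x \<partial>(unit_lborel \<Otimes>\<^sub>M unit_lborel)) = ennreal (LINT x|nil_measure. HB x)"
    using tot[OF cHB] nn integrable_nil_continuous[OF cHB] by (simp add: FB_eq nn_integral_eq_integral)
  also have "(\<integral>\<^sup>+x. F x * F x \<partial>(unit_lborel \<Otimes>\<^sub>M unit_lborel)) = (\<integral>\<^sup>+x. ennreal (cmod (f x) ^ 4) \<partial>nil_measure)"
  proof -
    have c4: "continuous_on UNIV (\<lambda>x. cmod (f x) ^ 4)" by (intro continuous_intros cf)
    have eq: "F x * F x = (\<integral>\<^sup>+c. ennreal (cmod (f (fst x, snd x, c)) ^ 4) \<partial>unit_lborel)" for x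
    proof -
      have "cmod (f (fst x, snd x, c)) ^ 4 = (cmod (f (fst x, snd x, 0)))\<^sup>2 * (cmod (f (fst x, snd x, 0)))\<^sup>2" for c
        by (subst central_weight_cmod[OF w]) (simp flip: power_add)
      then have "(\<integral>\<^sup>+c. ennreal (cmod (f (fst x, snd x, c)) ^ 4) \<partial>unit_lborel) =
          (\<integral>\<^sup>+c. ennreal ((cmod (f (fst x, snd x, 0)))\<^sup>2 * (cmod (f (fst x, snd x, 0)))\<^sup>2) \<partial>unit_lborel)"
        by (intro nn_integral_cong) (simp only:)
      then show ?thesis
        by (simp add: F_def split_beta ennreal_mult[symmetric] unit_lborel.emeasure_space_1[simplified]
            flip: power_add)
    qed
    show ?thesis unfolding eq by (rule tot[OF c4])
  qed
  also have "\<dots> = ennreal (LINT x|nil_measure. cmod (f x) ^ 4)"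
    by (intro nn_integral_eq_integral integrable_nil_continuous continuous_intros cf) auto
  finally have le: "(LINT x|nil_measure. cmod (f x) ^ 4) \<le> (LINT x|nil_measure. HA x) * (LINT x|nil_measure. HB x)"
    using nn by (simp add: ennreal_mult[symmetric] integral_nonneg_AE)
  have bound: "(LINT x|nil_measure. (cmod (f x))\<^sup>2 + 2 * (cmod (g x) * cmod (f x))) \<le>
      (nil_rnorm 2 f)\<^sup>2 + 2 * nil_rnorm 2 g * nil_rnorm 2 f" if g: "g \<in> nil_smooth" for g
  proof -
    have "(LINT x|nil_measure. (cmod (f x))\<^sup>2 + 2 * (cmod (g x) * cmod (f x))) =
        (LINT x|nil_measure. (cmod (f x))\<^sup>2) + 2 * (LINT x|nil_measure. cmod (g x) * cmod (f x))"
      by (subst Bochner_Integration.integral_add)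
        (auto intro!: integrable_nil_continuous continuous_intros cf nil_smooth_continuous[OF g])
    then show ?thesis
      using nil_Cauchy_Schwarz_abs[OF nil_smooth_Lp[OF g] nil_smooth_Lp[OF f]]
      by (simp add: nil_rnorm_2_eq)
  qed
  show ?thesis
    by (rule order_trans[OF le])
      (use bound[OF field_A_smooth[OF f]] bound[OF field_B_smooth[OF f]] nn in
        \<open>auto simp: HA_def[symmetric] HB_def[symmetric] intro!: mult_mono integral_nonneg_AE\<close>)
qed

lemma eigenfunction_L4_bound:
  assumes f: "f \<in> nil_smooth" and w: "central_weight k f" and \<mu>: "\<mu> \<ge> 0"
    and eig: "sublaplacian f = (\<lambda>x. of_real (\<mu>\<^sup>2) * f x)"
  shows "(LINT x|nil_measure. cmod (f x) ^ 4) \<le> (1 + 2 * \<mu>)\<^sup>2 * nil_rnorm 2 f ^ 4"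
proof -
  let ?N = "nil_rnorm 2 f" and ?A = "nil_rnorm 2 (field_A f)" and ?B = "nil_rnorm 2 (field_B f)"
  have "nil_inner (sublaplacian f) f = of_real (\<mu>\<^sup>2) * of_real (?N\<^sup>2)"
    unfolding eig nil_inner_cmult_left nil_inner_self ..
  then have "complex_of_real (?A\<^sup>2 + ?B\<^sup>2) = of_real ((\<mu> * ?N)\<^sup>2)"
    by (simp add: nil_inner_sublaplacian f nil_inner_self power_mult_distrib)
  then have sq: "?A\<^sup>2 + ?B\<^sup>2 = (\<mu> * ?N)\<^sup>2" by (simp only: of_real_eq_iff)
  have "?A \<le> \<mu> * ?N" "?B \<le> \<mu> * ?N"
    by (rule power2_le_imp_le; use sq \<mu> in \<open>simp add: sq[symmetric]\<close>)+
  then have "(?N\<^sup>2 + 2 * ?A * ?N) * (?N\<^sup>2 + 2 * ?B * ?N) \<le> (?N\<^sup>2 + 2 * (\<mu> * ?N) * ?N) * (?N\<^sup>2 + 2 * (\<mu> * ?N) * ?N)"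
    using \<mu> by (intro mult_mono add_mono) (auto intro!: mult_right_mono)
  also have "\<dots> = (1 + 2 * \<mu>)\<^sup>2 * ?N ^ 4" by (simp add: power2_eq_square power4_eq_xxxx algebra_simps)
  finally show ?thesis using nil_Ladyzhenskaya[OF f w] by linarith
qed

section \<open>Theta functions and Hermite polynomials\<close>

definition gauss_poly :: "real \<Rightarrow> real poly \<Rightarrow> real \<Rightarrow> real" where
  "gauss_poly \<kappa> p x = poly p x * exp (- (\<kappa> * x\<^sup>2 / 2))"

text \<open>The polynomial factor left after differentiating \<open>gauss_poly\<close>.
  Differentiation thereby becomes an operation on polynomials.\<close>

definition gauss_deriv :: "real \<Rightarrow> real poly \<Rightarrow> real poly" where
  "gauss_deriv \<kappa> p = pderiv p - smult \<kappa> (pCons 0 p)"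

lemma gauss_poly_has_derivative:
  "(gauss_poly \<kappa> p has_real_derivative gauss_poly \<kappa> (gauss_deriv \<kappa> p) x) (at x)"
proof -
  have "((\<lambda>x. poly p x * exp (- (\<kappa> * x\<^sup>2 / 2))) has_real_derivative
      poly (pderiv p) x * exp (- (\<kappa> * x\<^sup>2 / 2)) + exp (- (\<kappa> * x\<^sup>2 / 2)) * - (\<kappa> * x) * poly p x) (at x)"
    by (rule derivative_eq_intros refl poly_DERIV | simp)+
  then show ?thesis
    by (simp add: gauss_poly_def[abs_def] gauss_deriv_def algebra_simps)
qed

text \<open>The inequality y/n \<le> exp (y/n), raised to the power n.\<close>

lemma power_le_exp:
  fixes y :: real assumes "y \<ge> 0" shows "y ^ n \<le> real n ^ n * exp y"
proof (cases "n = 0")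
  case False
  then have "(y / n) ^ n \<le> exp (y / n) ^ n"
    using assms by (intro power_mono) (auto intro: order_trans[OF _ exp_ge_add_one_self])
  also have "\<dots> = exp y" using False by (simp add: exp_of_nat_mult[symmetric])
  finally show ?thesis using False by (simp add: power_divide field_simps)
qed (use assms in simp)

text \<open>It suffices to treat monomials. The bound of |x|^n by 1 + (x^2)^n allows
  \<open>power_le_exp\<close> to be used with \<kappa> x^2 / 2, which the Gaussian cancels
  exactly.\<close>

lemma gauss_poly_bounded:
  assumes "\<kappa> > 0" shows "\<exists>C. \<forall>x. \<bar>gauss_poly \<kappa> p x\<bar> \<le> C"
proof -
  have mono: "\<bar>x\<bar> ^ n * exp (- (\<kappa> * x\<^sup>2 / 2)) \<le> 1 + real n ^ n * (2 / \<kappa>) ^ n" for x n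
  proof -
    have "\<bar>x\<bar> ^ n \<le> 1 + (x\<^sup>2) ^ n"
    proof (cases "\<bar>x\<bar> \<le> 1")
      case True
      then have "\<bar>x\<bar> ^ n \<le> 1" by (simp add: power_le_one)
      moreover have "(x\<^sup>2) ^ n \<ge> 0" by simp
      ultimately show ?thesis by linarith
    next
      case False
      then have "\<bar>x\<bar> ^ n \<le> (\<bar>x\<bar>\<^sup>2) ^ n"
        by (intro power_mono self_le_power) auto
      then show ?thesis by simp
    qed
    also have "(x\<^sup>2) ^ n = (2 / \<kappa>) ^ n * (\<kappa> * x\<^sup>2 / 2) ^ n"
      using assms by (simp add: power_mult_distrib[symmetric])
    also have "\<dots> \<le> (2 / \<kappa>) ^ n * (real n ^ n * exp (\<kappa> * x\<^sup>2 / 2))"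
      using assms by (intro mult_left_mono power_le_exp) auto
    finally have "\<bar>x\<bar> ^ n * exp (- (\<kappa> * x\<^sup>2 / 2)) \<le>
        (1 + (2 / \<kappa>) ^ n * (real n ^ n * exp (\<kappa> * x\<^sup>2 / 2))) * exp (- (\<kappa> * x\<^sup>2 / 2))"
      by (simp add: mult_right_mono)
    also have "\<dots> = exp (- (\<kappa> * x\<^sup>2 / 2)) + (2 / \<kappa>) ^ n * real n ^ n"
      by (simp add: algebra_simps flip: exp_add)
    also have "\<dots> \<le> 1 + real n ^ n * (2 / \<kappa>) ^ n"
      using assms by (simp add: mult.commute)
    finally show ?thesis .
  qed
  have "\<bar>gauss_poly \<kappa> p x\<bar> \<le> (\<Sum>i\<le>degree p. \<bar>coeff p i\<bar> * (1 + real i ^ i * (2 / \<kappa>) ^ i))" for x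
  proof -
    have "\<bar>gauss_poly \<kappa> p x\<bar> = \<bar>\<Sum>i\<le>degree p. coeff p i * x ^ i * exp (- (\<kappa> * x\<^sup>2 / 2))\<bar>"
      by (simp add: gauss_poly_def poly_altdef sum_distrib_right)
    also have "\<dots> \<le> (\<Sum>i\<le>degree p. \<bar>coeff p i * x ^ i * exp (- (\<kappa> * x\<^sup>2 / 2))\<bar>)"
      by (rule sum_abs)
    also have "\<dots> \<le> (\<Sum>i\<le>degree p. \<bar>coeff p i\<bar> * (1 + real i ^ i * (2 / \<kappa>) ^ i))"
      using mono by (intro sum_mono) (auto simp: abs_mult power_abs mult.assoc intro!: mult_left_mono)
    finally show ?thesis .
  qed
  then show ?thesis by blast
qed

text \<open>Boundedness applied to the polynomial p multiplied by 1 + x^2. Quadratic decay is enough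
  to sum over integer translates.\<close>

lemma gauss_poly_decay:
  assumes "\<kappa> > 0" shows "\<exists>C\<ge>0. \<forall>x. \<bar>gauss_poly \<kappa> p x\<bar> \<le> C / (1 + x\<^sup>2)"
proof -
  obtain C where C: "\<And>x. \<bar>gauss_poly \<kappa> (p * [:1, 0, 1:]) x\<bar> \<le> C"
    using gauss_poly_bounded[OF assms] by blast
  have "gauss_poly \<kappa> (p * [:1, 0, 1:]) x = gauss_poly \<kappa> p x * (1 + x\<^sup>2)" for x
    by (simp add: gauss_poly_def power2_eq_square algebra_simps)
  moreover have pos: "1 + x\<^sup>2 > 0" for x :: real by (simp add: add_pos_nonneg)
  ultimately have "\<bar>gauss_poly \<kappa> p x\<bar> \<le> C / (1 + x\<^sup>2)" for x
    using C[of x] pos[of x] by (simp add: abs_mult pos_le_divide_eq)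
  moreover have "C \<ge> 0" using C[of 0] by linarith
  ultimately show ?thesis by blast
qed

text \<open>Separates the point y from the summation index m, giving bounds that are summable in m
  and locally uniform in y. The difference of 2 y^2 + 2 (y + m)^2 and m^2 is the square of 2 y +
  m.\<close>

lemma Peetre: "1 / (1 + (y + m)\<^sup>2) \<le> 2 * (1 + y\<^sup>2) / (1 + m\<^sup>2)" for y m :: real
proof -
  have "1 + m\<^sup>2 \<le> 2 * (1 + y\<^sup>2) * (1 + (y + m)\<^sup>2)"
  proof -
    have "m\<^sup>2 \<le> 2 * y\<^sup>2 + 2 * (y + m)\<^sup>2"
      using zero_le_power2[of "2 * y + m"] by (simp add: power2_eq_square algebra_simps)
    moreover have "0 \<le> y\<^sup>2 * (y + m)\<^sup>2" by simp
    moreover have "2 * (1 + y\<^sup>2) * (1 + (y + m)\<^sup>2) = 2 + 2 * y\<^sup>2 + 2 * (y + m)\<^sup>2 + 2 * (y\<^sup>2 * (y + m)\<^sup>2)"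
      by (simp only: distrib_left distrib_right mult_1 mult_1_right mult.assoc)
    ultimately show ?thesis by linarith
  qed
  moreover have "1 + m\<^sup>2 > 0" "1 + (y + m)\<^sup>2 > 0" by (simp_all add: add_pos_nonneg)
  ultimately show ?thesis by (simp add: field_simps)
qed

text \<open>The code of an integer m is at most 2 |m| + 1, so the series is dominated by a multiple
  of the sum of 1/q^2.\<close>

lemma summable_int_decode: "summable (\<lambda>q. 1 / (1 + (real_of_int (int_decode q))\<^sup>2))"
proof (rule summable_comparison_test)
  show "summable (\<lambda>q. 8 * (1 / (real (Suc q))\<^sup>2))"
    using inverse_power_summable[of 2, where 'a = real]
    by (intro summable_mult) (subst summable_Suc_iff, simp add: inverse_eq_divide)
  have "norm (1 / (1 + (real_of_int (int_decode q))\<^sup>2)) \<le> 8 * (1 / (real (Suc q))\<^sup>2)" for q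
  proof -
    define m where "m = int_decode q"
    have "int q \<le> 2 * \<bar>m\<bar> + 1"
      using int_decode_inverse[of q] unfolding m_def[symmetric]
      by (auto simp: int_encode_def sum_encode_def split: if_splits)
    then have "real (Suc q) \<le> 2 * \<bar>real_of_int m\<bar> + 2" by linarith
    then have "(real (Suc q))\<^sup>2 \<le> (2 * \<bar>real_of_int m\<bar> + 2)\<^sup>2" by (intro power_mono) auto
    also have "\<dots> \<le> 8 * (1 + (real_of_int m)\<^sup>2)"
      using zero_le_power2[of "\<bar>real_of_int m\<bar> - 1"] by (simp add: power2_eq_square algebra_simps)
    finally show ?thesis
      unfolding m_def[symmetric] by (simp add: divide_simps add_pos_nonneg)
  qed
  then show "\<exists>N. \<forall>q\<ge>N. norm (1 / (1 + (real_of_int (int_decode q))\<^sup>2)) \<le> 8 * (1 / (real (Suc q))\<^sup>2)"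
    by blast
qed

text \<open>The function exp (2 pi i (i b + k c)) g (a + i/k), where the i in front of b is the
  integer index, composed with left multiplication by (m, 0, 0). The shift by i/k makes the
  frequency of b equal to k times (argument of g minus a), so B acts as multiplication by that
  argument.\<close>

definition theta_term :: "int \<Rightarrow> int \<Rightarrow> real poly \<Rightarrow> int \<Rightarrow> heis \<Rightarrow> complex" where
  "theta_term k i p m = (\<lambda>(a, b, c).
     of_real (gauss_poly (2 * pi * \<bar>of_int k\<bar>) p (a + of_int i / of_int k + of_int m)) *
     cis (2 * pi * ((of_int i + of_int k * of_int m) * b + of_int k * c)))"

text \<open>An unordered sum, since left translation by the lattice merely reindexes it; for
  convergence it is enumerated by \<open>int_decode\<close>.\<close>

definition theta :: "int \<Rightarrow> int \<Rightarrow> real poly \<Rightarrow> heis \<Rightarrow> complex" where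
  "theta k i p x = (\<Sum>\<^sub>\<infinity>m. theta_term k i p m x)"

lemma theta_term_bound:
  assumes "k \<noteq> 0"
  shows "\<exists>C\<ge>0. \<forall>x m. cmod (theta_term k i p m x) \<le> C * (1 + (fst x + of_int i / of_int k)\<^sup>2) / (1 + (of_int m)\<^sup>2)"
proof -
  have "2 * pi * \<bar>real_of_int k\<bar> > 0" using assms by simp
  from gauss_poly_decay[OF this, of p] obtain C where C: "C \<ge> 0"
    "\<And>x. \<bar>gauss_poly (2 * pi * \<bar>of_int k\<bar>) p x\<bar> \<le> C / (1 + x\<^sup>2)" by blast
  have "cmod (theta_term k i p m x) \<le> 2 * C * (1 + (fst x + of_int i / of_int k)\<^sup>2) / (1 + (of_int m)\<^sup>2)" for m x
  proof -
    let ?y = "fst x + of_int i / of_int k"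
    have "cmod (theta_term k i p m x) = \<bar>gauss_poly (2 * pi * \<bar>of_int k\<bar>) p (?y + of_int m)\<bar>"
      by (simp add: theta_term_def split_beta norm_mult)
    also have "\<dots> \<le> C * (1 / (1 + (?y + of_int m)\<^sup>2))" using C(2)[of "?y + of_int m"] by simp
    also have "\<dots> \<le> C * (2 * (1 + ?y\<^sup>2) / (1 + (of_int m)\<^sup>2))"
      by (rule mult_left_mono[OF Peetre C(1)])
    finally show ?thesis by (simp add: mult_ac)
  qed
  then show ?thesis using C(1) by (intro exI[of _ "2 * C"]) auto
qed

lemma theta_summable_norm:
  assumes "k \<noteq> 0" shows "summable (\<lambda>q. cmod (theta_term k i p (int_decode q) x))"
proof -
  obtain C where C: "\<And>x m. cmod (theta_term k i p m x) \<le> C * (1 + (fst x + of_int i / of_int k)\<^sup>2) / (1 + (of_int m)\<^sup>2)"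
    using theta_term_bound[OF assms] by blast
  show ?thesis
    by (rule summable_comparison_test'[OF summable_mult[OF summable_int_decode]])
      (use C in simp)
qed

lemma bij_int_decode: "bij int_decode"
  by (rule bijI[OF inj_int_decode surj_int_decode])

lemma theta_sums:
  assumes "k \<noteq> 0" shows "(\<lambda>q. theta_term k i p (int_decode q) x) sums theta k i p x"
proof -
  have s: "summable (\<lambda>q. theta_term k i p (int_decode q) x)"
    by (rule summable_norm_cancel[OF theta_summable_norm[OF assms]])
  have "((\<lambda>q. theta_term k i p (int_decode q) x) has_sum (\<Sum>q. theta_term k i p (int_decode q) x)) UNIV"
    by (rule norm_summable_imp_has_sum[OF theta_summable_norm[OF assms] summable_sums[OF s]])
  moreover have "(\<Sum>\<^sub>\<infinity>q. theta_term k i p (int_decode q) x) = theta k i p x"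
    unfolding theta_def by (rule infsum_reindex_bij_betw[OF bij_int_decode])
  ultimately show ?thesis using s by (metis infsumI summable_sums)
qed

text \<open>Weierstrass M-test. The coordinates b and c enter only through a phase, so bounding a
  suffices.\<close>

lemma theta_uniform_limit:
  assumes "k \<noteq> 0"
  shows "uniform_limit {x. \<bar>fst x\<bar> < R} (\<lambda>n x. \<Sum>q<n. theta_term k i p (int_decode q) x) (theta k i p) sequentially"
proof -
  obtain C where C0: "C \<ge> 0" and C: "\<And>x m. cmod (theta_term k i p m x) \<le> C * (1 + (fst x + of_int i / of_int k)\<^sup>2) / (1 + (of_int m)\<^sup>2)"
    using theta_term_bound[OF assms] by blast
  define s where "s = \<bar>real_of_int i / of_int k\<bar>"
  have "uniform_limit {x. \<bar>fst x\<bar> < R} (\<lambda>n x. \<Sum>q<n. theta_term k i p (int_decode q) x)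
      (\<lambda>x. \<Sum>q. theta_term k i p (int_decode q) x) sequentially"
  proof (rule Weierstrass_m_test)
    show "summable (\<lambda>q. C * (1 + (R + s)\<^sup>2) * (1 / (1 + (real_of_int (int_decode q))\<^sup>2)))"
      by (intro summable_mult summable_int_decode)
    fix q and x :: heis assume "x \<in> {x. \<bar>fst x\<bar> < R}"
    then have "\<bar>fst x + of_int i / of_int k\<bar> \<le> R + s"
      unfolding s_def by (intro order_trans[OF abs_triangle_ineq] add_mono) auto
    then have "(fst x + of_int i / of_int k)\<^sup>2 \<le> (R + s)\<^sup>2"
      by (metis abs_ge_zero power2_abs power_mono)
    then have "C * (1 + (fst x + of_int i / of_int k)\<^sup>2) / (1 + (of_int (int_decode q))\<^sup>2) \<le>
        C * (1 + (R + s)\<^sup>2) / (1 + (of_int (int_decode q))\<^sup>2)"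
      using C0 by (intro divide_right_mono mult_left_mono) auto
    then show "cmod (theta_term k i p (int_decode q) x) \<le> C * (1 + (R + s)\<^sup>2) * (1 / (1 + (real_of_int (int_decode q))\<^sup>2))"
      using C[of "int_decode q" x] by simp
  qed
  then show ?thesis using theta_sums[OF assms] by (simp add: sums_iff)
qed

text \<open>
  \<open>T p\<close> stands for the theta series with polynomial \<open>p\<close> or for one of its terms, so that the same
  formula differentiates the terms and their sum.
\<close>

definition theta_deriv :: "int \<Rightarrow> int \<Rightarrow> real poly \<Rightarrow> (real poly \<Rightarrow> complex) \<Rightarrow> heis \<Rightarrow> heis \<Rightarrow> complex" where
  "theta_deriv k i p T x h = of_real (fst h) * T (gauss_deriv (2 * pi * \<bar>of_int k\<bar>) p) +
     2 * pi * \<i> * of_int k * (of_real (fst (snd h)) * (T (pCons 0 p) - of_real (fst x) * T p) + of_real (snd (snd h)) * T p)"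

lemma theta_term_has_derivative:
  assumes "k \<noteq> 0"
  shows "(theta_term k i p m has_derivative theta_deriv k i p (\<lambda>p. theta_term k i p m x) x) (at x within S)"
proof -
  let ?\<kappa> = "2 * pi * \<bar>real_of_int k\<bar>"
  define s where "s = real_of_int i / of_int k + of_int m"
  define y where "y = (\<lambda>x::heis. fst x + s)"
  define z where "z = (\<lambda>x::heis. 2 * pi * ((of_int i + of_int k * of_int m) * fst (snd x) + of_int k * snd (snd x)))"
  have T: "theta_term k i p m x = of_real (gauss_poly ?\<kappa> p (y x)) * cis (z x)" for p x
    by (simp add: theta_term_def split_beta y_def s_def z_def add.assoc)
  have g: "((\<lambda>x. gauss_poly ?\<kappa> p (y x)) has_derivative (\<lambda>h. gauss_poly ?\<kappa> (gauss_deriv ?\<kappa> p) (y x) * fst h)) (at x within S)"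
    by (rule DERIV_compose_FDERIV[OF gauss_poly_has_derivative, THEN has_derivative_eq_rhs])
      (auto simp: y_def intro!: derivative_eq_intros)
  have zd: "(z has_derivative (\<lambda>h. 2 * pi * ((of_int i + of_int k * of_int m) * fst (snd h) + of_int k * snd (snd h)))) (at x within S)"
    unfolding z_def by (auto intro!: derivative_eq_intros)
  have "((\<lambda>x. of_real (gauss_poly ?\<kappa> p (y x)) * cis (z x)) has_derivative
      (\<lambda>h. of_real (gauss_poly ?\<kappa> p (y x)) * ((2 * pi * ((of_int i + of_int k * of_int m) * fst (snd h) + of_int k * snd (snd h))) *\<^sub>R (\<i> * cis (z x)))
        + of_real (gauss_poly ?\<kappa> (gauss_deriv ?\<kappa> p) (y x) * fst h) * cis (z x))) (at x within S)"
    by (rule has_derivative_mult[OF has_derivative_of_real[OF g] has_derivative_cis[OF zd]])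
  moreover have "of_real (gauss_poly ?\<kappa> p (y x)) * ((2 * pi * ((of_int i + of_int k * of_int m) * fst (snd h) + of_int k * snd (snd h))) *\<^sub>R (\<i> * cis (z x)))
        + of_real (gauss_poly ?\<kappa> (gauss_deriv ?\<kappa> p) (y x) * fst h) * cis (z x) =
      theta_deriv k i p (\<lambda>p. theta_term k i p m x) x h" for h
  proof -
    \<comment> \<open>The frequency in \<open>b\<close> is rewritten through the argument of the Gaussian, so that no factor \<open>m\<close> is left.\<close>
    have ik: "real_of_int i + of_int k * of_int m = of_int k * (y x - fst x)"
      using assms by (simp add: y_def s_def field_simps)
    have gX: "gauss_poly ?\<kappa> (pCons 0 p) (y x) = y x * gauss_poly ?\<kappa> p (y x)"
      by (simp add: gauss_poly_def)
    show ?thesis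
      unfolding theta_deriv_def T gX ik
      by (simp add: scaleR_conv_of_real algebra_simps)
  qed
  moreover have "theta_term k i p m = (\<lambda>x. of_real (gauss_poly ?\<kappa> p (y x)) * cis (z x))"
    by (simp add: fun_eq_iff theta_term_def split_beta y_def s_def z_def add.assoc)
  ultimately show ?thesis by simp
qed

lemma theta_deriv_sum:
  "(\<Sum>q\<in>Q. theta_deriv k i p (T q) x h) = theta_deriv k i p (\<lambda>p. \<Sum>q\<in>Q. T q p) x h"
  by (simp add: theta_deriv_def sum.distrib sum_subtractf sum_distrib_left algebra_simps)

lemma theta_deriv_diff:
  "theta_deriv k i p S x h - theta_deriv k i p T x h = theta_deriv k i p (\<lambda>p. S p - T p) x h"
  by (simp add: theta_deriv_def algebra_simps)

text \<open>Only three polynomials enter the derivative. Uniform convergence of their three theta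
  series therefore controls the derivative series uniformly where a is bounded.\<close>

lemma theta_deriv_bound:
  assumes "\<And>p. p \<in> {q, pCons 0 q, gauss_deriv (2 * pi * \<bar>of_int k\<bar>) q} \<Longrightarrow> cmod (T p) \<le> \<delta>" "\<bar>fst x\<bar> < R" "\<delta> \<ge> 0"
  shows "cmod (theta_deriv k i q T x h) \<le> (1 + 2 * pi * \<bar>of_int k\<bar> * (2 + R)) * \<delta> * norm h"
proof -
  have h: "\<bar>fst h\<bar> \<le> norm h" "\<bar>fst (snd h)\<bar> \<le> norm h" "\<bar>snd (snd h)\<bar> \<le> norm h"
    using norm_fst_le[of "fst h" "snd h"] norm_snd_le[of "snd h" "fst h"]
      norm_fst_le[of "fst (snd h)" "snd (snd h)"] norm_snd_le[of "snd (snd h)" "fst (snd h)"]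
    by auto
  have 1: "cmod (of_real (fst h) * T (gauss_deriv (2 * pi * \<bar>of_int k\<bar>) q)) \<le> norm h * \<delta>"
    unfolding norm_mult norm_of_real by (intro mult_mono h assms) auto
  have "cmod (T (pCons 0 q) - of_real (fst x) * T q) \<le> cmod (T (pCons 0 q)) + cmod (of_real (fst x) * T q)"
    by (rule norm_triangle_ineq4)
  also have "\<dots> \<le> \<delta> + R * \<delta>"
    unfolding norm_mult norm_of_real using assms by (intro add_mono mult_mono) auto
  finally have 2: "cmod (of_real (fst (snd h)) * (T (pCons 0 q) - of_real (fst x) * T q)) \<le> norm h * (\<delta> + R * \<delta>)"
    unfolding norm_mult norm_of_real by (intro mult_mono h) auto
  have 3: "cmod (of_real (snd (snd h)) * T q) \<le> norm h * \<delta>"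
    unfolding norm_mult norm_of_real by (intro mult_mono h assms) auto
  have "cmod (theta_deriv k i q T x h) \<le> norm h * \<delta> + 2 * pi * \<bar>of_int k\<bar> * (norm h * (\<delta> + R * \<delta>) + norm h * \<delta>)"
    unfolding theta_deriv_def
  proof (rule order_trans[OF norm_triangle_ineq], rule add_mono[OF 1])
    have "cmod (2 * pi * \<i> * of_int k) = 2 * pi * \<bar>of_int k\<bar>"
      by (simp add: norm_mult)
    then show "cmod (2 * pi * \<i> * of_int k * (of_real (fst (snd h)) * (T (pCons 0 q) - of_real (fst x) * T q) + of_real (snd (snd h)) * T q))
        \<le> 2 * pi * \<bar>of_int k\<bar> * (norm h * (\<delta> + R * \<delta>) + norm h * \<delta>)"
      unfolding norm_mult[of "2 * pi * \<i> * of_int k"]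
      by (simp only:) (intro mult_left_mono order_trans[OF norm_triangle_ineq] add_mono 2 3; simp)
  qed
  also have "\<dots> = (1 + 2 * pi * \<bar>of_int k\<bar> * (2 + R)) * \<delta> * norm h" by (simp add: algebra_simps)
  finally show ?thesis .
qed

text \<open>Termwise differentiation on the strip |a| < R. It is convex, as the theorem on
  derivatives of series requires, and open, so that the derivative within it is a full
  derivative.\<close>

lemma theta_has_derivative:
  assumes k: "k \<noteq> 0"
  shows "(theta k i p has_derivative theta_deriv k i p (\<lambda>p. theta k i p x) x) (at x)"
proof -
  define R where "R = \<bar>fst x\<bar> + 1"
  define S where "S = {x::heis. \<bar>fst x\<bar> < R}"
  have S_eq: "S = {- R<..<R} \<times> UNIV" by (auto simp: S_def)
  have openS: "open S" unfolding S_eq by (intro open_Times) auto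
  have convexS: "convex S" unfolding S_eq by (intro convex_Times) auto
  have xS: "x \<in> S" by (simp add: S_def R_def)
  let ?f = "\<lambda>q. theta_term k i p (int_decode q)"
  have "\<exists>g. \<forall>y\<in>S. (\<lambda>q. ?f q y) sums g y \<and> (g has_derivative theta_deriv k i p (\<lambda>p. theta k i p y) y) (at y within S)"
  proof (rule has_derivative_series[OF convexS _ _ xS])
    show "(?f q has_derivative theta_deriv k i p (\<lambda>p. theta_term k i p (int_decode q) y) y) (at y within S)" for q y
      by (rule theta_term_has_derivative[OF k])
    show "(\<lambda>q. ?f q x) sums theta k i p x" by (rule theta_sums[OF k])
    fix e :: real assume e: "e > 0"
    \<comment> \<open>The constant of \<open>theta_deriv_bound\<close>: partial sums within
      e/\<open>K\<close> give derivatives within e.\<close>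
    define K where "K = 1 + 2 * pi * \<bar>real_of_int k\<bar> * (2 + R)"
    have K: "K > 0" unfolding K_def R_def by (intro add_pos_nonneg mult_nonneg_nonneg) auto
    have "\<forall>\<^sub>F n in sequentially. \<forall>y\<in>S. dist (\<Sum>q<n. theta_term k i p' (int_decode q) y) (theta k i p' y) < e / K" for p'
      using uniform_limitD[OF theta_uniform_limit[OF k, where R = R and i = i and p = p', folded S_def]] e K by simp
    then have "\<forall>\<^sub>F n in sequentially. \<forall>p'\<in>{p, pCons 0 p, gauss_deriv (2 * pi * \<bar>of_int k\<bar>) p}.
        \<forall>y\<in>S. dist (\<Sum>q<n. theta_term k i p' (int_decode q) y) (theta k i p' y) < e / K"
      by (intro eventually_ball_finite) auto
    then show "\<forall>\<^sub>F n in sequentially. \<forall>y\<in>S. \<forall>h. cmod ((\<Sum>q<n. theta_deriv k i p (\<lambda>p. theta_term k i p (int_decode q) y) y h)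
        - theta_deriv k i p (\<lambda>p. theta k i p y) y h) \<le> e * norm h"
    proof eventually_elim
      case (elim n)
      show ?case
      proof (intro ballI allI)
        fix y and h :: heis assume y: "y \<in> S"
        have "cmod (theta_deriv k i p (\<lambda>p. (\<Sum>q<n. theta_term k i p (int_decode q) y) - theta k i p y) y h)
            \<le> K * (e / K) * norm h"
          unfolding K_def
        proof (rule theta_deriv_bound)
          show "\<bar>fst y\<bar> < R" using y by (simp add: S_def)
        qed (use elim y e K in \<open>auto simp: dist_norm K_def intro: less_imp_le\<close>)
        then show "cmod ((\<Sum>q<n. theta_deriv k i p (\<lambda>p. theta_term k i p (int_decode q) y) y h)
            - theta_deriv k i p (\<lambda>p. theta k i p y) y h) \<le> e * norm h"
          using K by (simp add: theta_deriv_sum theta_deriv_diff)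
      qed
    qed
  qed
  then obtain g where g: "\<And>y. y \<in> S \<Longrightarrow> (\<lambda>q. ?f q y) sums g y"
    "\<And>y. y \<in> S \<Longrightarrow> (g has_derivative theta_deriv k i p (\<lambda>p. theta k i p y) y) (at y within S)" by blast
  have "(g has_derivative theta_deriv k i p (\<lambda>p. theta k i p x) x) (at x)"
    using g(2)[OF xS] at_within_open[OF xS openS] by simp
  moreover have "g y = theta k i p y" if "y \<in> S" for y
    using sums_unique2[OF g(1)[OF that] theta_sums[OF k]] .
  ultimately show ?thesis
    by (rule has_derivative_transform_within_open[OF _ openS xS])
qed

text \<open>The induction runs over all polynomials at once, because the derivatives are theta
  series of other polynomials with coefficients linear in a.\<close>

lemma cont_diff_theta: "k \<noteq> 0 \<Longrightarrow> cont_diff n (theta k i p)"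
proof (induction n arbitrary: p)
  case 0
  then show ?case
    using theta_has_derivative[OF 0, THEN has_derivative_continuous]
    by (auto simp: continuous_on_eq_continuous_at)
next
  case (Suc n)
  have *: "cont_diff n (\<lambda>x. c * (theta k i p x - of_real (fst x) * theta k i q x))" for c p q
  proof -
    have "cont_diff n (\<lambda>x. c * (theta k i p x + (- 1) * (of_real (fst x) * theta k i q x)))"
      by (intro cont_diff_mult cont_diff_add cont_diff_const cont_diff_fst Suc)
    then show ?thesis by simp
  qed
  show ?case
    by (rule cont_diff_SucI[OF theta_has_derivative[OF Suc.prems]])
      (unfold theta_deriv_def, intro cont_diff_add cont_diff_mult cont_diff_const * Suc)
qed

text \<open>Translation by a lattice point turns the term of index j into the term of index j + m,
  up to a phase that is an integer multiple of 2 pi.\<close>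

lemma nil_invariant_theta:
  assumes "k \<noteq> 0" shows "nil_invariant (theta k i p)"
  unfolding nil_invariant_def
proof (intro ballI allI)
  fix \<gamma> x :: heis assume "\<gamma> \<in> heis_lattice"
  then obtain m n l where \<gamma>: "\<gamma> = (of_int m, of_int n, of_int l)"
    by (auto simp: heis_lattice_def elim!: Ints_cases)
  obtain a b c where x: "x = (a, b, c)" by (cases x)
  have "theta_term k i p j (heis_mult \<gamma> x) = theta_term k i p (j + m) x" for j
  proof -
    have "2 * pi * ((of_int i + of_int k * of_int j) * (of_int n + b) + of_int k * (of_int l + c + of_int m * b))
      = 2 * pi * ((of_int i + of_int k * of_int (j + m)) * b + of_int k * c)
        + 2 * pi * of_int ((i + k * j) * n + k * l)"
      by (simp add: algebra_simps)
    moreover have "cis (2 * pi * of_int ((i + k * j) * n + k * l)) = 1"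
      by (intro cis_multiple_2pi) auto
    ultimately have "cis (2 * pi * ((of_int i + of_int k * of_int j) * (of_int n + b) + of_int k * (of_int l + c + of_int m * b)))
      = cis (2 * pi * ((of_int i + of_int k * of_int (j + m)) * b + of_int k * c))"
      by (metis cis_mult mult.right_neutral)
    then show ?thesis
      by (simp add: \<gamma> x heis_mult_def theta_term_def add_ac)
  qed
  then have "theta k i p (heis_mult \<gamma> x) = (\<Sum>\<^sub>\<infinity>j. theta_term k i p (j + m) x)"
    by (simp add: theta_def)
  also have "\<dots> = theta k i p x"
    unfolding theta_def
    by (rule infsum_reindex_bij_betw[of "\<lambda>j. j + m" UNIV UNIV "\<lambda>j. theta_term k i p j x"])
      (rule bij_betw_byWitness[of _ "\<lambda>j. j - m"], auto)
  finally show "theta k i p (heis_mult \<gamma> x) = theta k i p x" .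
qed

lemma theta_smooth: "k \<noteq> 0 \<Longrightarrow> theta k i p \<in> nil_smooth"
  by (simp add: nil_smooth_iff nil_invariant_theta cont_diff_theta)

lemma theta_central_weight:
  assumes "k \<noteq> 0" shows "central_weight k (theta k i p)"
  unfolding central_weight_def
proof (intro allI)
  fix a b c
  have "theta_term k i p m (a, b, c) = cis (2 * pi * of_int k * c) * theta_term k i p m (a, b, 0)" for m
    by (simp add: theta_term_def cis_mult algebra_simps)
  then have "(\<lambda>q. theta_term k i p (int_decode q) (a, b, c)) sums (cis (2 * pi * of_int k * c) * theta k i p (a, b, 0))"
    using sums_mult[OF theta_sums[OF assms]] by simp
  then show "theta k i p (a, b, c) = cis (2 * pi * of_int k * c) * theta k i p (a, b, 0)"
    using sums_unique2[OF theta_sums[OF assms]] by blast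
qed

lemma frechet_derivative_theta:
  "k \<noteq> 0 \<Longrightarrow> frechet_derivative (theta k i p) (at x) = theta_deriv k i p (\<lambda>p. theta k i p x) x"
  using frechet_derivative_at[OF theta_has_derivative] by simp

text \<open>On the one-variable profile A differentiates, and B below multiplies by 2 pi i k x. This
  is the Schroedinger representation, in which the sub-Laplacian is a harmonic oscillator.\<close>

lemma field_A_theta:
  "k \<noteq> 0 \<Longrightarrow> field_A (theta k i p) = theta k i (gauss_deriv (2 * pi * \<bar>of_int k\<bar>) p)"
  by (simp add: fun_eq_iff field_A_def frechet_derivative_theta theta_deriv_def)

lemma field_B_theta:
  "k \<noteq> 0 \<Longrightarrow> field_B (theta k i p) = (\<lambda>x. 2 * pi * \<i> * of_int k * theta k i (pCons 0 p) x)"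
  by (simp add: fun_eq_iff field_B_def frechet_derivative_theta theta_deriv_def algebra_simps)

lemma theta_add:
  assumes "k \<noteq> 0" shows "theta k i (p + q) x = theta k i p x + theta k i q x"
proof -
  have "theta_term k i (p + q) m x = theta_term k i p m x + theta_term k i q m x" for m
    by (simp add: theta_term_def gauss_poly_def split_beta algebra_simps)
  then show ?thesis
    using sums_unique2[OF theta_sums[OF assms, of i "p + q" x]]
      sums_add[OF theta_sums[OF assms, of i p x] theta_sums[OF assms, of i q x]] by simp
qed

lemma theta_smult:
  assumes "k \<noteq> 0" shows "theta k i (smult r p) x = of_real r * theta k i p x"
proof -
  have "theta_term k i (smult r p) m x = of_real r * theta_term k i p m x" for m
    by (simp add: theta_term_def gauss_poly_def split_beta)
  then show ?thesis
    using sums_unique2[OF theta_sums[OF assms, of i "smult r p" x]]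
      sums_mult[OF theta_sums[OF assms, of i p x], of "of_real r"] by simp
qed

text \<open>The physicists' Hermite polynomials for \<kappa> = 1. In general they are rescaled to
  the oscillator with ground state exp (-\<kappa> x^2 / 2).\<close>

fun hermite :: "real \<Rightarrow> nat \<Rightarrow> real poly" where
  "hermite \<kappa> 0 = 1"
| "hermite \<kappa> (Suc j) = smult (2 * \<kappa>) (pCons 0 (hermite \<kappa> j)) - pderiv (hermite \<kappa> j)"

text \<open>The lowering relation; both the Hermite equation and the spanning property follow from
  it.\<close>

lemma pderiv_hermite: "pderiv (hermite \<kappa> (Suc j)) = smult (2 * \<kappa> * real (Suc j)) (hermite \<kappa> j)"
proof (induction j)
  case 0
  show ?case by (simp add: pderiv_pCons pderiv_smult pderiv_diff)
next
  case (Suc j)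
  have "pderiv (hermite \<kappa> (Suc (Suc j))) = smult (2 * \<kappa>) (hermite \<kappa> (Suc j) + pCons 0 (pderiv (hermite \<kappa> (Suc j))))
      - pderiv (pderiv (hermite \<kappa> (Suc j)))"
    by (subst hermite.simps(2)[of _ "Suc j"]) (simp only: pderiv_pCons pderiv_smult pderiv_diff add.commute)
  also have "\<dots> = smult (2 * \<kappa>) (hermite \<kappa> (Suc j)) + smult (2 * \<kappa> * real (Suc j)) (hermite \<kappa> (Suc j))"
    unfolding Suc
    by (simp only: hermite.simps(2)[of \<kappa> j] pderiv_smult) (simp add: smult_add_right smult_diff_right mult_ac)
  also have "\<dots> = smult (2 * \<kappa> * real (Suc (Suc j))) (hermite \<kappa> (Suc j))"
    by (simp only: smult_add_left[symmetric]) (simp add: algebra_simps)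
  finally show ?case .
qed

text \<open>Conjugating the oscillator by the Gaussian leaves \<kappa> p + 2 \<kappa> x p' - p''.
  The Hermite equation evaluates the last two terms to 2 \<kappa> j p.\<close>

lemma hermite_eigen:
  "smult (\<kappa>\<^sup>2) (pCons 0 (pCons 0 (hermite \<kappa> j))) - gauss_deriv \<kappa> (gauss_deriv \<kappa> (hermite \<kappa> j))
    = smult (\<kappa> * (2 * real j + 1)) (hermite \<kappa> j)"
proof -
  have "smult (2 * \<kappa>) (pCons 0 (pderiv (hermite \<kappa> j))) - pderiv (pderiv (hermite \<kappa> j)) = smult (2 * \<kappa> * real j) (hermite \<kappa> j)"
  proof (cases j)
    case (Suc n)
    show ?thesis
      unfolding Suc pderiv_hermite pderiv_smult
      by (simp only: hermite.simps(2)[of \<kappa> n]) (simp add: smult_diff_right mult_ac)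
  qed simp
  moreover have "smult (\<kappa>\<^sup>2) (pCons 0 (pCons 0 p)) - gauss_deriv \<kappa> (gauss_deriv \<kappa> p) =
      smult \<kappa> p + (smult (2 * \<kappa>) (pCons 0 (pderiv p)) - pderiv (pderiv p))" for p
  proof -
    have "smult (2 * \<kappa>) q = smult \<kappa> q + smult \<kappa> q" for q :: "real poly"
      by (simp flip: smult_add_left)
    then show ?thesis
      by (simp add: gauss_deriv_def pderiv_diff pderiv_smult pderiv_pCons smult_diff_right smult_add_right
          power2_eq_square)
  qed
  moreover have "smult \<kappa> p + smult (2 * \<kappa> * real j) p = smult (\<kappa> * (2 * real j + 1)) p" for p
    by (simp only: smult_add_left[symmetric]) (simp add: algebra_simps)
  ultimately show ?thesis by simp
qed

text \<open>For \<kappa> = 2 pi |k|, A twice is the second derivative of the profile and B twice is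
  multiplication by -\<kappa>^2 x^2.\<close>

lemma sublaplacian_theta:
  assumes k: "k \<noteq> 0"
  shows "sublaplacian (theta k i (hermite (2 * pi * \<bar>of_int k\<bar>) j)) =
    (\<lambda>x. of_real (2 * pi * \<bar>of_int k\<bar> * (2 * real j + 1)) * theta k i (hermite (2 * pi * \<bar>of_int k\<bar>) j) x)"
proof
  fix x
  let ?\<kappa> = "2 * pi * \<bar>real_of_int k\<bar>" and ?p = "hermite (2 * pi * \<bar>real_of_int k\<bar>) j"
  have k2: "of_int k * of_int k = (of_real \<bar>of_int k\<bar> * of_real \<bar>of_int k\<bar> :: complex)"
    by (simp flip: of_real_mult) (simp flip: of_int_mult)
  have B: "field_B (field_B (theta k i ?p)) x = - of_real (?\<kappa>\<^sup>2) * theta k i (pCons 0 (pCons 0 ?p)) x"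
    using k unfolding field_B_theta[OF k]
    by (simp add: field_B_eq nil_smooth_cmult theta_smooth lie_field_cmult)
      (simp add: field_B_eq[symmetric] theta_smooth field_B_theta power2_eq_square algebra_simps k2)
  have "sublaplacian (theta k i ?p) x =
      theta k i (smult (?\<kappa>\<^sup>2) (pCons 0 (pCons 0 ?p)) + smult (- 1) (gauss_deriv ?\<kappa> (gauss_deriv ?\<kappa> ?p))) x"
    unfolding theta_add[OF k] theta_smult[OF k] sublaplacian_def B
    by (simp add: field_A_theta k)
  also have "smult (?\<kappa>\<^sup>2) (pCons 0 (pCons 0 ?p)) + smult (- 1) (gauss_deriv ?\<kappa> (gauss_deriv ?\<kappa> ?p)) =
      smult (?\<kappa> * (2 * real j + 1)) ?p"
    using hermite_eigen[of ?\<kappa> j] by simp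
  finally show "sublaplacian (theta k i ?p) x = of_real (?\<kappa> * (2 * real j + 1)) * theta k i ?p x"
    by (simp only: theta_smult[OF k])
qed

section \<open>Uniqueness of Fourier coefficients and moments\<close>

text \<open>For k nonzero the shear in the group law destroys lattice invariance. These are
  characters of the cube, seen as a torus, and serve there only as test functions; those with k = 0
  do live on the nilmanifold.\<close>

definition fourier_char :: "int \<Rightarrow> int \<Rightarrow> int \<Rightarrow> heis \<Rightarrow> complex" where
  "fourier_char l n k = (\<lambda>(a, b, c). cis (2 * pi * (of_int l * a + of_int n * b + of_int k * c)))"

lemma fourier_char_mult: "fourier_char l n k x * fourier_char l' n' k' x = fourier_char (l + l') (n + n') (k + k') x"
  by (simp add: fourier_char_def split_beta cis_mult algebra_simps)

lemma cmod_fourier_char [simp]: "cmod (fourier_char l n k x) = 1"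
  by (simp add: fourier_char_def split_beta)

lemma fourier_char_continuous: "continuous_on UNIV (fourier_char l n k)"
  unfolding fourier_char_def by (auto simp: split_beta' intro!: continuous_intros)

inductive trig_poly :: "(heis \<Rightarrow> complex) \<Rightarrow> bool" where
  base: "trig_poly (fourier_char l n k)"
| cmult: "trig_poly f \<Longrightarrow> trig_poly (\<lambda>x. c * f x)"
| add: "trig_poly f \<Longrightarrow> trig_poly g \<Longrightarrow> trig_poly (\<lambda>x. f x + g x)"

lemma trig_poly_continuous: "trig_poly f \<Longrightarrow> continuous_on UNIV f"
  by (induction rule: trig_poly.induct) (auto intro!: continuous_intros fourier_char_continuous)

lemma trig_poly_mult: "trig_poly f \<Longrightarrow> trig_poly g \<Longrightarrow> trig_poly (\<lambda>x. f x * g x)"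
proof (induction arbitrary: g rule: trig_poly.induct)
  case (base l n k)
  from base show ?case
  proof (induction rule: trig_poly.induct)
    case (base l' n' k')
    then show ?case using trig_poly.base[of "l + l'" "n + n'" "k + k'"]
      by (simp add: fourier_char_mult)
  next
    case (cmult f c)
    then show ?case using trig_poly.cmult[OF cmult.IH, of c] by (simp add: mult.left_commute)
  qed (simp add: distrib_left trig_poly.add)
next
  case (cmult f c)
  then show ?case using trig_poly.cmult[OF cmult.IH, of _ c] by (simp add: mult.assoc)
qed (simp add: distrib_right trig_poly.add)

lemma trig_poly_const: "trig_poly (\<lambda>x. c)"
  using trig_poly.cmult[OF trig_poly.base[of 0 0 0], of c] by (simp add: fourier_char_def split_beta)

text \<open>Carries the cube into a compact torus, where Stone-Weierstrass applies and polynomials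
  become trigonometric polynomials.\<close>

definition torus_map :: "heis \<Rightarrow> complex \<times> complex \<times> complex" where
  "torus_map = (\<lambda>(a, b, c). (cis (2 * pi * a), cis (2 * pi * b), cis (2 * pi * c)))"

lemma torus_map_continuous: "continuous_on UNIV torus_map"
  unfolding torus_map_def by (auto simp: split_beta' intro!: continuous_intros)

text \<open>Only the linear case has content: a real linear functional combines real and imaginary
  parts of the coordinates, that is, cosines and sines.\<close>

lemma trig_poly_of_polynomial:
  assumes "real_polynomial_function q"
  shows "trig_poly (\<lambda>x. of_real (q (torus_map x)))"
  using assms
proof (induction rule: real_polynomial_function.induct)
  case (linear q)
  then interpret q: bounded_linear q .
  have cis_Re: "trig_poly (\<lambda>x. of_real (cos (2 * pi * (of_int l * fst x + of_int n * fst (snd x) + of_int k * snd (snd x)))))" for l n k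
  proof -
    have "trig_poly (\<lambda>x. (1 / 2) * (fourier_char l n k x + fourier_char (- l) (- n) (- k) x))"
      by (intro trig_poly.intros)
    moreover have "(1 / 2) * (fourier_char l n k x + fourier_char (- l) (- n) (- k) x) =
      of_real (cos (2 * pi * (of_int l * fst x + of_int n * fst (snd x) + of_int k * snd (snd x))))" for x
    proof -
      have m: "2 * pi * (of_int (- l) * fst x + of_int (- n) * fst (snd x) + of_int (- k) * snd (snd x))
        = - (2 * pi * (of_int l * fst x + of_int n * fst (snd x) + of_int k * snd (snd x)))"
        by (simp add: algebra_simps)
      show ?thesis unfolding fourier_char_def split_beta m by (simp add: complex_eq_iff)
    qed
    ultimately show ?thesis by simp
  qed
  have cis_Im: "trig_poly (\<lambda>x. of_real (sin (2 * pi * (of_int l * fst x + of_int n * fst (snd x) + of_int k * snd (snd x)))))" for l n k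
  proof -
    have "trig_poly (\<lambda>x. (- \<i> / 2) * (fourier_char l n k x + (- 1) * fourier_char (- l) (- n) (- k) x))"
      by (intro trig_poly.intros)
    moreover have "(- \<i> / 2) * (fourier_char l n k x + (- 1) * fourier_char (- l) (- n) (- k) x) =
      of_real (sin (2 * pi * (of_int l * fst x + of_int n * fst (snd x) + of_int k * snd (snd x))))" for x
    proof -
      have m: "2 * pi * (of_int (- l) * fst x + of_int (- n) * fst (snd x) + of_int (- k) * snd (snd x))
        = - (2 * pi * (of_int l * fst x + of_int n * fst (snd x) + of_int k * snd (snd x)))"
        by (simp add: algebra_simps)
      show ?thesis unfolding fourier_char_def split_beta m by (simp add: complex_eq_iff)
    qed
    ultimately show ?thesis by simp
  qed
  have q_eq: "q (z1, z2, z3) = Re z1 * q (1, 0, 0) + Im z1 * q (\<i>, 0, 0) + Re z2 * q (0, 1, 0) + Im z2 * q (0, \<i>, 0)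
     + Re z3 * q (0, 0, 1) + Im z3 * q (0, 0, \<i>)" for z1 z2 z3
  proof -
    have dec: "z = Re z *\<^sub>R 1 + Im z *\<^sub>R \<i>" for z :: complex by (simp add: complex_eq_iff)
    have "(z1, z2, z3) = Re z1 *\<^sub>R (1, 0, 0) + Im z1 *\<^sub>R (\<i>, 0, 0) + Re z2 *\<^sub>R (0, 1, 0) + Im z2 *\<^sub>R (0, \<i>, 0)
     + Re z3 *\<^sub>R (0, 0, 1) + Im z3 *\<^sub>R (0, 0, \<i>)"
      using dec[of z1] dec[of z2] dec[of z3] by simp
    then have "q (z1, z2, z3) = q (Re z1 *\<^sub>R (1, 0, 0) + Im z1 *\<^sub>R (\<i>, 0, 0) + Re z2 *\<^sub>R (0, 1, 0) + Im z2 *\<^sub>R (0, \<i>, 0)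
     + Re z3 *\<^sub>R (0, 0, 1) + Im z3 *\<^sub>R (0, 0, \<i>))" by (rule arg_cong)
    also have "\<dots> = Re z1 * q (1, 0, 0) + Im z1 * q (\<i>, 0, 0) + Re z2 * q (0, 1, 0) + Im z2 * q (0, \<i>, 0)
     + Re z3 * q (0, 0, 1) + Im z3 * q (0, 0, \<i>)"
      by (simp only: q.add q.scaleR real_scaleR_def)
    finally show ?thesis .
  qed
  have torus_map_eq: "torus_map x = (cis (2 * pi * fst x), cis (2 * pi * fst (snd x)), cis (2 * pi * snd (snd x)))" for x
    by (simp add: torus_map_def split_beta)
  have q_torus: "q (torus_map x) = q (1, 0, 0) * cos (2 * pi * fst x) + q (\<i>, 0, 0) * sin (2 * pi * fst x)
     + q (0, 1, 0) * cos (2 * pi * fst (snd x)) + q (0, \<i>, 0) * sin (2 * pi * fst (snd x))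
     + q (0, 0, 1) * cos (2 * pi * snd (snd x)) + q (0, 0, \<i>) * sin (2 * pi * snd (snd x))" for x
    unfolding torus_map_eq by (subst q_eq) (simp only: cis.sel mult.commute)
  have "trig_poly (\<lambda>x. of_real (q (1, 0, 0)) * of_real (cos (2 * pi * fst x)) + of_real (q (\<i>, 0, 0)) * of_real (sin (2 * pi * fst x))
     + of_real (q (0, 1, 0)) * of_real (cos (2 * pi * fst (snd x))) + of_real (q (0, \<i>, 0)) * of_real (sin (2 * pi * fst (snd x)))
     + of_real (q (0, 0, 1)) * of_real (cos (2 * pi * snd (snd x))) + of_real (q (0, 0, \<i>)) * of_real (sin (2 * pi * snd (snd x))))"
    using cis_Re[of 1 0 0] cis_Re[of 0 1 0] cis_Re[of 0 0 1] cis_Im[of 1 0 0] cis_Im[of 0 1 0] cis_Im[of 0 0 1]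
    by (intro trig_poly.intros) simp_all
  then show ?case
    by (simp only: q_torus of_real_add of_real_mult)
next
  case (const c)
  show ?case by (rule trig_poly_const)
next
  case (add f g)
  then show ?case using trig_poly.add by (simp add: trig_poly.add)
next
  case (mult f g)
  then show ?case using trig_poly_mult by simp
qed

text \<open>Continuous off the nonnegative real axis and zero on it.\<close>

lemma borel_measurable_Arg2pi [measurable]: "Arg2pi \<in> borel_measurable borel"
proof -
  have 1: "continuous_on (- \<real>\<^sub>\<ge>\<^sub>0) Arg2pi"
    using continuous_at_Arg2pi continuous_at_imp_continuous_within
    by (auto simp: continuous_on_eq_continuous_within)
  have "- \<real>\<^sub>\<ge>\<^sub>0 \<in> sets (borel :: complex measure)" by (intro borel_open open_Compl closed_nonneg_Reals_complex)
  then have "(\<lambda>z. indicat_real (- \<real>\<^sub>\<ge>\<^sub>0) z *\<^sub>R Arg2pi z) \<in> borel_measurable borel"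
    using borel_measurable_continuous_on_restrict[OF 1] by (subst (asm) borel_measurable_restrict_space_iff) auto
  moreover have "(\<lambda>z. indicat_real (- \<real>\<^sub>\<ge>\<^sub>0) z *\<^sub>R Arg2pi z) = Arg2pi"
    using Arg2pi_eq_0 by (auto simp: fun_eq_iff indicator_def complex_nonneg_Reals_iff complex_is_Real_iff)
  ultimately show ?thesis by (simp only:)
qed

lemma Arg2pi_cis: "0 \<le> t \<Longrightarrow> t < 1 \<Longrightarrow> Arg2pi (cis (2 * pi * t)) = 2 * pi * t"
  by (rule Arg2pi_unique[of 1]) (auto simp: cis_conv_exp)

text \<open>The vanishing integrals extend from characters to continuous functions on the torus by
  Stone-Weierstrass, to indicators of open sets by dominated convergence, and to Borel sets by a
  Dynkin argument.\<close>

lemma fourier_uniqueness: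
  assumes F: "integrable nil_measure F"
    and zero: "\<And>l n k. (LINT x|nil_measure. F x * fourier_char l n k x) = 0"
  shows "AE x in nil_measure. F x = 0"
proof -
  have Fm [measurable]: "F \<in> borel_measurable nil_measure" using F by auto
  have int_mult: "integrable nil_measure (\<lambda>x. F x * g x)"
    if "g \<in> borel_measurable nil_measure" "\<And>x. cmod (g x) \<le> B" for g B
  proof (rule Bochner_Integration.integrable_bound)
    show "integrable nil_measure (\<lambda>x. B * cmod (F x))" using F by simp
    show "AE x in nil_measure. norm (F x * g x) \<le> norm (B * cmod (F x))"
      using that(2) by (auto simp: norm_mult abs_mult mult.commute[of B] intro!: mult_left_mono order_trans[OF _ abs_ge_self])
  qed (use that in measurable)
  have trig_bound: "\<exists>B. \<forall>x. cmod (f x) \<le> B" if "trig_poly f" for f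
    using that
  proof (induction rule: trig_poly.induct)
    case (cmult f c)
    then obtain B where "\<And>x. cmod (f x) \<le> B" by blast
    then show ?case by (intro exI[of _ "cmod c * B"]) (auto simp: norm_mult intro: mult_left_mono)
  next
    case (add f g)
    then obtain B B' where "\<And>x. cmod (f x) \<le> B" "\<And>x. cmod (g x) \<le> B'" by blast
    then show ?case by (intro exI[of _ "B + B'"]) (auto intro: norm_triangle_mono)
  qed (auto intro: exI[of _ 1])
  have trig_int: "integrable nil_measure (\<lambda>x. F x * f x)" if "trig_poly f" for f
    using trig_bound[OF that] int_mult borel_measurable_nil[OF borel_measurable_continuous_onI[OF trig_poly_continuous[OF that]]]
    by blast
  have trig_zero: "(LINT x|nil_measure. F x * f x) = 0" if "trig_poly f" for f
    using that
  proof (induction rule: trig_poly.induct)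
    case (base l n k)
    then show ?case by (rule zero)
  next
    case (cmult f c)
    then show ?case by (simp add: mult.left_commute[of _ c])
  next
    case (add f g)
    then show ?case by (simp add: distrib_left trig_int)
  qed
  define N where "N = (LINT x|nil_measure. cmod (F x))"
  have N: "N \<ge> 0" by (simp add: N_def)
  have cont_zero: "(LINT x|nil_measure. F x * of_real (G (torus_map x))) = 0"
    if G: "continuous_on UNIV G" for G :: "complex \<times> complex \<times> complex \<Rightarrow> real"
  proof -
    define K where "K = (sphere 0 1 \<times> sphere 0 1 \<times> sphere 0 1 :: (complex \<times> complex \<times> complex) set)"
    have K: "compact K" unfolding K_def by (intro compact_Times compact_sphere)
    have EK: "torus_map x \<in> K" for x by (auto simp: torus_map_def K_def split_beta)
    have cGE: "continuous_on UNIV (\<lambda>x. complex_of_real (G (torus_map x)))"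
      by (intro continuous_intros continuous_on_compose2[OF G torus_map_continuous]) auto
    have "cmod (LINT x|nil_measure. F x * of_real (G (torus_map x))) \<le> e * N" if e: "e > 0" for e
    proof -
      obtain q where q: "real_polynomial_function q" "\<And>x. x \<in> K \<Longrightarrow> \<bar>G x - q x\<bar> < e"
        using Stone_Weierstrass_real_polynomial_function[OF K continuous_on_subset[OF G subset_UNIV] e] by blast
      note tq = trig_poly_of_polynomial[OF q(1)]
      have "bounded (G ` K)"
        by (intro compact_imp_bounded compact_continuous_image continuous_on_subset[OF G subset_UNIV] K)
      then obtain B where B: "\<forall>y\<in>G ` K. norm y \<le> B" unfolding bounded_iff by blast
      have i1: "integrable nil_measure (\<lambda>x. F x * of_real (G (torus_map x)))"
        by (rule int_mult[of _ B])
          (use B EK borel_measurable_nil[OF borel_measurable_continuous_onI[OF cGE]] in auto)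
      have "(LINT x|nil_measure. F x * of_real (G (torus_map x))) =
         (LINT x|nil_measure. F x * of_real (G (torus_map x)) - F x * of_real (q (torus_map x)))"
        using i1 trig_int[OF tq] trig_zero[OF tq] by simp
      also have "cmod \<dots> \<le> (LINT x|nil_measure. cmod (F x * of_real (G (torus_map x)) - F x * of_real (q (torus_map x))))"
        by (rule integral_norm_bound)
      also have "\<dots> \<le> (LINT x|nil_measure. e * cmod (F x))"
      proof (rule integral_mono)
        show "integrable nil_measure (\<lambda>x. cmod (F x * of_real (G (torus_map x)) - F x * of_real (q (torus_map x))))"
          using i1 trig_int[OF tq] by (intro integrable_norm Bochner_Integration.integrable_diff)
        show "integrable nil_measure (\<lambda>x. e * cmod (F x))" using F by simp
        fix x
        have "cmod (F x * of_real (G (torus_map x)) - F x * of_real (q (torus_map x))) = \<bar>G (torus_map x) - q (torus_map x)\<bar> * cmod (F x)"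
          by (simp add: norm_mult mult.commute flip: right_diff_distrib of_real_diff)
        then show "cmod (F x * of_real (G (torus_map x)) - F x * of_real (q (torus_map x))) \<le> e * cmod (F x)"
          using q(2)[OF EK, of x] by (simp add: mult_right_mono less_imp_le)
      qed
      finally show ?thesis by (simp add: N_def)
    qed
    note le = this
    have "cmod (LINT x|nil_measure. F x * of_real (G (torus_map x))) \<le> 0 + e" if e: "e > 0" for e
    proof -
      \<comment> \<open>\<open>N\<close> may be zero, hence the division by
        \<open>N + 1\<close>.\<close>
      have "e / (N + 1) * N \<le> e" using e N by (simp add: field_simps)
      then show ?thesis using le[of "e / (N + 1)"] e N by simp
    qed
    then have "cmod (LINT x|nil_measure. F x * of_real (G (torus_map x))) \<le> 0"
      by (rule field_le_epsilon)
    then show ?thesis by simp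
  qed
  have Em: "torus_map \<in> borel_measurable borel"
    by (rule borel_measurable_continuous_onI[OF torus_map_continuous])
  have [measurable]: "torus_map \<in> borel_measurable nil_measure" by (rule borel_measurable_nil[OF Em])
  have open_zero: "(LINT x|nil_measure. F x * indicator U (torus_map x)) = 0" if U: "open U" for U
  \<comment> \<open>\<open>infdist\<close> from the empty set is 0 by convention, so the cutoffs
    \<open>G n\<close> would vanish identically for the whole space.\<close>
  proof (cases "U = UNIV")
    case True
    then show ?thesis using cont_zero[of "\<lambda>_. 1"] by simp
  next
    case False
    define G where "G n z = min 1 (real n * infdist z (- U))" for n z
    have cG: "continuous_on UNIV (G n)" for n unfolding G_def by (intro continuous_intros)
    have [measurable]: "G n \<in> borel_measurable borel" for n by (rule borel_measurable_continuous_onI[OF cG])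
    have Ub [measurable]: "U \<in> sets borel" using U by simp
    have "(\<lambda>n. LINT x|nil_measure. F x * of_real (G n (torus_map x))) \<longlonglongrightarrow> (LINT x|nil_measure. F x * indicator U (torus_map x))"
    proof (rule integral_dominated_convergence[where w = "\<lambda>x. cmod (F x)"])
      have "(\<lambda>n. G n z) \<longlonglongrightarrow> indicator U z" for z
      proof (cases "z \<in> U")
        case True
        have "infdist z (- U) > 0"
          using True False U by (intro infdist_pos_not_in_closed) auto
        then obtain n0 where n0: "1 < real n0 * infdist z (- U)" using reals_Archimedean3 by blast
        have "\<forall>\<^sub>F n in sequentially. G n z = 1"
          using eventually_ge_at_top[of n0]
        proof eventually_elim
          case (elim n)
          have "real n0 * infdist z (- U) \<le> real n * infdist z (- U)"
            using elim by (intro mult_right_mono) (auto simp: infdist_nonneg)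
          then show ?case using n0 by (simp add: G_def)
        qed
        then show ?thesis using True by (simp add: tendsto_eventually)
      next
        case False
        then show ?thesis by (simp add: G_def)
      qed
      then have "(\<lambda>n. complex_of_real (G n z)) \<longlonglongrightarrow> of_real (indicator U z)" for z by (intro tendsto_of_real)
      then show "AE x in nil_measure. (\<lambda>n. F x * of_real (G n (torus_map x))) \<longlonglongrightarrow> F x * indicator U (torus_map x)"
        by (intro AE_I2 tendsto_mult tendsto_const) (simp add: of_real_indicator)
      show "AE x in nil_measure. norm (F x * of_real (G n (torus_map x))) \<le> cmod (F x)" for n
      proof (intro AE_I2)
        fix x
        have "0 \<le> G n (torus_map x)" "G n (torus_map x) \<le> 1"
          using infdist_nonneg[of "torus_map x" "- U"] by (auto simp: G_def)
        then show "norm (F x * of_real (G n (torus_map x))) \<le> cmod (F x)"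
          by (simp add: norm_mult mult_left_le)
      qed
    qed (use F in auto)
    then show ?thesis by (simp add: cont_zero[OF cG] LIMSEQ_const_iff)
  qed
  have F_ind: "integrable nil_measure (\<lambda>x. F x * indicator B (torus_map x))" if [measurable]: "B \<in> sets borel" for B
    by (rule int_mult[of _ 1]) (auto simp: indicator_def)
  have borel_zero: "(LINT x|nil_measure. F x * indicator B (torus_map x)) = 0"
    if B: "B \<in> sigma_sets UNIV {U. open U}" for B
  proof -
    have "Int_stable {U :: (complex \<times> complex \<times> complex) set. open U}" "{U :: (complex \<times> complex \<times> complex) set. open U} \<subseteq> Pow UNIV"
      by (auto simp: Int_stable_def)
    from this B show ?thesis
    proof (induction rule: sigma_sets_induct_disjoint)
      case (basic U)
      then show ?case using open_zero by simp
    next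
      case empty
      show ?case by simp
    next
      case (compl B)
      then have "B \<in> sets borel" by (simp add: borel_def)
      then have "(LINT x|nil_measure. F x * indicator UNIV (torus_map x) - F x * indicator B (torus_map x)) = 0"
        using open_zero[of UNIV] compl F_ind[of B] F by simp
      moreover have "F x * indicator (UNIV - B) (torus_map x) = F x * indicator UNIV (torus_map x) - F x * indicator B (torus_map x)" for x
        by (auto simp: indicator_def)
      ultimately show ?case by simp
    next
      case (union B)
      have Bm [measurable]: "B i \<in> sets borel" for i using union by (auto simp: borel_def)
      have "(\<lambda>n. LINT x|nil_measure. F x * (\<Sum>i<n. indicator (B i) (torus_map x))) \<longlonglongrightarrow>
          (LINT x|nil_measure. F x * indicator (\<Union>i. B i) (torus_map x))"
      proof (rule integral_dominated_convergence[where w = "\<lambda>x. cmod (F x)"])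
        have sum_eq: "(\<Sum>i<n. indicator (B i) z) = (indicator (\<Union>i<n. B i) z :: complex)" for z n
          using union(1) by (intro indicator_UN_disjoint[symmetric]) (auto simp: disjoint_family_on_def)
        show "AE x in nil_measure. (\<lambda>n. F x * (\<Sum>i<n. indicator (B i) (torus_map x))) \<longlonglongrightarrow> F x * indicator (\<Union>i. B i) (torus_map x)"
          unfolding sum_eq by (intro AE_I2 tendsto_mult tendsto_const LIMSEQ_indicator_UN)
        show "AE x in nil_measure. norm (F x * (\<Sum>i<n. indicator (B i) (torus_map x))) \<le> cmod (F x)" for n
          unfolding sum_eq by (intro AE_I2) (auto simp: norm_mult indicator_def)
        have [measurable]: "(\<Union>i. B i) \<in> sets borel" by auto
        show "(\<lambda>x. F x * indicator (\<Union>i. B i) (torus_map x)) \<in> borel_measurable nil_measure" by measurable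
      qed (use F in auto)
      moreover have "(LINT x|nil_measure. F x * (\<Sum>i<n. indicator (B i) (torus_map x))) = 0" for n
        unfolding sum_distrib_left using union(3) F_ind[OF Bm]
        by (subst Bochner_Integration.integral_sum) simp_all
      ultimately show ?case by (simp add: LIMSEQ_const_iff)
    qed
  qed
  show ?thesis
  proof (rule nil.density_zero[OF F])
    fix A assume A: "A \<in> sets nil_measure"
    then have AB [measurable]: "A \<in> sets borel" and As: "A \<subseteq> {0..<1} \<times> {0..<1} \<times> {0..<1}"
      using sets_nil_strip[of 0] by (auto simp: nil_measure_def sets_restrict_space nil_strip_def)
    \<comment> \<open>A measurable inverse of \<open>torus_map\<close> on the half-open cube: every
      measurable subset of the cube is the preimage of a Borel set under
      \<open>torus_map\<close>.\<close>
    define \<psi> where "\<psi> z = (Arg2pi (fst z) / (2 * pi), Arg2pi (fst (snd z)) / (2 * pi), Arg2pi (snd (snd z)) / (2 * pi))"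
      for z :: "complex \<times> complex \<times> complex"
    have \<psi>: "\<psi> \<in> borel_measurable borel"
      unfolding \<psi>_def by (simp add: borel_prod[symmetric])
    have B: "\<psi> -` A \<in> sets borel"
      using measurable_sets[OF \<psi> AB] by simp
    have "\<psi> (torus_map x) = x" if "x \<in> space nil_measure" for x
      using that by (auto simp: space_nil_measure torus_map_def \<psi>_def Arg2pi_cis)
    then have "set_lebesgue_integral nil_measure A F = (LINT x|nil_measure. F x * indicator (\<psi> -` A) (torus_map x))"
      unfolding set_lebesgue_integral_def
      by (intro Bochner_Integration.integral_cong refl) (auto simp: indicator_def)
    also have "\<dots> = 0" using B by (intro borel_zero) (simp add: borel_def)
    finally show "set_lebesgue_integral nil_measure A F = 0" .
  qed
qed

section \<open>Injectivity of the Fourier transform on the line, and moments\<close>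

lemma density_char:
  assumes f: "integrable lborel f" "\<And>x. f x \<ge> (0::real)" "(LINT x|lborel. f x) = m" "m > 0"
  shows "real_distribution (density lborel (\<lambda>x. ennreal (f x / m)))"
    and "char (density lborel (\<lambda>x. ennreal (f x / m))) t = (LINT x|lborel. f x *\<^sub>R iexp (t * x)) /\<^sub>R m"
proof -
  have [measurable]: "f \<in> borel_measurable borel" using f(1) by auto
  have "emeasure (density lborel (\<lambda>x. ennreal (f x / m))) (space (density lborel (\<lambda>x. ennreal (f x / m)))) = 1"
    using f by (simp add: emeasure_density nn_integral_eq_integral)
  then have "prob_space (density lborel (\<lambda>x. ennreal (f x / m)))" by (rule prob_spaceI)
  then show "real_distribution (density lborel (\<lambda>x. ennreal (f x / m)))"
    by (simp add: real_distribution_def real_distribution_axioms_def)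
  have "char (density lborel (\<lambda>x. ennreal (f x / m))) t = (LINT x|lborel. (f x / m) *\<^sub>R iexp (t * x))"
    unfolding char_def using f by (intro integral_density) auto
  also have "\<dots> = (LINT x|lborel. inverse m *\<^sub>R (f x *\<^sub>R iexp (t * x)))"
    by (simp add: divide_inverse mult.commute)
  finally show "char (density lborel (\<lambda>x. ennreal (f x / m))) t = (LINT x|lborel. f x *\<^sub>R iexp (t * x)) /\<^sub>R m"
    by (simp only: integral_scaleR_right)
qed

text \<open>Positive and negative part have the same transform, and t = 0 shows that they have the
  same mass. Normalised to probability densities they have equal characteristic functions, so Levy's
  uniqueness theorem identifies them.\<close>

lemma fourier_transform_zero_real:
  fixes u :: "real \<Rightarrow> real"
  assumes u: "integrable lborel u" and zero: "\<And>t. (LINT x|lborel. u x *\<^sub>R iexp (t * x)) = 0"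
  shows "AE x in lborel. u x = 0"
proof -
  have [measurable]: "u \<in> borel_measurable borel" using u by auto
  define f where "f x = max 0 (u x)" for x
  define g where "g x = max 0 (- u x)" for x
  have fg: "integrable lborel f" "integrable lborel g" "\<And>x. f x \<ge> 0" "\<And>x. g x \<ge> 0"
    unfolding f_def g_def using u by auto
  have u_eq: "u x = f x - g x" for x by (auto simp: f_def g_def)
  have int_e: "integrable lborel (\<lambda>x. h x *\<^sub>R iexp (t * x))" if "integrable lborel h" for h t
    by (rule Bochner_Integration.integrable_bound[OF that]) (use that in auto)
  have eq: "(LINT x|lborel. f x *\<^sub>R iexp (t * x)) = (LINT x|lborel. g x *\<^sub>R iexp (t * x))" for t
  proof -
    have "(LINT x|lborel. f x *\<^sub>R iexp (t * x)) - (LINT x|lborel. g x *\<^sub>R iexp (t * x)) =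
        (LINT x|lborel. u x *\<^sub>R iexp (t * x))"
      unfolding u_eq scaleR_diff_left
      by (rule Bochner_Integration.integral_diff[OF int_e[OF fg(1)] int_e[OF fg(2)], symmetric])
    then show ?thesis using zero[of t] by simp
  qed
  define m where "m = (LINT x|lborel. f x)"
  have m': "(LINT x|lborel. g x) = m"
    using eq[of 0] by (simp add: m_def scaleR_conv_of_real)
  have "m \<ge> 0" by (simp add: m_def fg)
  then consider "m = 0" | "m > 0" by linarith
  then show ?thesis
  proof cases
    case 1
    have "AE x in lborel. f x = 0" "AE x in lborel. g x = 0"
      using 1 m' m_def fg integral_nonneg_eq_0_iff_AE[of lborel f] integral_nonneg_eq_0_iff_AE[of lborel g] by auto
    then show ?thesis by eventually_elim (simp add: u_eq)
  next
    case 2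
    have "density lborel (\<lambda>x. ennreal (f x / m)) = density lborel (\<lambda>x. ennreal (g x / m))"
    proof (rule Levy_uniqueness)
      note df = density_char[OF fg(1,3) m_def[symmetric] 2] and dg = density_char[OF fg(2,4) m' 2]
      show "real_distribution (density lborel (\<lambda>x. ennreal (f x / m)))" by (rule df(1))
      show "real_distribution (density lborel (\<lambda>x. ennreal (g x / m)))" by (rule dg(1))
      show "char (density lborel (\<lambda>x. ennreal (f x / m))) = char (density lborel (\<lambda>x. ennreal (g x / m)))"
        by (rule ext) (simp only: df(2) dg(2) eq)
    qed
    then have "AE x in lborel. ennreal (f x / m) = ennreal (g x / m)"
      using fg by (intro sigma_finite_measure.density_unique[OF sigma_finite_lborel]) auto
    then show ?thesis
      by eventually_elim (use fg 2 in \<open>auto simp: u_eq\<close>)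
  qed
qed

text \<open>The transform of the conjugate at t is the conjugate of the transform at -t, so the real
  and the imaginary part have vanishing transforms too.\<close>

lemma fourier_transform_zero:
  fixes w :: "real \<Rightarrow> complex"
  assumes w: "integrable lborel w" and zero: "\<And>t. (LINT x|lborel. w x * iexp (t * x)) = 0"
  shows "AE x in lborel. w x = 0"
proof -
  have int_e: "integrable lborel (\<lambda>x. h x * iexp (t * x))" if "integrable lborel h" for h t
    by (rule Bochner_Integration.integrable_bound[OF that]) (use that in \<open>auto simp: norm_mult\<close>)
  have zero': "(LINT x|lborel. cnj (w x) * iexp (t * x)) = 0" for t
  proof -
    have "cnj (w x) * iexp (t * x) = cnj (w x * iexp (- t * x))" for x by (simp add: exp_cnj)
    then have "(LINT x|lborel. cnj (w x) * iexp (t * x)) = cnj (LINT x|lborel. w x * iexp (- t * x))"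
      by (simp only: Bochner_Integration.integral_cnj)
    then show ?thesis using zero[of "- t"] by simp
  qed
  have wc: "integrable lborel (\<lambda>x. cnj (w x))" using w by simp
  have "AE x in lborel. Re (w x) = 0"
  proof (rule fourier_transform_zero_real)
    fix t
    have "Re (w x) *\<^sub>R iexp (t * x) = (1 / 2) * (w x * iexp (t * x) + cnj (w x) * iexp (t * x))" for x
      by (auto simp: scaleR_conv_of_real complex_eq_iff field_simps)
    then have "(LINT x|lborel. Re (w x) *\<^sub>R iexp (t * x)) =
        (LINT x|lborel. (1 / 2) * (w x * iexp (t * x) + cnj (w x) * iexp (t * x)))" by (simp only:)
    also have "\<dots> = 0"
      using zero[of t] zero'[of t] int_e[OF w, of t] int_e[OF wc, of t] by simp
    finally show "(LINT x|lborel. Re (w x) *\<^sub>R iexp (t * x)) = 0" .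
  qed (use w in simp)
  moreover have "AE x in lborel. Im (w x) = 0"
  proof (rule fourier_transform_zero_real)
    fix t
    have "Im (w x) *\<^sub>R iexp (t * x) = (- \<i> / 2) * (w x * iexp (t * x) - cnj (w x) * iexp (t * x))" for x
      by (auto simp: scaleR_conv_of_real complex_eq_iff field_simps)
    then have "(LINT x|lborel. Im (w x) *\<^sub>R iexp (t * x)) =
        (LINT x|lborel. (- \<i> / 2) * (w x * iexp (t * x) - cnj (w x) * iexp (t * x)))" by (simp only:)
    also have "\<dots> = 0"
      using zero[of t] zero'[of t] int_e[OF w, of t] int_e[OF wc, of t] by simp
    finally show "(LINT x|lborel. Im (w x) *\<^sub>R iexp (t * x)) = 0" .
  qed (use w in simp)
  ultimately show ?thesis by eventually_elim (simp add: complex_eq_iff)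
qed

text \<open>Exponential integrability dominates the partial sums of the exponential series
  uniformly. The Fourier transform is thus a limit of combinations of moments.\<close>

lemma moments_zero:
  fixes w :: "real \<Rightarrow> complex"
  assumes exp_int: "\<And>t. t \<ge> 0 \<Longrightarrow> integrable lborel (\<lambda>x. cmod (w x) * exp (t * \<bar>x\<bar>))"
    and [measurable]: "w \<in> borel_measurable borel"
    and zero: "\<And>n. (LINT x|lborel. w x * of_real (x ^ n)) = 0"
  shows "AE x in lborel. w x = 0"
proof (rule fourier_transform_zero)
  show w: "integrable lborel w"
    using exp_int[of 0] by (simp add: integrable_norm_iff)
  fix t
  have term_bound: "cmod (w x * (\<Sum>n<N. (\<i> * of_real (t * x)) ^ n /\<^sub>R fact n)) \<le> cmod (w x) * exp (\<bar>t\<bar> * \<bar>x\<bar>)" for x N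
  proof -
    have "cmod (\<Sum>n<N. (\<i> * of_real (t * x)) ^ n /\<^sub>R fact n) \<le> (\<Sum>n<N. (\<bar>t\<bar> * \<bar>x\<bar>) ^ n /\<^sub>R fact n)"
      by (rule order_trans[OF norm_sum]) (simp add: norm_power norm_mult abs_mult)
    also have "\<dots> \<le> exp (\<bar>t\<bar> * \<bar>x\<bar>)"
      unfolding exp_def by (intro sum_le_suminf summable_exp_generic) auto
    finally show ?thesis by (simp add: norm_mult mult_left_mono)
  qed
  have "(\<lambda>N. LINT x|lborel. w x * (\<Sum>n<N. (\<i> * of_real (t * x)) ^ n /\<^sub>R fact n)) \<longlonglongrightarrow> (LINT x|lborel. w x * iexp (t * x))"
  proof (rule integral_dominated_convergence[where w = "\<lambda>x. cmod (w x) * exp (\<bar>t\<bar> * \<bar>x\<bar>)"])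
    show "AE x in lborel. (\<lambda>N. w x * (\<Sum>n<N. (\<i> * of_real (t * x)) ^ n /\<^sub>R fact n)) \<longlonglongrightarrow> w x * iexp (t * x)"
      using exp_converges[where 'a = complex] unfolding sums_def by (intro AE_I2 tendsto_mult tendsto_const)
    show "AE x in lborel. norm (w x * (\<Sum>n<N. (\<i> * of_real (t * x)) ^ n /\<^sub>R fact n)) \<le> cmod (w x) * exp (\<bar>t\<bar> * \<bar>x\<bar>)" for N
      using term_bound by (intro AE_I2)
  qed (use exp_int in auto)
  moreover have "(LINT x|lborel. w x * (\<Sum>n<N. (\<i> * of_real (t * x)) ^ n /\<^sub>R fact n)) = 0" for N
  proof -
    have mono_int: "integrable lborel (\<lambda>x. w x * of_real (x ^ n))" for n
    proof (rule Bochner_Integration.integrable_bound)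
      show "integrable lborel (\<lambda>x. real n ^ n * (cmod (w x) * exp (1 * \<bar>x\<bar>)))"
        using exp_int[of 1] by simp
      have "cmod (w x * of_real (x ^ n)) \<le> real n ^ n * (cmod (w x) * exp (1 * \<bar>x\<bar>))" for x
        using mult_left_mono[OF power_le_exp[of "\<bar>x\<bar>" n], of "cmod (w x)"]
        by (simp add: norm_mult norm_power power_abs mult_ac)
      then show "AE x in lborel. norm (w x * of_real (x ^ n)) \<le> norm (real n ^ n * (cmod (w x) * exp (1 * \<bar>x\<bar>)))"
        by (intro AE_I2 order_trans[OF _ abs_ge_self[THEN order_trans[OF _ eq_refl[OF real_norm_def[symmetric]]]]])
    qed simp
    have "w x * (\<Sum>n<N. (\<i> * of_real (t * x)) ^ n /\<^sub>R fact n) =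
        (\<Sum>n<N. ((\<i> * of_real t) ^ n / fact n) * (w x * of_real (x ^ n)))" for x
      by (simp add: sum_distrib_left scaleR_conv_of_real power_mult_distrib divide_inverse mult_ac)
    then show ?thesis
      using mono_int zero by (simp add: Bochner_Integration.integral_sum)
  qed
  ultimately show "(LINT x|lborel. w x * iexp (t * x)) = 0"
    by (simp add: LIMSEQ_const_iff)
qed

section \<open>Completeness of the explicit eigenfunctions\<close>

lemma nil_L2_integrable: "f \<in> nil_Lp 2 \<Longrightarrow> integrable nil_measure f"
  using nil_L2_integrable_mult[of f "\<lambda>x. 1"] nil_smooth_Lp[OF nil_smooth_const[of 1], of 2] by simp

definition full_strip :: "heis set" where
  "full_strip = (\<Union>q. nil_strip (int_decode q))"

lemma full_strip_eq: "full_strip = UNIV \<times> {0..<1} \<times> {0..<1}"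
proof -
  have "x \<in> full_strip" if "x \<in> UNIV \<times> {0..<1} \<times> {0..<1}" for x :: heis
  proof -
    have "x \<in> nil_strip \<lfloor>fst x\<rfloor>" using that by (auto simp: nil_strip_def)
    then show ?thesis unfolding full_strip_def using surj_int_decode by (metis UN_iff UNIV_I surjD)
  qed
  then show ?thesis by (auto simp: full_strip_def nil_strip_def)
qed

lemma full_strip_borel [measurable]: "full_strip \<in> sets borel"
  unfolding full_strip_def by auto

lemma nil_strip_disjoint: "q \<noteq> q' \<Longrightarrow> nil_strip (int_decode q) \<inter> nil_strip (int_decode q') = {}"
proof -
  have "m = m'" if "x \<in> nil_strip m" "x \<in> nil_strip m'" for x m m'
    using that by (auto simp: nil_strip_def)
  then show "q \<noteq> q' \<Longrightarrow> nil_strip (int_decode q) \<inter> nil_strip (int_decode q') = {}"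
    by (metis disjoint_iff int_decode_eq)
qed

interpretation line_unit2: pair_sigma_finite lborel "unit_lborel \<Otimes>\<^sub>M unit_lborel" ..

lemma full_strip_measure: "restrict_space lborel full_strip = lborel \<Otimes>\<^sub>M (unit_lborel \<Otimes>\<^sub>M unit_lborel)"
proof -
  have [measurable]: "{0..<1::real} \<times> {0..<1::real} \<in> sets borel"
    by (simp add: borel_prod[symmetric])
  have "restrict_space lborel UNIV \<Otimes>\<^sub>M restrict_space lborel ({0..<1} \<times> {0..<1}) = restrict_space (lborel \<Otimes>\<^sub>M lborel :: heis measure) (UNIV \<times> {0..<1} \<times> {0..<1})"
    by (rule pair_restrict_space) (auto simp: sigma_finite_lborel)
  moreover have "restrict_space lborel (UNIV :: real set) = lborel"
    by (rule measure_eqI) (auto simp: sets_restrict_space emeasure_restrict_space)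
  ultimately show ?thesis by (simp add: full_strip_eq lborel_prod unit_lborel_pair_eq)
qed

text \<open>Profiles in a that decay fast enough for the contributions of the unit strips to be
  summable.\<close>

definition decaying :: "(real \<Rightarrow> complex) \<Rightarrow> bool" where
  "decaying v \<longleftrightarrow> v \<in> borel_measurable borel \<and> (\<exists>C\<ge>0. \<forall>a. cmod (v a) \<le> C / (1 + a\<^sup>2))"

text \<open>
  Left invariance moves the \<open>m\<close>-th term of a theta series from the fundamental domain to the translate
  by \<open>m\<close> in the direction of \<open>a\<close>. Pairing \<open>r\<close> with the series thus unfolds to an integral over
  \<open>\<real> \<times> [0,1)\<^sup>2\<close>, where Hermite functions can be used.
\<close>

context
  fixes r :: "heis \<Rightarrow> complex" and i k :: int
  assumes r: "r \<in> nil_Lp 2"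
begin

definition strip_fun :: "(real \<Rightarrow> complex) \<Rightarrow> heis \<Rightarrow> complex" where
  "strip_fun v x = r x * cnj (fourier_char 0 i k x) * v (fst x)"

text \<open>Meant for all real a: by invariance its values on [m, m + 1) are the coefficients of r
  on the cube at frequency i + k m in b. One function on the line thus collects a whole residue
  class of frequencies modulo k, as in the Weil-Brezin transform.\<close>

definition fiber_coeff :: "real \<Rightarrow> complex" where
  "fiber_coeff a = (LINT y|(unit_lborel \<Otimes>\<^sub>M unit_lborel). r (a, y) * cnj (fourier_char 0 i k (a, y)))"

lemma strip_borel [measurable]: "r \<in> borel_measurable borel"
  using r by (rule nil_LpD)

lemma fourier_char_borel [measurable]: "fourier_char l n j \<in> borel_measurable borel"
  by (rule borel_measurable_continuous_onI[OF fourier_char_continuous])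

lemma strip_fun_borel: "v \<in> borel_measurable borel \<Longrightarrow> strip_fun v \<in> borel_measurable borel"
proof -
  assume v: "v \<in> borel_measurable borel"
  have "(\<lambda>x::heis. v (fst x)) \<in> borel_measurable borel"
    by (rule measurable_compose[OF _ v]) (simp add: borel_measurable_continuous_onI continuous_on_fst)
  then show ?thesis unfolding strip_fun_def[abs_def] by measurable
qed

lemma strip_fun_shift:
  "strip_fun v (a + of_int m, b, c + of_int m * b) =
    r (a, b, c) * cnj (fourier_char 0 (i + k * m) k (a, b, c)) * v (a + of_int m)"
  using nil_invariantD[OF nil_LpD(1)[OF r], of a m b 0 c 0]
  by (simp add: strip_fun_def fourier_char_def algebra_simps)

lemma strip_fun_periodic: "strip_fun v (a, b, c + 1) = strip_fun v (a, b, c)"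
proof -
  have "2 * pi * (of_int i * b + of_int k * (c + 1)) = 2 * pi * (of_int i * b + of_int k * c) + 2 * pi * of_int k"
    by (simp add: algebra_simps)
  then have "cis (2 * pi * (of_int i * b + of_int k * (c + 1))) = cis (2 * pi * (of_int i * b + of_int k * c))"
    by (simp add: cis_mult[symmetric] cis_multiple_2pi)
  then show ?thesis
    by (simp add: strip_fun_def fourier_char_def nil_invariant_periodic_c[OF nil_LpD(1)[OF r]])
qed

lemma integral_strip_fun:
  assumes "v \<in> borel_measurable borel"
  shows "(LINT x:nil_strip m|lborel. strip_fun v x) =
    (LINT x|nil_measure. r x * cnj (fourier_char 0 (i + k * m) k x) * v (fst x + of_int m))"
  by (subst integral_nil_strip[OF strip_fun_borel[OF assms] strip_fun_periodic])
    (auto simp: strip_fun_shift intro!: Bochner_Integration.integral_cong)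

lemma strip_fun_integrable:
  assumes v: "decaying v" shows "set_integrable lborel full_strip (strip_fun v)"
  unfolding set_integrable_def
proof (rule integrableI_bounded)
  from v obtain C where C: "C \<ge> 0" "\<And>a. cmod (v a) \<le> C / (1 + a\<^sup>2)" and vm: "v \<in> borel_measurable borel"
    by (auto simp: decaying_def)
  note [measurable] = strip_fun_borel[OF vm]
  show "(\<lambda>x. indicat_real full_strip x *\<^sub>R strip_fun v x) \<in> borel_measurable lborel" by measurable
  define N where "N = (LINT x|nil_measure. cmod (r x))"
  have N: "N \<ge> 0" by (simp add: N_def)
  \<comment> \<open>On the cube \<open>a\<^sup>2\<close> is at most 1, so Peetre's inequality yields
    the factor 4 and decay in m.\<close>
  have strip: "(\<integral>\<^sup>+x. ennreal (cmod (strip_fun v x)) * indicator (nil_strip m) x \<partial>lborel)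
      \<le> ennreal (4 * C * N * (1 / (1 + (of_int m)\<^sup>2)))" for m
  proof -
    have "(\<integral>\<^sup>+x. ennreal (cmod (strip_fun v x)) * indicator (nil_strip m) x \<partial>lborel) =
        (\<integral>\<^sup>+(a, b, c). ennreal (cmod (strip_fun v (a + of_int m, b, c + of_int m * b))) \<partial>nil_measure)"
      by (rule nn_integral_nil_strip) (auto simp: strip_fun_periodic)
    also have "\<dots> \<le> (\<integral>\<^sup>+x. ennreal (4 * C / (1 + (of_int m)\<^sup>2) * cmod (r x)) \<partial>nil_measure)"
    proof (rule nn_integral_mono)
      fix x assume "x \<in> space nil_measure"
      then obtain a b c where x: "x = (a, b, c)" "0 \<le> a" "a < 1" by (auto simp: space_nil_measure)
      have "a\<^sup>2 \<le> 1" using x by (simp add: power_le_one)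
      then have "2 * (1 + a\<^sup>2) / (1 + (real_of_int m)\<^sup>2) \<le> 4 / (1 + (of_int m)\<^sup>2)"
        by (intro divide_right_mono) auto
      then have "1 / (1 + (a + of_int m)\<^sup>2) \<le> 4 / (1 + (of_int m)\<^sup>2)"
        using Peetre[of a "of_int m"] by linarith
      then have "C * (1 / (1 + (a + of_int m)\<^sup>2)) \<le> C * (4 / (1 + (of_int m)\<^sup>2))"
        by (rule mult_left_mono[OF _ C(1)])
      then have "cmod (v (a + of_int m)) \<le> 4 * C / (1 + (of_int m)\<^sup>2)"
        using C(2)[of "a + of_int m"] by (simp add: mult.commute)
      then have "cmod (r x) * cmod (v (a + of_int m)) \<le> cmod (r x) * (4 * C / (1 + (of_int m)\<^sup>2))"
        by (intro mult_left_mono) auto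
      then show "(case x of (a, b, c) \<Rightarrow> ennreal (cmod (strip_fun v (a + of_int m, b, c + of_int m * b))))
          \<le> ennreal (4 * C / (1 + (of_int m)\<^sup>2) * cmod (r x))"
        using x by (simp only: prod.case strip_fun_shift norm_mult complex_mod_cnj cmod_fourier_char mult_1_right)
          (simp only: mult.commute ennreal_leI)
    qed
    also have "\<dots> = ennreal (4 * C / (1 + (of_int m)\<^sup>2) * N)"
      using C(1) nil_L2_integrable[OF r] unfolding N_def
      by (subst nn_integral_eq_integral) auto
    finally show ?thesis by (simp add: mult_ac)
  qed
  have "(\<integral>\<^sup>+x. ennreal (norm (indicat_real full_strip x *\<^sub>R strip_fun v x)) \<partial>lborel) =
      (\<integral>\<^sup>+x. (\<Sum>q. ennreal (cmod (strip_fun v x)) * indicator (nil_strip (int_decode q)) x) \<partial>lborel)"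
  proof (intro nn_integral_cong)
    fix x
    have "disjoint_family (\<lambda>q. nil_strip (int_decode q))"
      using nil_strip_disjoint by (auto simp: disjoint_family_on_def)
    from suminf_indicator[OF this, of x]
    have "(\<Sum>q. indicator (nil_strip (int_decode q)) x) = (indicator full_strip x :: ennreal)"
      by (simp add: full_strip_def)
    then show "ennreal (norm (indicat_real full_strip x *\<^sub>R strip_fun v x)) =
        (\<Sum>q. ennreal (cmod (strip_fun v x)) * indicator (nil_strip (int_decode q)) x)"
      by (auto simp: ennreal_suminf_cmult indicator_def)
  qed
  also have "\<dots> = (\<Sum>q. \<integral>\<^sup>+x. ennreal (cmod (strip_fun v x)) * indicator (nil_strip (int_decode q)) x \<partial>lborel)"
    by (rule nn_integral_suminf) measurable
  also have "\<dots> \<le> (\<Sum>q. ennreal (4 * C * N * (1 / (1 + (real_of_int (int_decode q))\<^sup>2))))"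
    by (intro suminf_le strip) auto
  also have "\<dots> = ennreal (\<Sum>q. 4 * C * N * (1 / (1 + (real_of_int (int_decode q))\<^sup>2)))"
    using C(1) N by (intro suminf_ennreal2 summable_mult summable_int_decode) auto
  also have "\<dots> < \<infinity>" by simp
  finally show "(\<integral>\<^sup>+x. ennreal (norm (indicat_real full_strip x *\<^sub>R strip_fun v x)) \<partial>lborel) < \<infinity>" .
qed

lemma
  assumes v: "decaying v"
  shows fiber_coeff_integrable: "integrable lborel (\<lambda>a. fiber_coeff a * v a)"
    and fiber_coeff_integral: "(LINT a|lborel. fiber_coeff a * v a) = (LINT x:full_strip|lborel. strip_fun v x)"
proof -
  have vm [measurable]: "v \<in> borel_measurable borel" using v by (simp add: decaying_def)
  have "integrable (restrict_space lborel full_strip) (strip_fun v)"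
    using strip_fun_integrable[OF v] by (simp add: set_integrable_def integrable_restrict_space)
  then have int: "integrable (lborel \<Otimes>\<^sub>M (unit_lborel \<Otimes>\<^sub>M unit_lborel)) (strip_fun v)"
    by (simp only: full_strip_measure)
  have eq: "(LINT y|(unit_lborel \<Otimes>\<^sub>M unit_lborel). strip_fun v (a, y)) = fiber_coeff a * v a" for a
    by (simp add: strip_fun_def fiber_coeff_def)
  show "integrable lborel (\<lambda>a. fiber_coeff a * v a)"
    using line_unit2.integrable_fst'[OF int] by (simp only: eq)
  have "(LINT a|lborel. fiber_coeff a * v a) = integral\<^sup>L (restrict_space lborel full_strip) (strip_fun v)"
    using line_unit2.integral_fst'[OF int] by (simp only: eq full_strip_measure)
  then show "(LINT a|lborel. fiber_coeff a * v a) = (LINT x:full_strip|lborel. strip_fun v x)"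
    by (simp add: set_lebesgue_integral_def integral_restrict_space)
qed

lemma fiber_coeff_borel [measurable]: "fiber_coeff \<in> borel_measurable borel"
proof -
  have "(\<lambda>x. r x * cnj (fourier_char 0 i k x)) \<in> borel_measurable (lborel \<Otimes>\<^sub>M (unit_lborel \<Otimes>\<^sub>M unit_lborel))"
    unfolding full_strip_measure[symmetric] by (intro measurable_restrict_space1) simp
  then have "fiber_coeff \<in> borel_measurable lborel"
    unfolding fiber_coeff_def by (intro unit_lborel2.borel_measurable_lebesgue_integral) (simp add: split_beta')
  then show ?thesis by simp
qed

lemma decaying_indicator:
  assumes "v \<in> borel_measurable borel" "\<And>a. cmod (v a) \<le> 1"
  shows "decaying (\<lambda>a. indicator {of_int m..<of_int m + 1} a * v a)"
  unfolding decaying_def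
proof (intro conjI exI[of _ "1 + (\<bar>of_int m\<bar> + 1)\<^sup>2"] allI)
  show "(\<lambda>a. indicator {of_int m..<of_int m + 1} a * v a) \<in> borel_measurable borel"
    using assms(1) by measurable
  fix a :: real
  show "cmod (indicator {of_int m..<of_int m + 1} a * v a) \<le> (1 + (\<bar>of_int m\<bar> + 1)\<^sup>2) / (1 + a\<^sup>2)"
  proof (cases "a \<in> {of_int m..<of_int m + 1}")
    case True
    then have "a\<^sup>2 \<le> (\<bar>of_int m\<bar> + 1)\<^sup>2" by (subst power2_abs[symmetric], intro power_mono) auto
    then have "1 \<le> (1 + (\<bar>of_int m\<bar> + 1)\<^sup>2) / (1 + a\<^sup>2)" by (simp add: le_divide_eq add_pos_nonneg)
    then show ?thesis using True assms(2)[of a] by simp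
  qed simp
qed simp

text \<open>The converse direction of the unfolding: restricting the line to one unit interval
  recovers the coefficients with frequency i + k m from \<open>fiber_coeff\<close>.\<close>

lemma fiber_coeff_strip:
  assumes "v \<in> borel_measurable borel" "\<And>a. cmod (v a) \<le> 1"
  shows "(LINT a|lborel. fiber_coeff a * (indicator {of_int m..<of_int m + 1} a * v a)) =
     (LINT x|nil_measure. r x * cnj (fourier_char 0 (i + k * m) k x) * v (fst x + of_int m))"
proof -
  have sub: "nil_strip m \<subseteq> full_strip" by (auto simp: full_strip_eq nil_strip_def)
  have "(LINT x:full_strip|lborel. strip_fun (\<lambda>a. indicator {of_int m..<of_int m + 1} a * v a) x) = (LINT x:nil_strip m|lborel. strip_fun v x)"
    unfolding set_lebesgue_integral_def
    by (intro Bochner_Integration.integral_cong refl)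
      (auto simp: indicator_def strip_fun_def full_strip_eq nil_strip_def)
  then show ?thesis
    by (simp only: fiber_coeff_integral[OF decaying_indicator[OF assms]] integral_strip_fun[OF assms(1)])
qed

text \<open>Half of the Gaussian absorbs the exponential growth, the other half provides the decay;
  Peetre's inequality removes the shift s. The exponential factor is what the moment argument
  consumes.\<close>

lemma decaying_gauss:
  assumes "\<kappa> > 0" "t \<ge> 0"
  shows "decaying (\<lambda>a. of_real (gauss_poly \<kappa> p (a + s) * exp (t * \<bar>a\<bar>)))"
proof -
  obtain C where C: "C \<ge> 0" "\<And>x. \<bar>gauss_poly (\<kappa> / 2) p x\<bar> \<le> C / (1 + x\<^sup>2)"
    using gauss_poly_decay[of "\<kappa> / 2" p] assms by auto
  define D where "D = exp (t\<^sup>2 / \<kappa> + t * \<bar>s\<bar>)"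
  have "\<bar>gauss_poly \<kappa> p (a + s) * exp (t * \<bar>a\<bar>)\<bar> \<le> D * (C * (2 * (1 + s\<^sup>2))) / (1 + a\<^sup>2)" for a
  proof -
    \<comment> \<open>Completing the square bounds t |a + s| by a constant plus half of the Gaussian
      exponent; the constant goes into \<open>D\<close>.\<close>
    have "0 \<le> (\<kappa> * \<bar>a + s\<bar> - 2 * t)\<^sup>2 / (4 * \<kappa>)" using assms by simp
    also have "\<dots> = t\<^sup>2 / \<kappa> + \<kappa> / 2 * (a + s)\<^sup>2 / 2 - t * \<bar>a + s\<bar>"
      using assms(1) by (simp add: power2_eq_square field_simps flip: abs_mult)
    finally have sq: "t * \<bar>a + s\<bar> \<le> t\<^sup>2 / \<kappa> + \<kappa> / 2 * (a + s)\<^sup>2 / 2" by linarith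
    have "\<bar>a\<bar> \<le> \<bar>a + s\<bar> + \<bar>s\<bar>" by linarith
    then have "t * \<bar>a\<bar> \<le> t * (\<bar>a + s\<bar> + \<bar>s\<bar>)" using assms(2) by (rule mult_left_mono)
    with sq have "- (\<kappa> * (a + s)\<^sup>2 / 2) + t * \<bar>a\<bar> \<le> - (\<kappa> / 2 * (a + s)\<^sup>2 / 2) + (t\<^sup>2 / \<kappa> + t * \<bar>s\<bar>)"
      by (simp add: distrib_left)
    then have "exp (- (\<kappa> * (a + s)\<^sup>2 / 2)) * exp (t * \<bar>a\<bar>) \<le> D * exp (- (\<kappa> / 2 * (a + s)\<^sup>2 / 2))"
      unfolding D_def by (simp only: mult_exp_exp exp_le_cancel_iff add.commute)
    then have "\<bar>poly p (a + s)\<bar> * (exp (- (\<kappa> * (a + s)\<^sup>2 / 2)) * exp (t * \<bar>a\<bar>)) \<le> \<bar>poly p (a + s)\<bar> * (D * exp (- (\<kappa> / 2 * (a + s)\<^sup>2 / 2)))"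
      by (rule mult_left_mono) simp
    then have "\<bar>gauss_poly \<kappa> p (a + s) * exp (t * \<bar>a\<bar>)\<bar> \<le> D * \<bar>gauss_poly (\<kappa> / 2) p (a + s)\<bar>"
      by (simp add: gauss_poly_def abs_mult mult_ac)
    also have "\<dots> \<le> D * (C * (1 / (1 + (s + a)\<^sup>2)))"
      using C(2)[of "a + s"] by (intro mult_left_mono) (auto simp: D_def add.commute)
    also have "\<dots> \<le> D * (C * (2 * (1 + s\<^sup>2) / (1 + a\<^sup>2)))"
      by (intro mult_left_mono Peetre C) (simp add: D_def)
    finally show ?thesis by simp
  qed
  moreover have "(\<lambda>a. of_real (gauss_poly \<kappa> p (a + s) * exp (t * \<bar>a\<bar>)) :: complex) \<in> borel_measurable borel"
    unfolding gauss_poly_def by (intro borel_measurable_continuous_onI continuous_intros) auto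
  moreover have "D * (C * (2 * (1 + s\<^sup>2))) \<ge> 0" using C(1) by (simp add: D_def)
  ultimately show ?thesis unfolding decaying_def by (auto simp: norm_mult abs_mult)
qed

lemma nil_inner_theta:
  assumes k: "k \<noteq> 0"
  shows "nil_inner r (theta k i p) =
    (LINT a|lborel. fiber_coeff a * of_real (gauss_poly (2 * pi * \<bar>of_int k\<bar>) p (a + of_int i / of_int k)))"
proof -
  let ?\<kappa> = "2 * pi * \<bar>real_of_int k\<bar>"
  define v where "v a = complex_of_real (gauss_poly ?\<kappa> p (a + of_int i / of_int k))" for a
  have dv: "decaying v"
    using decaying_gauss[of ?\<kappa> 0 p "of_int i / of_int k"] k by (simp add: v_def[abs_def])
  then have vm: "v \<in> borel_measurable borel" by (simp add: decaying_def)
  have strip: "nil_inner r (theta_term k i p m) = (LINT x:nil_strip m|lborel. strip_fun v x)" for m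
  proof -
    have "cnj (theta_term k i p m x) = cnj (fourier_char 0 (i + k * m) k x) * v (fst x + of_int m)" for x
      by (simp add: theta_term_def fourier_char_def split_beta v_def algebra_simps)
    then show ?thesis
      by (simp add: nil_inner_def integral_strip_fun[OF vm] mult.assoc)
  qed
  have term_cont: "continuous_on UNIV (theta_term k i p m)" for m
    using theta_term_has_derivative[OF k, THEN has_derivative_continuous]
    by (auto simp: continuous_on_eq_continuous_at)
  have [measurable]: "theta_term k i p m \<in> borel_measurable nil_measure" for m
    by (rule borel_measurable_nil[OF borel_measurable_continuous_onI[OF term_cont]])
  have [measurable]: "theta k i p \<in> borel_measurable nil_measure"
    by (rule borel_measurable_nil[OF nil_smooth_borel[OF theta_smooth[OF k]]])
  have [measurable]: "r \<in> borel_measurable nil_measure" by (rule borel_measurable_nil[OF strip_borel])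
  obtain C where C: "C \<ge> 0" "\<And>m x. cmod (theta_term k i p m x) \<le> C * (1 + (fst x + of_int i / of_int k)\<^sup>2) / (1 + (of_int m)\<^sup>2)"
    using theta_term_bound[OF k, of i p] by blast
  \<comment> \<open>The term bound made uniform on the cube. Its sum \<open>Z\<close> gives the
    dominating function \<open>Z\<close> |r| for interchanging the series with the integral.\<close>
  define W where "W = C * (1 + (1 + \<bar>of_int i / of_int k\<bar>)\<^sup>2)"
  have W: "W \<ge> 0" using C by (simp add: W_def)
  have Wb: "cmod (theta_term k i p m x) \<le> W * (1 / (1 + (of_int m)\<^sup>2))" if "x \<in> space nil_measure" for m x
  proof -
    have "\<bar>fst x + of_int i / of_int k\<bar> \<le> 1 + \<bar>of_int i / of_int k\<bar>"
      using that by (intro order_trans[OF abs_triangle_ineq] add_mono) (auto simp: space_nil_measure)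
    then have "(fst x + of_int i / of_int k)\<^sup>2 \<le> (1 + \<bar>of_int i / of_int k\<bar>)\<^sup>2"
      by (subst power2_abs[symmetric], intro power_mono) auto
    then have "C * (1 + (fst x + of_int i / of_int k)\<^sup>2) / (1 + (of_int m)\<^sup>2) \<le> W / (1 + (of_int m)\<^sup>2)"
      unfolding W_def by (intro divide_right_mono mult_left_mono C(1)) auto
    then show ?thesis using C(2)[of m x] by simp
  qed
  define Z where "Z = (\<Sum>q. W * (1 / (1 + (real_of_int (int_decode q))\<^sup>2)))"
  have Zb: "cmod (\<Sum>q<n. theta_term k i p (int_decode q) x) \<le> Z" if "x \<in> space nil_measure" for x n
  proof -
    have "cmod (\<Sum>q<n. theta_term k i p (int_decode q) x) \<le> (\<Sum>q<n. W * (1 / (1 + (real_of_int (int_decode q))\<^sup>2)))"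
      by (rule order_trans[OF norm_sum sum_mono]) (rule Wb[OF that])
    also have "\<dots> \<le> Z"
      unfolding Z_def using W by (intro sum_le_suminf summable_mult summable_int_decode) auto
    finally show ?thesis .
  qed
  have ri: "integrable nil_measure r" by (rule nil_L2_integrable[OF r])
  have "(\<lambda>n. LINT x|nil_measure. r x * cnj (\<Sum>q<n. theta_term k i p (int_decode q) x)) \<longlonglongrightarrow> nil_inner r (theta k i p)"
    unfolding nil_inner_def
  proof (rule integral_dominated_convergence[where w = "\<lambda>x. Z * cmod (r x)"])
    show "AE x in nil_measure. (\<lambda>n. r x * cnj (\<Sum>q<n. theta_term k i p (int_decode q) x)) \<longlonglongrightarrow> r x * cnj (theta k i p x)"
      using theta_sums[OF k] unfolding sums_def by (intro AE_I2 tendsto_mult tendsto_const tendsto_cnj)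
    show "AE x in nil_measure. norm (r x * cnj (\<Sum>q<n. theta_term k i p (int_decode q) x)) \<le> Z * cmod (r x)" for n
      using Zb by (intro AE_I2) (simp add: norm_mult mult.commute[of Z] mult_left_mono del: cnj_sum)
    show "integrable nil_measure (\<lambda>x. Z * cmod (r x))" using ri by simp
  qed measurable
  moreover have "(LINT x|nil_measure. r x * cnj (\<Sum>q<n. theta_term k i p (int_decode q) x)) =
      (\<Sum>q<n. LINT x:nil_strip (int_decode q)|lborel. strip_fun v x)" for n
  proof -
    have "integrable nil_measure (\<lambda>x. r x * cnj (theta_term k i p (int_decode q) x))" for q
    proof (rule Bochner_Integration.integrable_bound)
      show "integrable nil_measure (\<lambda>x. W * (1 / (1 + (real_of_int (int_decode q))\<^sup>2)) * cmod (r x))" using ri by simp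
      show "AE x in nil_measure. norm (r x * cnj (theta_term k i p (int_decode q) x)) \<le> norm (W * (1 / (1 + (real_of_int (int_decode q))\<^sup>2)) * cmod (r x))"
      proof (rule AE_I2)
        fix x assume "x \<in> space nil_measure"
        from mult_right_mono[OF Wb[OF this, of "int_decode q"], of "cmod (r x)"]
        show "norm (r x * cnj (theta_term k i p (int_decode q) x)) \<le> norm (W * (1 / (1 + (real_of_int (int_decode q))\<^sup>2)) * cmod (r x))"
          using W by (simp add: norm_mult mult_ac abs_mult)
      qed
    qed measurable
    then show ?thesis
      by (simp add: cnj_sum sum_distrib_left Bochner_Integration.integral_sum strip[symmetric] nil_inner_def)
  qed
  ultimately have "(\<lambda>q. LINT x:nil_strip (int_decode q)|lborel. strip_fun v x) sums nil_inner r (theta k i p)"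
    by (simp add: sums_def)
  moreover have "(LINT x:full_strip|lborel. strip_fun v x) = (\<Sum>q. LINT x:nil_strip (int_decode q)|lborel. strip_fun v x)"
    using strip_fun_integrable[OF dv] nil_strip_disjoint unfolding full_strip_def
    by (intro lebesgue_integral_countable_add) auto
  ultimately show ?thesis
    using fiber_coeff_integral[OF dv] by (simp add: sums_iff v_def)
qed

text \<open>The Gaussian factor gives exponential integrability and vanishes nowhere, so it can be
  divided out once all moments of the product are zero.\<close>

lemma fiber_coeff_zero:
  assumes k: "k \<noteq> 0" and zero: "\<And>p. nil_inner r (theta k i p) = 0"
  shows "AE a in lborel. fiber_coeff a = 0"
proof -
  let ?\<kappa> = "2 * pi * \<bar>real_of_int k\<bar>" and ?s = "real_of_int i / of_int k"
  have \<kappa>: "?\<kappa> > 0" using k by simp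
  define w where "w a = fiber_coeff a * of_real (gauss_poly ?\<kappa> 1 (a + ?s))" for a
  have "AE a in lborel. w a = 0"
  proof (rule moments_zero)
    have [measurable]: "(\<lambda>a. complex_of_real (gauss_poly ?\<kappa> 1 (a + ?s))) \<in> borel_measurable borel"
      using decaying_gauss[OF \<kappa>, of 0 1 ?s] by (simp add: decaying_def)
    show "w \<in> borel_measurable borel" unfolding w_def by measurable
    fix t :: real assume t: "t \<ge> 0"
    have "cmod (fiber_coeff a * of_real (gauss_poly ?\<kappa> 1 (a + ?s) * exp (t * \<bar>a\<bar>))) = cmod (w a) * exp (t * \<bar>a\<bar>)" for a
      by (simp add: w_def norm_mult)
    then show "integrable lborel (\<lambda>a. cmod (w a) * exp (t * \<bar>a\<bar>))"
      using integrable_norm[OF fiber_coeff_integrable[OF decaying_gauss[OF \<kappa> t, of 1 ?s]]] by (simp only:)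
  next
    fix n
    \<comment> \<open>The theta profile is evaluated at a + s; composing with x - s produces the
      monomial in a itself.\<close>
    define p where "p = pcompose (monom 1 n) [:- ?s, 1:]"
    have "fiber_coeff a * of_real (gauss_poly ?\<kappa> p (a + ?s)) = w a * of_real (a ^ n)" for a
      by (simp add: w_def gauss_poly_def p_def poly_pcompose poly_monom)
    then show "(LINT a|lborel. w a * of_real (a ^ n)) = 0"
      using zero[of p] by (simp add: nil_inner_theta[OF k])
  qed
  then show ?thesis
    by eventually_elim (simp add: w_def gauss_poly_def)
qed

end

text \<open>The span of the Hermite polynomials contains 1 and is closed under multiplication by x:
  the recursion expresses x H_j through H_(j+1) and the derivative of H_j, which is a multiple of
  H_(j-1).\<close>

lemma hermite_induct:
  assumes "\<kappa> \<noteq> 0" and herm: "\<And>j. P (hermite \<kappa> j)"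
    and add: "\<And>p q. P p \<Longrightarrow> P q \<Longrightarrow> P (p + q)" and smult: "\<And>c p. P p \<Longrightarrow> P (smult c p)"
  shows "P p"
proof -
  have "P (monom 1 n * hermite \<kappa> j)" for n j
  proof (induction n arbitrary: j)
    case 0
    then show ?case using herm by (simp add: monom_0)
  next
    case (Suc n)
    have X: "pCons 0 (hermite \<kappa> j) = smult (1 / (2 * \<kappa>)) (hermite \<kappa> (Suc j) + pderiv (hermite \<kappa> j))"
      using assms(1) by simp
    have "P (monom 1 n * smult (1 / (2 * \<kappa>)) (hermite \<kappa> (Suc j) + pderiv (hermite \<kappa> j)))"
    proof (cases j)
      case 0
      then show ?thesis
        unfolding mult_smult_right distrib_left
        by (intro smult) (simp only: hermite.simps(1) pderiv_1 mult_zero_right add_0_right Suc)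
    next
      case (Suc j')
      then show ?thesis
        unfolding Suc pderiv_hermite mult_smult_right distrib_left
        by (intro smult add Suc.IH[unfolded Suc])
    qed
    then have "P (monom 1 n * pCons 0 (hermite \<kappa> j))" by (simp only: X)
    then show ?case by (simp add: monom_Suc)
  qed
  then have mono: "P (monom 1 n)" for n by (metis hermite.simps(1) mult.right_neutral)
  have "p = (\<Sum>n\<le>degree p. smult (coeff p n) (monom 1 n))"
    using poly_as_sum_of_monoms[of p] by (simp add: smult_monom)
  moreover have "P (\<Sum>n\<le>N. smult (coeff p n) (monom 1 n))" for N
  proof (induction N)
    case 0
    from smult[OF mono[of 0], of "coeff p 0"] show ?case by simp
  next
    case (Suc N)
    from add[OF Suc smult[OF mono[of "Suc N"], of "coeff p (Suc N)"]] show ?case by simp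
  qed
  ultimately show ?thesis by metis
qed

text \<open>For k nonzero, every frequency n of b is i + k m with 0 \<le> i < |k|, so |k| theta
  families determine all coefficients of weight k. The coefficient at (l, n, k) is read off from the
  fiber coefficient on [m, m + 1).\<close>

lemma nil_completeness:
  assumes r: "r \<in> nil_Lp 2"
    and torus: "\<And>l n. nil_inner r (fourier_char l n 0) = 0"
    and theta: "\<And>k i j. k \<noteq> 0 \<Longrightarrow> 0 \<le> i \<Longrightarrow> i < \<bar>k\<bar> \<Longrightarrow> nil_inner r (theta k i (hermite (2 * pi * \<bar>of_int k\<bar>) j)) = 0"
  shows "AE x in nil_measure. r x = 0"
proof (rule fourier_uniqueness)
  show "integrable nil_measure r" by (rule nil_L2_integrable[OF r])
  fix l n k
  have cnj_char: "cnj (fourier_char l n k x) = fourier_char (- l) (- n) (- k) x" for l n k x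
  proof -
    have "2 * pi * (of_int (- l) * fst x + of_int (- n) * fst (snd x) + of_int (- k) * snd (snd x)) =
        - (2 * pi * (of_int l * fst x + of_int n * fst (snd x) + of_int k * snd (snd x)))"
      by (simp add: algebra_simps)
    then show ?thesis by (simp only: fourier_char_def split_beta cis_cnj)
  qed
  have "(LINT x|nil_measure. r x * cnj (fourier_char l n k x)) = 0" for l n k
  proof (cases "k = 0")
    case True
    then show ?thesis using torus[of l n] by (simp add: nil_inner_def)
  next
    case False
    \<comment> \<open>Division by |k| makes the residue nonnegative; the sign of k is put into
      \<open>m\<close>.\<close>
    define i where "i = n mod \<bar>k\<bar>"
    define m where "m = sgn k * (n div \<bar>k\<bar>)"
    have i: "0 \<le> i" "i < \<bar>k\<bar>" using False by (auto simp: i_def)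
    have "k * m = \<bar>k\<bar> * (n div \<bar>k\<bar>)" by (simp add: m_def abs_sgn)
    then have n: "i + k * m = n" by (simp add: i_def)
    have "nil_inner r (theta k i p) = 0" for p
    proof (rule hermite_induct[of "2 * pi * \<bar>real_of_int k\<bar>" "\<lambda>p. nil_inner r (theta k i p) = 0"])
      show "nil_inner r (theta k i (hermite (2 * pi * \<bar>of_int k\<bar>) j)) = 0" for j
        by (rule theta[OF False i])
      fix p q assume pq: "nil_inner r (theta k i p) = 0" "nil_inner r (theta k i q) = 0"
      have "nil_inner (theta k i p) r = 0" "nil_inner (theta k i q) r = 0"
        using pq by (simp_all add: nil_inner_cnj[of _ r])
      then have "nil_inner (\<lambda>x. theta k i p x + theta k i q x) r = 0"
        by (subst nil_inner_add_left) (simp_all add: nil_smooth_Lp theta_smooth False r)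
      then show "nil_inner r (theta k i (p + q)) = 0"
        using nil_inner_cnj[of "\<lambda>x. theta k i p x + theta k i q x" r] by (simp add: theta_add[OF False, abs_def])
    next
      fix c p assume "nil_inner r (theta k i p) = 0"
      then show "nil_inner r (theta k i (smult c p)) = 0"
        by (simp add: theta_smult[OF False, abs_def] nil_inner_cmult_right)
    qed (use False in simp)
    then have zero: "AE a in lborel. fiber_coeff r i k a = 0"
      by (rule fiber_coeff_zero[OF r False])
    define v where "v a = cnj (cis (2 * pi * (of_int l * a)))" for a
    have vm: "v \<in> borel_measurable borel"
      unfolding v_def by (intro borel_measurable_continuous_onI continuous_intros)
    have "(LINT a|lborel. fiber_coeff r i k a * (indicator {of_int m..<of_int m + 1} a * v a)) = 0"
      by (rule integral_eq_zero_AE) (use zero in \<open>eventually_elim, simp\<close>)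
    then have "(LINT x|nil_measure. r x * cnj (fourier_char 0 n k x) * v (fst x + of_int m)) = 0"
      using fiber_coeff_strip[OF r vm, of i k m] by (simp add: v_def n)
    moreover have "v (a + of_int m) = v a" for a
    proof -
      have "2 * pi * (of_int l * (a + of_int m)) = 2 * pi * (of_int l * a) + 2 * pi * of_int (l * m)"
        by (simp add: algebra_simps)
      then show ?thesis unfolding v_def by (simp only: cis_mult[symmetric] cis_multiple_2pi Ints_of_int mult_1_right)
    qed
    moreover have "cnj (fourier_char 0 n k x) * v (fst x) = cnj (fourier_char l n k x)" for x
      by (simp add: fourier_char_def split_beta v_def cis_mult algebra_simps flip: complex_cnj_mult)
    ultimately show ?thesis by (simp add: mult.assoc)
  qed
  from this[of "- l" "- n" "- k"] show "(LINT x|nil_measure. r x * fourier_char l n k x) = 0"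
    by (simp add: cnj_char)
qed

section \<open>Orthonormal bases of the eigenspaces\<close>

lemma fourier_char_has_derivative:
  "(fourier_char l n k has_derivative
     (\<lambda>h. (2 * pi * (of_int l * fst h + of_int n * fst (snd h) + of_int k * snd (snd h))) *\<^sub>R (\<i> * fourier_char l n k x))) (at x)"
proof -
  have "((\<lambda>x. 2 * pi * (of_int l * fst x + of_int n * fst (snd x) + of_int k * snd (snd x))) has_derivative
     (\<lambda>h. 2 * pi * (of_int l * fst h + of_int n * fst (snd h) + of_int k * snd (snd h)))) (at x)" for x :: heis
    by (auto intro!: derivative_eq_intros)
  from has_derivative_cis[OF this] show ?thesis
    by (simp add: fourier_char_def split_beta')
qed

lemma cont_diff_fourier_char: "cont_diff m (fourier_char l n k)"
proof (induction m)
  case 0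
  show ?case by (simp add: fourier_char_continuous)
next
  case (Suc m)
  show ?case
    by (rule cont_diff_SucI[OF fourier_char_has_derivative], unfold scaleR_conv_of_real)
      (intro cont_diff_mult cont_diff_const Suc)
qed

lemma torus_char_smooth: "fourier_char l n 0 \<in> nil_smooth"
proof -
  have "fourier_char l n 0 (heis_mult \<gamma> x) = fourier_char l n 0 x" if \<gamma>: "\<gamma> \<in> heis_lattice" for \<gamma> x
  proof -
    obtain p q s where \<gamma>: "\<gamma> = (of_int p, of_int q, of_int s)"
      using \<gamma> by (auto simp: heis_lattice_def elim!: Ints_cases)
    have "2 * pi * (of_int l * (of_int p + fst x) + of_int n * (of_int q + fst (snd x))) =
        2 * pi * (of_int l * fst x + of_int n * fst (snd x)) + 2 * pi * of_int (l * p + n * q)"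
      by (simp add: algebra_simps)
    then have "cis (2 * pi * (of_int l * (of_int p + fst x) + of_int n * (of_int q + fst (snd x)))) =
        cis (2 * pi * (of_int l * fst x + of_int n * fst (snd x)))"
      by (simp only: cis_mult[symmetric] cis_multiple_2pi Ints_of_int mult_1_right)
    then show ?thesis by (simp add: fourier_char_def heis_mult_def split_beta \<gamma>)
  qed
  then show ?thesis by (simp add: nil_smooth_iff cont_diff_fourier_char nil_invariant_def)
qed

lemma sublaplacian_torus_char:
  "sublaplacian (fourier_char l n 0) = (\<lambda>x. of_real (4 * pi\<^sup>2 * ((of_int l)\<^sup>2 + (of_int n)\<^sup>2)) * fourier_char l n 0 x)"
proof -
  note D = fourier_char_has_derivative[THEN frechet_derivative_at, symmetric]
  have A: "field_A (fourier_char l n 0) = (\<lambda>x. (2 * pi * of_int l * \<i>) * fourier_char l n 0 x)"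
    and B: "field_B (fourier_char l n 0) = (\<lambda>x. (2 * pi * of_int n * \<i>) * fourier_char l n 0 x)"
    by (simp_all add: fun_eq_iff field_A_def field_B_def D scaleR_conv_of_real)
  have lin: "field_A (\<lambda>x. c * fourier_char l n 0 x) = (\<lambda>x. c * field_A (fourier_char l n 0) x)"
    "field_B (\<lambda>x. c * fourier_char l n 0 x) = (\<lambda>x. c * field_B (fourier_char l n 0) x)" for c
    by (simp_all add: field_A_eq field_B_eq lie_field_cmult torus_char_smooth nil_smooth_cmult)
  have "field_A (field_A (fourier_char l n 0)) = (\<lambda>x. (2 * pi * of_int l * \<i>) * ((2 * pi * of_int l * \<i>) * fourier_char l n 0 x))"
    "field_B (field_B (fourier_char l n 0)) = (\<lambda>x. (2 * pi * of_int n * \<i>) * ((2 * pi * of_int n * \<i>) * fourier_char l n 0 x))"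
    by (simp_all only: A B lin)
  then show ?thesis
    by (simp add: fun_eq_iff sublaplacian_def power2_eq_square algebra_simps)
qed

text \<open>The equation holds pointwise here, in contrast to the L^2 closure in
  \<open>eigenspace\<close>.\<close>

definition mode :: "real \<Rightarrow> int \<Rightarrow> (heis \<Rightarrow> complex) set" where
  "mode \<mu> k = {f \<in> nil_smooth. central_weight k f \<and> sublaplacian f = (\<lambda>x. of_real (\<mu>\<^sup>2) * f x)}"

lemma mode_smooth: "f \<in> mode \<mu> k \<Longrightarrow> f \<in> nil_smooth"
  by (simp add: mode_def)

lemma mode_L2: "f \<in> mode \<mu> k \<Longrightarrow> f \<in> nil_Lp 2"
  by (simp add: mode_smooth nil_smooth_Lp)

lemma central_weight_add:
  assumes "central_weight k f" "central_weight k g" shows "central_weight k (\<lambda>x. f x + g x)"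
  unfolding central_weight_def
proof (intro allI)
  fix a b c
  have "f (a, b, c) = cis (2 * pi * of_int k * c) * f (a, b, 0)" "g (a, b, c) = cis (2 * pi * of_int k * c) * g (a, b, 0)"
    using assms unfolding central_weight_def by blast+
  then show "f (a, b, c) + g (a, b, c) = cis (2 * pi * of_int k * c) * (f (a, b, 0) + g (a, b, 0))"
    by (simp only: distrib_left)
qed

lemma central_weight_cmult:
  assumes "central_weight k f" shows "central_weight k (\<lambda>x. d * f x)"
  unfolding central_weight_def
proof (intro allI)
  fix a b c
  have "f (a, b, c) = cis (2 * pi * of_int k * c) * f (a, b, 0)"
    using assms unfolding central_weight_def by blast
  then show "d * f (a, b, c) = cis (2 * pi * of_int k * c) * (d * f (a, b, 0))"
    by (simp only: mult.left_commute)
qed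

lemma mode_add: "f \<in> mode \<mu> k \<Longrightarrow> g \<in> mode \<mu> k \<Longrightarrow> (\<lambda>x. f x + g x) \<in> mode \<mu> k"
  by (simp add: mode_def nil_smooth_add central_weight_add sublaplacian_add distrib_left)

lemma mode_cmult: "f \<in> mode \<mu> k \<Longrightarrow> (\<lambda>x. d * f x) \<in> mode \<mu> k"
  by (simp add: mode_def nil_smooth_cmult central_weight_cmult sublaplacian_cmult mult.left_commute)

lemma sublaplacian_zero: "sublaplacian (\<lambda>x. 0) = (\<lambda>x. 0)"
  using sublaplacian_cmult[OF nil_smooth_const[of 0], of 0] by simp

lemma mode_zero: "(\<lambda>x. 0) \<in> mode \<mu> k"
  by (simp add: mode_def nil_smooth_const central_weight_def sublaplacian_zero)

lemma mode_sum: "(\<And>i. i \<in> I \<Longrightarrow> F i \<in> mode \<mu> k) \<Longrightarrow> (\<lambda>x. \<Sum>i\<in>I. F i x) \<in> mode \<mu> k"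
  by (induction I rule: infinite_finite_induct) (auto intro: mode_add mode_zero)

lemma mode_eigenspace: "f \<in> mode \<mu> k \<Longrightarrow> f \<in> eigenspace \<mu>"
proof -
  assume f: "f \<in> mode \<mu> k"
  have "nil_norm 2 (\<lambda>x. 0) = 0" by (simp add: nil_norm_eq nil_L2_zero nil_rnorm_2_eq)
  moreover have "sublaplacian f = (\<lambda>x. of_real (\<mu>\<^sup>2) * f x)" using f by (simp add: mode_def)
  ultimately have "(\<lambda>n. nil_norm 2 (\<lambda>x. f x - f x)) \<longlonglongrightarrow> 0"
    "(\<lambda>n. nil_norm 2 (\<lambda>x. sublaplacian f x - of_real (\<mu>\<^sup>2) * f x)) \<longlonglongrightarrow> 0"
    by simp_all
  then show ?thesis
    unfolding eigenspace_def sublaplacian_closure_def mem_Collect_eq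
    by (intro conjI exI[of _ "\<lambda>_. f"] allI mode_L2[OF f] nil_L2_cmult mode_smooth[OF f])
qed

text \<open>The central field is skew and acts on weight k as the scalar 2 pi i k; distinct scalars
  force orthogonality.\<close>

lemma mode_orthogonal:
  assumes f: "f \<in> mode \<mu> k" and g: "g \<in> mode \<mu> k'" and "k \<noteq> k'"
  shows "nil_inner f g = 0"
proof -
  have C: "field_C f = (\<lambda>x. (\<i> * of_real (2 * pi * of_int k)) * f x)" if "f \<in> mode \<mu> k" for f k
    using central_weight_derivative[of f k] that by (auto simp: mode_def field_C_def fun_eq_iff)
  have "nil_inner (field_C f) g = - nil_inner f (field_C g)"
    by (rule nil_inner_field_C[OF mode_smooth[OF f] mode_smooth[OF g]])
  then have "(\<i> * of_real (2 * pi * of_int k)) * nil_inner f g = (\<i> * of_real (2 * pi * of_int k')) * nil_inner f g"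
    unfolding C[OF f] C[OF g] nil_inner_cmult_left nil_inner_cmult_right by simp
  then show ?thesis using assms(3) by auto
qed

lemma eigenspace_L2: "f \<in> eigenspace \<mu> \<Longrightarrow> f \<in> nil_Lp 2"
  by (simp add: eigenspace_def sublaplacian_closure_def)

text \<open>f is only a limit of smooth functions in the graph norm. Moving the operator onto the
  smooth e before taking the limit yields both eigenvalues for the same inner product.\<close>

lemma eigenspace_orthogonal:
  assumes f: "f \<in> eigenspace \<mu>" and e: "e \<in> nil_smooth" "sublaplacian e = (\<lambda>x. of_real \<nu> * e x)"
    and ne: "\<nu> \<noteq> \<mu>\<^sup>2"
  shows "nil_inner f e = 0"
proof -
  from f obtain \<phi> where \<phi>: "\<And>n. \<phi> n \<in> nil_smooth"
    "(\<lambda>n. nil_norm 2 (\<lambda>x. \<phi> n x - f x)) \<longlonglongrightarrow> 0"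
    "(\<lambda>n. nil_norm 2 (\<lambda>x. sublaplacian (\<phi> n) x - of_real (\<mu>\<^sup>2) * f x)) \<longlonglongrightarrow> 0"
    by (auto simp: eigenspace_def sublaplacian_closure_def)
  note fL = eigenspace_L2[OF f] and eL = nil_smooth_Lp[OF e(1), of 2, simplified]
  have 1: "(\<lambda>n. nil_inner (\<phi> n) e) \<longlonglongrightarrow> nil_inner f e"
    by (rule nil_inner_tendsto[OF nil_smooth_Lp[OF \<phi>(1)] fL eL \<phi>(2)]) simp
  have 2: "(\<lambda>n. nil_inner (sublaplacian (\<phi> n)) e) \<longlonglongrightarrow> nil_inner (\<lambda>x. of_real (\<mu>\<^sup>2) * f x) e"
    by (rule nil_inner_tendsto[OF nil_smooth_Lp[OF sublaplacian_smooth[OF \<phi>(1)]] nil_L2_cmult[OF fL] eL \<phi>(3)]) simp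
  have "nil_inner (sublaplacian (\<phi> n)) e = of_real \<nu> * nil_inner (\<phi> n) e" for n
    by (simp add: sublaplacian_symmetric[OF \<phi>(1) e(1)] e(2) nil_inner_cmult_right)
  then have "(\<lambda>n. of_real \<nu> * nil_inner (\<phi> n) e) \<longlonglongrightarrow> of_real (\<mu>\<^sup>2) * nil_inner f e"
    using 2 by (simp add: nil_inner_cmult_left)
  moreover have "(\<lambda>n. of_real \<nu> * nil_inner (\<phi> n) e) \<longlonglongrightarrow> of_real \<nu> * nil_inner f e"
    by (intro tendsto_mult tendsto_const 1)
  ultimately have "of_real (\<mu>\<^sup>2) * nil_inner f e = of_real \<nu> * nil_inner f e"
    by (rule LIMSEQ_unique)
  then show ?thesis using ne by (auto simp flip: of_real_power)
qed

section \<open>Gram-Schmidt and the assembly of an eigenspace basis\<close>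

definition nil_orthonormal :: "(heis \<Rightarrow> complex) set \<Rightarrow> bool" where
  "nil_orthonormal S \<longleftrightarrow> (\<forall>e\<in>S. \<forall>e'\<in>S. nil_inner e e' = (if e = e' then 1 else 0))"

lemma orthonormal_coeff:
  assumes "finite S" "S \<subseteq> nil_Lp 2" "nil_orthonormal S" "e' \<in> S"
  shows "nil_inner (\<lambda>x. \<Sum>e\<in>S. c e * e x) e' = c e'"
proof -
  have "nil_inner (\<lambda>x. \<Sum>e\<in>S. c e * e x) e' = (\<Sum>e\<in>S. c e * nil_inner e e')"
    using assms by (subst nil_inner_sum_left) (auto intro: nil_L2_cmult simp: nil_inner_cmult_left)
  also have "\<dots> = (\<Sum>e\<in>S. if e = e' then c e else 0)"
    using assms(3,4) by (intro sum.cong) (auto simp: nil_orthonormal_def)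
  finally show ?thesis using assms(1,4) by simp
qed

lemma orthonormal_norm:
  assumes "finite S" "S \<subseteq> nil_Lp 2" "nil_orthonormal S"
  shows "(nil_rnorm 2 (\<lambda>x. \<Sum>e\<in>S. c e * e x))\<^sup>2 = (\<Sum>e\<in>S. (cmod (c e))\<^sup>2)"
proof -
  have L: "(\<lambda>x. \<Sum>e\<in>S. c e * e x) \<in> nil_Lp 2"
    using assms(2) by (auto intro!: nil_L2_sum nil_L2_cmult)
  have "complex_of_real ((nil_rnorm 2 (\<lambda>x. \<Sum>e\<in>S. c e * e x))\<^sup>2) =
      nil_inner (\<lambda>x. \<Sum>e\<in>S. c e * e x) (\<lambda>x. \<Sum>e\<in>S. c e * e x)"
    by (rule nil_inner_self[symmetric])
  also have "\<dots> = (\<Sum>e\<in>S. nil_inner (\<lambda>x. \<Sum>e\<in>S. c e * e x) (\<lambda>x. c e * e x))"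
    using assms(2) L by (subst nil_inner_sum_right[of 2 2]) (auto intro!: nil_L2_cmult)
  also have "\<dots> = (\<Sum>e\<in>S. cnj (c e) * c e)"
    by (intro sum.cong) (simp_all add: nil_inner_cmult_right orthonormal_coeff[OF assms])
  also have "\<dots> = of_real (\<Sum>e\<in>S. (cmod (c e))\<^sup>2)"
    by (simp add: complex_norm_square mult.commute del: of_real_power)
  finally show ?thesis by (simp only: of_real_eq_iff)
qed

text \<open>Orthonormalises within one weight without evaluating inner products of theta functions.
  A generator whose residual has norm zero is already spanned almost everywhere and adds no
  vector.\<close>

lemma Gram_Schmidt:
  assumes "finite G" "G \<subseteq> mode \<mu> k"
  shows "\<exists>S. finite S \<and> S \<subseteq> mode \<mu> k \<and> nil_orthonormal S \<and>
    (\<forall>g\<in>G. \<exists>c. AE x in nil_measure. g x = (\<Sum>e\<in>S. c e * e x))"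
  using assms
proof (induction G)
  case empty
  show ?case by (intro exI[of _ "{}"]) (auto simp: nil_orthonormal_def)
next
  case (insert g G)
  then obtain S where S: "finite S" "S \<subseteq> mode \<mu> k" "nil_orthonormal S"
    "\<And>g. g \<in> G \<Longrightarrow> \<exists>c. AE x in nil_measure. g x = (\<Sum>e\<in>S. c e * e x)" by auto
  have SL: "S \<subseteq> nil_Lp 2" using S(2) mode_L2 by blast
  have g: "g \<in> mode \<mu> k" using insert by simp
  define h where "h x = g x + (- 1) * (\<Sum>e\<in>S. nil_inner g e * e x)" for x
  have h: "h \<in> mode \<mu> k"
    unfolding h_def using S(2) by (intro mode_add g mode_cmult mode_sum) auto
  have h_orth: "nil_inner h e = 0" if e: "e \<in> S" for e
  proof -
    have "nil_inner h e = nil_inner g e - nil_inner (\<lambda>x. \<Sum>e\<in>S. nil_inner g e * e x) e"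
      unfolding h_def using SL e
      by (simp add: nil_inner_diff_left mode_L2[OF g] nil_L2_sum nil_L2_cmult subset_iff)
    then show ?thesis by (simp add: orthonormal_coeff[OF S(1) SL S(3) e])
  qed
  show ?case
  proof (cases "nil_rnorm 2 h = 0")
    case True
    have "AE x in nil_measure. h x = 0" by (rule nil_rnorm_2_eq_0[OF mode_L2[OF h] True])
    then have "AE x in nil_measure. g x = (\<Sum>e\<in>S. nil_inner g e * e x)"
      by eventually_elim (simp add: h_def)
    then show ?thesis using S by blast
  next
    case False
    define N where "N = nil_rnorm 2 h"
    have N: "N > 0" using False nil_rnorm_nonneg[of 2 h] by (simp add: N_def less_le)
    define e0 where "e0 x = of_real (1 / N) * h x" for x
    have e0: "e0 \<in> mode \<mu> k" unfolding e0_def by (rule mode_cmult[OF h])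
    have "nil_inner e0 e0 = of_real (1 / N) * (cnj (of_real (1 / N)) * nil_inner h h)"
      unfolding e0_def nil_inner_cmult_left nil_inner_cmult_right ..
    then have n0: "nil_inner e0 e0 = 1"
      using N by (simp add: nil_inner_self N_def[symmetric] power2_eq_square)
    have o0: "nil_inner e0 e = 0" "nil_inner e e0 = 0" if "e \<in> S" for e
      using h_orth[OF that] nil_inner_cnj[of e h]
      unfolding e0_def nil_inner_cmult_left nil_inner_cmult_right by simp_all
    have "e0 \<notin> S" using n0 o0 by force
    have "nil_orthonormal (insert e0 S)"
      using S(3) n0 o0 \<open>e0 \<notin> S\<close> by (auto simp: nil_orthonormal_def)
    moreover have "\<exists>c. AE x in nil_measure. g' x = (\<Sum>e\<in>insert e0 S. c e * e x)" if g': "g' \<in> insert g G" for g'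
    proof (cases "g' = g")
      case True
      define c where "c e = (if e = e0 then of_real N else nil_inner g e)" for e
      have "(\<Sum>e\<in>S. c e * e x) = (\<Sum>e\<in>S. nil_inner g e * e x)" for x
        using \<open>e0 \<notin> S\<close> by (intro sum.cong) (auto simp: c_def)
      then have "g x = (\<Sum>e\<in>insert e0 S. c e * e x)" for x
        using \<open>e0 \<notin> S\<close> S(1) N by (simp add: c_def e0_def h_def)
      then show ?thesis using True by auto
    next
      case False
      then obtain c where c: "AE x in nil_measure. g' x = (\<Sum>e\<in>S. c e * e x)" using S(4) g' by blast
      have "(\<Sum>e\<in>S. c e * e x) = (\<Sum>e\<in>insert e0 S. (c(e0 := 0)) e * e x)" for x
        using \<open>e0 \<notin> S\<close> S(1) by (auto intro!: sum.cong)
      then show ?thesis using c by auto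
    qed
    ultimately show ?thesis
      using S(1,2) e0 by (intro exI[of _ "insert e0 S"]) auto
  qed
qed

text \<open>The candidate weights. Weight 0 is always included, whether or not
  \<open>\<mu>\<^sup>2\<close> is an eigenvalue of the torus; its generating set may be
  empty.\<close>

definition mode_indices :: "real \<Rightarrow> int set" where
  "mode_indices \<mu> = insert 0 {k. k \<noteq> 0 \<and> (\<exists>j::nat. 2 * pi * \<bar>of_int k\<bar> * (2 * real j + 1) = \<mu>\<^sup>2)}"

lemma two_pi_ge_1: "2 * pi \<ge> 1"
  using pi_ge_two by simp

lemma mode_index_bound:
  assumes "2 * pi * \<bar>of_int k\<bar> * (2 * real j + 1) = \<mu>\<^sup>2" "k \<noteq> 0"
  shows "\<bar>of_int k\<bar> \<le> \<mu>\<^sup>2" "real j \<le> \<mu>\<^sup>2" "1 \<le> \<mu>\<^sup>2"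
proof -
  have k1: "1 \<le> \<bar>real_of_int k\<bar>" using assms(2) by linarith
  have j1: "1 \<le> 2 * real j + 1" by simp
  have "1 * \<bar>real_of_int k\<bar> * 1 \<le> 2 * pi * \<bar>of_int k\<bar> * (2 * real j + 1)"
    using two_pi_ge_1 j1 by (intro mult_mono) auto
  then show "\<bar>of_int k\<bar> \<le> \<mu>\<^sup>2" using assms(1) by simp
  then show "1 \<le> \<mu>\<^sup>2" using k1 by linarith
  have "1 * 1 * (2 * real j + 1) \<le> 2 * pi * \<bar>of_int k\<bar> * (2 * real j + 1)"
    using two_pi_ge_1 k1 by (intro mult_mono) auto
  then show "real j \<le> \<mu>\<^sup>2" using assms(1) by simp
qed

lemma finite_mode_indices: "finite (mode_indices \<mu>)"
proof -
  have "mode_indices \<mu> \<subseteq> {- \<lceil>\<mu>\<^sup>2\<rceil>..\<lceil>\<mu>\<^sup>2\<rceil>}"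
  proof
    fix k assume "k \<in> mode_indices \<mu>"
    then have "\<bar>real_of_int k\<bar> \<le> \<mu>\<^sup>2"
      using mode_index_bound(1) by (auto simp: mode_indices_def)
    then show "k \<in> {- \<lceil>\<mu>\<^sup>2\<rceil>..\<lceil>\<mu>\<^sup>2\<rceil>}" by (auto simp: abs_le_iff) linarith+
  qed
  then show ?thesis by (rule finite_subset) simp
qed

definition mode_generators :: "real \<Rightarrow> int \<Rightarrow> (heis \<Rightarrow> complex) set" where
  "mode_generators \<mu> k =
     (if k = 0 then {fourier_char l n 0 | l n. 4 * pi\<^sup>2 * ((of_int l)\<^sup>2 + (of_int n)\<^sup>2) = \<mu>\<^sup>2}
      else {theta k i (hermite (2 * pi * \<bar>of_int k\<bar>) j) | i j.
              0 \<le> i \<and> i < \<bar>k\<bar> \<and> 2 * pi * \<bar>of_int k\<bar> * (2 * real j + 1) = \<mu>\<^sup>2})"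

lemma finite_mode_generators: "finite (mode_generators \<mu> k)"
proof (cases "k = 0")
  case True
  have bound: "\<bar>l\<bar> \<le> \<lceil>\<mu>\<^sup>2\<rceil>" if "4 * pi\<^sup>2 * ((of_int l)\<^sup>2 + (of_int n)\<^sup>2) = \<mu>\<^sup>2" for l n :: int
  proof -
    have p: "1 \<le> 4 * pi\<^sup>2" using power_mono[OF two_pi_ge_1, of 2] by (simp add: power_mult_distrib)
    have "\<bar>real_of_int l\<bar> \<le> \<bar>real_of_int l\<bar>\<^sup>2"
    proof (cases "l = 0")
      case False
      then have "1 \<le> \<bar>real_of_int l\<bar>" by linarith
      then show ?thesis by (intro self_le_power) auto
    qed simp
    then have "\<bar>real_of_int l\<bar> \<le> (of_int l)\<^sup>2" by (simp only: power2_abs)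
    also have "\<dots> \<le> 1 * ((of_int l)\<^sup>2 + (of_int n)\<^sup>2)" by simp
    also have "\<dots> \<le> 4 * pi\<^sup>2 * ((of_int l)\<^sup>2 + (of_int n)\<^sup>2)" using p by (intro mult_right_mono) auto
    finally show ?thesis using that by linarith
  qed
  have "mode_generators \<mu> k \<subseteq> (\<lambda>(l, n). fourier_char l n 0) ` ({- \<lceil>\<mu>\<^sup>2\<rceil>..\<lceil>\<mu>\<^sup>2\<rceil>} \<times> {- \<lceil>\<mu>\<^sup>2\<rceil>..\<lceil>\<mu>\<^sup>2\<rceil>})"
  proof
    fix f assume "f \<in> mode_generators \<mu> k"
    then obtain l n where ln: "f = fourier_char l n 0" "4 * pi\<^sup>2 * ((of_int l)\<^sup>2 + (of_int n)\<^sup>2) = \<mu>\<^sup>2"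
      using True by (auto simp: mode_generators_def)
    have "\<bar>l\<bar> \<le> \<lceil>\<mu>\<^sup>2\<rceil>" "\<bar>n\<bar> \<le> \<lceil>\<mu>\<^sup>2\<rceil>" using bound[of l n] bound[of n l] ln(2) by (simp_all add: add.commute)
    then show "f \<in> (\<lambda>(l, n). fourier_char l n 0) ` ({- \<lceil>\<mu>\<^sup>2\<rceil>..\<lceil>\<mu>\<^sup>2\<rceil>} \<times> {- \<lceil>\<mu>\<^sup>2\<rceil>..\<lceil>\<mu>\<^sup>2\<rceil>})"
      using ln(1) by (intro image_eqI[of _ _ "(l, n)"]) auto
  qed
  then show ?thesis by (rule finite_subset) simp
next
  case False
  have "mode_generators \<mu> k \<subseteq> (\<lambda>(i, j). theta k i (hermite (2 * pi * \<bar>of_int k\<bar>) j)) ` ({0..\<bar>k\<bar>} \<times> {..nat \<lceil>\<mu>\<^sup>2\<rceil>})"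
  proof
    fix f assume "f \<in> mode_generators \<mu> k"
    then obtain i j where ij: "f = theta k i (hermite (2 * pi * \<bar>of_int k\<bar>) j)" "0 \<le> i" "i < \<bar>k\<bar>"
      "2 * pi * \<bar>of_int k\<bar> * (2 * real j + 1) = \<mu>\<^sup>2"
      using False by (auto simp: mode_generators_def)
    have "j \<le> nat \<lceil>\<mu>\<^sup>2\<rceil>" using mode_index_bound(2)[OF ij(4) False] by linarith
    then show "f \<in> (\<lambda>(i, j). theta k i (hermite (2 * pi * \<bar>of_int k\<bar>) j)) ` ({0..\<bar>k\<bar>} \<times> {..nat \<lceil>\<mu>\<^sup>2\<rceil>})"
      using ij by (intro image_eqI[of _ _ "(i, j)"]) auto
  qed
  then show ?thesis by (rule finite_subset) simp
qed

lemma mode_generators_subset: "mode_generators \<mu> k \<subseteq> mode \<mu> k"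
proof
  fix f assume f: "f \<in> mode_generators \<mu> k"
  show "f \<in> mode \<mu> k"
  proof (cases "k = 0")
    case True
    then obtain l n where ln: "f = fourier_char l n 0" "4 * pi\<^sup>2 * ((of_int l)\<^sup>2 + (of_int n)\<^sup>2) = \<mu>\<^sup>2"
      using f by (auto simp: mode_generators_def)
    then show ?thesis
      using True sublaplacian_torus_char[of l n]
      by (simp add: mode_def torus_char_smooth central_weight_def) (simp add: fourier_char_def)
  next
    case False
    then obtain i j where ij: "f = theta k i (hermite (2 * pi * \<bar>of_int k\<bar>) j)"
      "2 * pi * \<bar>of_int k\<bar> * (2 * real j + 1) = \<mu>\<^sup>2"
      using f by (auto simp: mode_generators_def)
    then show ?thesis
      using False sublaplacian_theta[OF False, of i j]
        theta_smooth[OF False] theta_central_weight[OF False]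
      by (simp add: mode_def)
  qed
qed

text \<open>The residual of an eigenfunction after projection is orthogonal to every explicit
  eigenfunction, whatever its eigenvalue, so completeness makes it vanish almost everywhere. This
  also settles finite dimension and regularity.\<close>

lemma eigenspace_basis:
  obtains S where "\<And>k. finite (S k)" "\<And>k. S k \<subseteq> mode \<mu> k" "\<And>k. nil_orthonormal (S k)"
    "eigenspace_onb \<mu> (\<Union>k\<in>mode_indices \<mu>. S k)"
proof -
  have "\<forall>k. \<exists>S. finite S \<and> S \<subseteq> mode \<mu> k \<and> nil_orthonormal S \<and>
      (\<forall>g\<in>mode_generators \<mu> k. \<exists>c. AE x in nil_measure. g x = (\<Sum>e\<in>S. c e * e x))"
    using Gram_Schmidt[OF finite_mode_generators mode_generators_subset] by blast
  from choice[OF this] obtain S where S': "\<forall>k. finite (S k) \<and> S k \<subseteq> mode \<mu> k \<and> nil_orthonormal (S k) \<and>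
      (\<forall>g\<in>mode_generators \<mu> k. \<exists>c. AE x in nil_measure. g x = (\<Sum>e\<in>S k. c e * e x))" ..
  then have S: "\<And>k. finite (S k)" "\<And>k. S k \<subseteq> mode \<mu> k" "\<And>k. nil_orthonormal (S k)"
    "\<And>k g. g \<in> mode_generators \<mu> k \<Longrightarrow> \<exists>c. AE x in nil_measure. g x = (\<Sum>e\<in>S k. c e * e x)"
    by simp_all
  define U where "U = (\<Union>k\<in>mode_indices \<mu>. S k)"
  have finU: "finite U" unfolding U_def using finite_mode_indices S(1) by blast
  have UE: "U \<subseteq> eigenspace \<mu> \<inter> nil_smooth"
    using S(2) mode_eigenspace mode_smooth unfolding U_def by blast
  have UL: "U \<subseteq> nil_Lp 2" using UE eigenspace_L2 by blast
  have orthU: "nil_orthonormal U"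
    unfolding nil_orthonormal_def
  proof (intro ballI)
    fix e e' assume "e \<in> U" "e' \<in> U"
    then obtain k k' where k: "e \<in> S k" "e' \<in> S k'" by (auto simp: U_def)
    have self: "nil_inner e e = 1" using S(3)[of k] k by (auto simp: nil_orthonormal_def)
    show "nil_inner e e' = (if e = e' then 1 else 0)"
    proof (cases "k = k'")
      case True
      then show ?thesis using S(3)[of k] k by (auto simp: nil_orthonormal_def)
    next
      case False
      then have "nil_inner e e' = 0" using mode_orthogonal S(2) k by blast
      then show ?thesis using self by auto
    qed
  qed
  have span: "AE x in nil_measure. f x = (\<Sum>e\<in>U. nil_inner f e * e x)" if f: "f \<in> eigenspace \<mu>" for f
  proof -
    have fL: "f \<in> nil_Lp 2" by (rule eigenspace_L2[OF f])
    define r where "r x = f x - (\<Sum>e\<in>U. nil_inner f e * e x)" for x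
    have sL: "(\<lambda>x. \<Sum>e\<in>U. nil_inner f e * e x) \<in> nil_Lp 2"
      using UL by (intro nil_L2_sum nil_L2_cmult) auto
    have rL: "r \<in> nil_Lp 2" unfolding r_def by (rule nil_L2_diff[OF fL sL])
    have rU: "nil_inner r e = 0" if "e \<in> U" for e
      using UL that unfolding r_def
      by (simp add: nil_inner_diff_left fL sL subset_iff orthonormal_coeff[OF finU UL orthU that])
    \<comment> \<open>Generators with the right eigenvalue lie in the span of the basis vectors, to
      which \<open>r\<close> is orthogonal.\<close>
    have r_same: "nil_inner r g = 0" if g: "g \<in> mode_generators \<mu> k" "k \<in> mode_indices \<mu>" for g k
    proof -
      obtain c where c: "AE x in nil_measure. g x = (\<Sum>e\<in>S k. c e * e x)" using S(4)[OF g(1)] by blast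
      have gL: "g \<in> nil_Lp 2" using g(1) mode_generators_subset mode_L2 by blast
      have SkL: "S k \<subseteq> nil_Lp 2" using S(2) mode_L2 by blast
      have "(\<lambda>x. \<Sum>e\<in>S k. c e * e x) \<in> nil_Lp 2"
        using SkL by (intro nil_L2_sum nil_L2_cmult) auto
      then have "nil_inner g r = nil_inner (\<lambda>x. \<Sum>e\<in>S k. c e * e x) r"
        using nil_LpD(2) gL rL by (intro nil_inner_cong_AE[OF c]) auto
      also have "\<dots> = (\<Sum>e\<in>S k. c e * nil_inner e r)"
        using SkL rL by (subst nil_inner_sum_left) (auto intro: nil_L2_cmult simp: nil_inner_cmult_left)
      also have "\<dots> = 0"
      proof (rule sum.neutral, rule ballI)
        fix e assume "e \<in> S k"
        then have "e \<in> U" using g(2) by (auto simp: U_def)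
        then show "c e * nil_inner e r = 0" using rU nil_inner_cnj[of e r] by simp
      qed
      finally show ?thesis using nil_inner_cnj[of r g] by simp
    qed
    \<comment> \<open>For a different eigenvalue, both \<open>f\<close> and each basis vector are
      already orthogonal to \<open>g\<close>.\<close>
    have r_diff: "nil_inner r g = 0"
      if g: "g \<in> nil_smooth" "sublaplacian g = (\<lambda>x. of_real \<nu> * g x)" "\<nu> \<noteq> \<mu>\<^sup>2" for g \<nu>
    proof -
      have gL: "g \<in> nil_Lp 2" using g(1) by (simp add: nil_smooth_Lp)
      have "nil_inner r g = nil_inner f g - nil_inner (\<lambda>x. \<Sum>e\<in>U. nil_inner f e * e x) g"
        unfolding r_def by (rule nil_inner_diff_left[OF fL sL gL])
      also have "nil_inner (\<lambda>x. \<Sum>e\<in>U. nil_inner f e * e x) g = (\<Sum>e\<in>U. nil_inner f e * nil_inner e g)"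
        using UL gL by (subst nil_inner_sum_left) (auto intro: nil_L2_cmult simp: nil_inner_cmult_left)
      also have "\<dots> = 0"
        using UE eigenspace_orthogonal[OF _ g] by (intro sum.neutral) auto
      finally show ?thesis using eigenspace_orthogonal[OF f g] by simp
    qed
    have "AE x in nil_measure. r x = 0"
    proof (rule nil_completeness[OF rL])
      show "nil_inner r (fourier_char l n 0) = 0" for l n
      proof (cases "4 * pi\<^sup>2 * ((of_int l)\<^sup>2 + (of_int n)\<^sup>2) = \<mu>\<^sup>2")
        case True
        then show ?thesis by (intro r_same[of _ 0]) (auto simp: mode_generators_def mode_indices_def)
      qed (rule r_diff[OF torus_char_smooth sublaplacian_torus_char])
      show "nil_inner r (theta k i (hermite (2 * pi * \<bar>of_int k\<bar>) j)) = 0" if k: "k \<noteq> 0" "0 \<le> i" "i < \<bar>k\<bar>" for k i j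
      proof (cases "2 * pi * \<bar>of_int k\<bar> * (2 * real j + 1) = \<mu>\<^sup>2")
        case True
        then show ?thesis using k by (intro r_same[of _ k]) (auto simp: mode_generators_def mode_indices_def)
      qed (rule r_diff[OF theta_smooth[OF k(1)] sublaplacian_theta[OF k(1)]])
    qed
    then show ?thesis by eventually_elim (simp add: r_def)
  qed
  have "eigenspace_onb \<mu> U"
    unfolding eigenspace_onb_def
  proof (intro conjI finU UE)
    show "\<forall>e\<in>U. \<forall>e'\<in>U. nil_inner e e' = (if e = e' then 1 else 0)"
      using orthU by (simp add: nil_orthonormal_def)
    show "\<forall>f\<in>eigenspace \<mu>. \<exists>c. AE x in nil_measure. f x = (\<Sum>e\<in>U. c e * e x)"
    proof
      fix f assume "f \<in> eigenspace \<mu>"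
      from span[OF this] show "\<exists>c. AE x in nil_measure. f x = (\<Sum>e\<in>U. c e * e x)"
        by (rule exI[of _ "nil_inner f"])
    qed
  qed
  then show thesis using that[of S] S by (auto simp: U_def)
qed

section \<open>Counting the central frequencies\<close>

lemma card_divisors_prime_power_mult:
  fixes p m e :: nat
  assumes "prime p" "m > 0"
  shows "card {d. d dvd p ^ e * m} \<le> (e + 1) * card {d. d dvd m}"
proof -
  have fin: "finite {d. d dvd m}" using assms(2) by simp
  have "{d. d dvd p ^ e * m} \<subseteq> (\<lambda>(i, d). p ^ i * d) ` ({..e} \<times> {d. d dvd m})"
  proof
    fix d assume "d \<in> {d. d dvd p ^ e * m}"
    then obtain x y where xy: "d = x * y" "x dvd p ^ e" "y dvd m"
      using division_decomp[of d "p ^ e" m] by auto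
    then obtain i where "i \<le> e" "x = p ^ i" using divides_primepow_nat[OF assms(1)] by auto
    then show "d \<in> (\<lambda>(i, d). p ^ i * d) ` ({..e} \<times> {d. d dvd m})"
      using xy by (intro image_eqI[of _ _ "(i, y)"]) auto
  qed
  then have "card {d. d dvd p ^ e * m} \<le> card ((\<lambda>(i, d). p ^ i * d) ` ({..e} \<times> {d. d dvd m}))"
    using fin by (intro card_mono) auto
  also have "\<dots> \<le> card ({..e} \<times> {d. d dvd m})" using fin by (intro card_image_le) auto
  finally show ?thesis by (simp add: card_cartesian_product)
qed

text \<open>The divisor count compared with n^\<epsilon> is a product over primes of (e + 1) / p^(e
  \<epsilon>). Large primes contribute factors at most 1, and each of the boundedly many small
  primes contributes at most \<open>K\<close>.\<close>

lemma divisor_bound: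
  assumes \<epsilon>: "\<epsilon> > 0"
  shows "\<exists>C>0. \<forall>n::nat. n > 0 \<longrightarrow> real (card {d. d dvd n}) \<le> C * real n powr \<epsilon>"
proof -
  \<comment> \<open>From this threshold on p^\<epsilon> is at least 2, hence p^(e \<epsilon>) \<ge>
    2^e \<ge> e + 1.\<close>
  define P where "P = nat \<lceil>2 powr (1 / \<epsilon>)\<rceil>"
  \<comment> \<open>Chosen so that \<delta> (e + 1) \<le> 1 + \<epsilon> e ln 2, which is below 2^(e
    \<epsilon>) by convexity of the exponential.\<close>
  define \<delta> where "\<delta> = min 1 (\<epsilon> * ln 2)"
  define K where "K = 1 / \<delta>"
  have \<delta>: "\<delta> > 0" "\<delta> \<le> 1" using \<epsilon> by (auto simp: \<delta>_def)
  have K: "K \<ge> 1" using \<delta> by (simp add: K_def)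
  have small: "real (e + 1) \<le> K * real (p ^ e) powr \<epsilon>" if "prime p" for p e :: nat
  proof -
    have "p \<ge> 2" using that by (rule prime_ge_2_nat)
    then have "2 ^ e \<le> real (p ^ e)" by (simp add: power_mono)
    then have "(2 ^ e) powr \<epsilon> \<le> real (p ^ e) powr \<epsilon>" using \<epsilon> by (intro powr_mono2) auto
    moreover have "(2 ^ e) powr \<epsilon> = exp (\<epsilon> * (real e * ln 2))"
      by (simp add: powr_def ln_realpow)
    moreover have "1 + \<epsilon> * (real e * ln 2) \<le> exp (\<epsilon> * (real e * ln 2))" by (rule exp_ge_add_one_self)
    moreover have "\<delta> * real (e + 1) \<le> 1 + \<epsilon> * (real e * ln 2)"
    proof -
      have "\<delta> * real e \<le> (\<epsilon> * ln 2) * real e" by (intro mult_right_mono) (auto simp: \<delta>_def)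
      then show ?thesis using \<delta> by (simp add: algebra_simps)
    qed
    ultimately have "\<delta> * real (e + 1) \<le> real (p ^ e) powr \<epsilon>" by linarith
    then show ?thesis using \<delta> by (simp add: K_def field_simps)
  qed
  have large: "real (e + 1) \<le> real (p ^ e) powr \<epsilon>" if "P \<le> p" for p e :: nat
  proof -
    have "2 powr (1 / \<epsilon>) \<le> real p" using that by (simp add: P_def)
    then have "(2 powr (1 / \<epsilon>)) powr \<epsilon> \<le> real p powr \<epsilon>" using \<epsilon> by (intro powr_mono2) auto
    then have "2 \<le> real p powr \<epsilon>" using \<epsilon> by (simp add: powr_powr)
    then have "2 ^ e \<le> (real p powr \<epsilon>) ^ e" by (intro power_mono) auto
    also have "\<dots> = real (p ^ e) powr \<epsilon>"
      by (induction e) (simp_all add: powr_mult)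
    finally have "2 ^ e \<le> real (p ^ e) powr \<epsilon>" .
    moreover have "real (e + 1) \<le> 2 ^ e"
      by (induction e) auto
    ultimately show ?thesis by linarith
  qed
  \<comment> \<open>\<open>S\<close> holds the small primes that may still divide n. Splitting off a
    full prime power deletes its prime from \<open>S\<close>, so each costs the factor
    \<open>K\<close> only once.\<close>
  have main: "real (card {d. d dvd n}) \<le> K ^ card S * real n powr \<epsilon>"
    if "n > 0" "finite S" "\<And>p. prime p \<Longrightarrow> p dvd n \<Longrightarrow> p < P \<Longrightarrow> p \<in> S" for n :: nat and S :: "nat set"
    using that
  proof (induction n arbitrary: S rule: less_induct)
    case (less n)
    show ?case
    proof (cases "n = 1")
      case True
      then show ?thesis using K by simp
    next
      case False
      then obtain p where p: "prime p" "p dvd n" using prime_factor_nat by blast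
      obtain e m where "\<not> p dvd m" "n = m * p ^ e"
        using prime_power_canonical[OF p(1) less.prems(1)] by blast
      then have em: "n = p ^ e * m" "\<not> p dvd m" by (simp_all add: mult.commute)
      have m: "m > 0" using em less.prems(1) by (cases "m = 0") auto
      have e: "e > 0" using em p by (cases "e = 0") auto
      have "1 < p ^ e" using e prime_gt_1_nat[OF p(1)] by (rule one_less_power[rotated])
      then have lt: "m < n" using m em by simp
      have step: "real (card {d. d dvd n}) \<le> real (e + 1) * real (card {d. d dvd m})"
        using card_divisors_prime_power_mult[OF p(1) m, of e] em(1) by (metis of_nat_le_iff of_nat_mult)
      have npow: "real n powr \<epsilon> = real (p ^ e) powr \<epsilon> * real m powr \<epsilon>"
        using em by (simp add: powr_mult)
      show ?thesis
      proof (cases "p < P")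
        case True
        then have pS: "p \<in> S" using less.prems(3) p by blast
        have "real (card {d. d dvd m}) \<le> K ^ card (S - {p}) * real m powr \<epsilon>"
        proof (rule less.IH[OF lt m])
          fix q assume "prime q" "q dvd m" "q < P"
          then show "q \<in> S - {p}" using less.prems(3)[of q] em by (auto simp: dvd_mult)
        qed (use less.prems in simp)
        then have "real (e + 1) * real (card {d. d dvd m}) \<le> (K * real (p ^ e) powr \<epsilon>) * (K ^ card (S - {p}) * real m powr \<epsilon>)"
          using small[OF p(1), of e] K by (intro mult_mono) auto
        also have "\<dots> = K ^ Suc (card (S - {p})) * real n powr \<epsilon>" by (simp add: npow mult_ac)
        also have "Suc (card (S - {p})) = card S" by (rule card.remove[symmetric, OF less.prems(2) pS])
        finally show ?thesis using step by linarith
      next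
        case False
        have "real (card {d. d dvd m}) \<le> K ^ card S * real m powr \<epsilon>"
        proof (rule less.IH[OF lt m less.prems(2)])
          fix q assume "prime q" "q dvd m" "q < P"
          then show "q \<in> S" using less.prems(3)[of q] em by (auto simp: dvd_mult)
        qed
        then have "real (e + 1) * real (card {d. d dvd m}) \<le> real (p ^ e) powr \<epsilon> * (K ^ card S * real m powr \<epsilon>)"
          using large[of p e] False K by (intro mult_mono) auto
        then show ?thesis using step by (simp add: npow mult_ac)
      qed
    qed
  qed
  have "real (card {d. d dvd n}) \<le> K ^ card {..<P} * real n powr \<epsilon>" if "n > 0" for n :: nat
    by (rule main[OF that]) auto
  then show ?thesis using K by (intro exI[of _ "K ^ card {..<P}"]) auto
qed

text \<open>All nonzero weights lead to the same integer N with 2 pi N =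
  \<open>\<mu>\<^sup>2\<close>. Weight zero and the two signs give the constant 1 + 2 C, and N \<le>
  \<open>\<mu>\<^sup>2\<close> explains the divisor bound with exponent \<epsilon>/2.\<close>

lemma card_mode_indices:
  assumes \<epsilon>: "\<epsilon> > 0"
  shows "\<exists>C>0. \<forall>\<mu>\<ge>1. real (card (mode_indices \<mu>)) \<le> C * \<mu> powr \<epsilon>"
proof -
  obtain C where C: "C > 0" "\<And>n::nat. n > 0 \<Longrightarrow> real (card {d. d dvd n}) \<le> C * real n powr (\<epsilon> / 2)"
    using divisor_bound[of "\<epsilon> / 2"] \<epsilon> by auto
  have "real (card (mode_indices \<mu>)) \<le> (1 + 2 * C) * \<mu> powr \<epsilon>" if \<mu>: "\<mu> \<ge> 1" for \<mu>
  proof (cases "mode_indices \<mu> = {0}")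
    case True
    have "1 \<le> \<mu> powr \<epsilon>" using \<mu> \<epsilon> by (simp add: ge_one_powr_ge_zero)
    then show ?thesis using True C(1) mult_mono[of 1 "1 + 2 * C" 1 "\<mu> powr \<epsilon>"] by simp
  next
    case False
    then obtain k0 j0 where kj: "k0 \<noteq> 0" "2 * pi * \<bar>of_int k0\<bar> * (2 * real j0 + 1) = \<mu>\<^sup>2"
      by (auto simp: mode_indices_def)
    define N where "N = nat \<bar>k0\<bar> * (2 * j0 + 1)"
    have N_eq: "real N = \<bar>of_int k0\<bar> * (2 * real j0 + 1)" by (simp add: N_def algebra_simps)
    have N: "2 * pi * real N = \<mu>\<^sup>2" unfolding N_eq using kj(2) by (simp only: mult.assoc)
    have N0: "N > 0" using kj(1) by (simp add: N_def)
    have "1 * real N \<le> 2 * pi * real N" using two_pi_ge_1 by (intro mult_right_mono) auto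
    then have N_le: "real N \<le> \<mu>\<^sup>2" using N by simp
    let ?D = "{d. d dvd N}"
    have finD: "finite ?D" using N0 by simp
    have "mode_indices \<mu> \<subseteq> insert 0 (int ` ?D \<union> (\<lambda>d. - int d) ` ?D)"
    proof
      fix k assume k: "k \<in> mode_indices \<mu>"
      show "k \<in> insert 0 (int ` ?D \<union> (\<lambda>d. - int d) ` ?D)"
      proof (cases "k = 0")
        case False
        then obtain j where "2 * pi * \<bar>of_int k\<bar> * (2 * real j + 1) = \<mu>\<^sup>2"
          using k by (auto simp: mode_indices_def)
        moreover have "real (nat \<bar>k\<bar> * (2 * j + 1)) = \<bar>of_int k\<bar> * (2 * real j + 1)" by (simp add: algebra_simps)
        ultimately have "2 * pi * real (nat \<bar>k\<bar> * (2 * j + 1)) = 2 * pi * real N" using N by (simp only: mult.assoc)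
        then have "real (nat \<bar>k\<bar> * (2 * j + 1)) = real N" by simp
        then have "nat \<bar>k\<bar> * (2 * j + 1) = N" by (simp only: of_nat_eq_iff)
        then have "nat \<bar>k\<bar> dvd N" by (metis dvd_triv_left)
        moreover have "k = int (nat \<bar>k\<bar>) \<or> k = - int (nat \<bar>k\<bar>)" by auto
        ultimately show ?thesis by blast
      qed simp
    qed
    then have "card (mode_indices \<mu>) \<le> card (insert 0 (int ` ?D \<union> (\<lambda>d. - int d) ` ?D))"
      using finD by (intro card_mono) auto
    also have "\<dots> \<le> 1 + (card ?D + card ?D)"
      using finD card_Un_le[of "int ` ?D" "(\<lambda>d. - int d) ` ?D"] card_image_le[OF finD, of int]
        card_image_le[OF finD, of "\<lambda>d. - int d"]
        card_insert_le_m1[of "Suc (card ?D + card ?D)" "int ` ?D \<union> (\<lambda>d. - int d) ` ?D" 0] by simp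
    finally have "real (card (mode_indices \<mu>)) \<le> 1 + 2 * real (card ?D)" by linarith
    also have "real (card ?D) \<le> C * real N powr (\<epsilon> / 2)" by (rule C(2)[OF N0])
    also have "real N powr (\<epsilon> / 2) \<le> (\<mu>\<^sup>2) powr (\<epsilon> / 2)" using N_le \<epsilon> by (intro powr_mono2) auto
    also have "(\<mu>\<^sup>2) powr (\<epsilon> / 2) = \<mu> powr \<epsilon>"
      using \<mu> by (simp add: powr_powr flip: powr_numeral)
    finally have "real (card (mode_indices \<mu>)) \<le> 1 + 2 * (C * \<mu> powr \<epsilon>)" using C(1) by simp
    moreover have "1 \<le> \<mu> powr \<epsilon>" using \<mu> \<epsilon> by (simp add: ge_one_powr_ge_zero)
    ultimately show ?thesis by (simp add: algebra_simps)
  qed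
  then show ?thesis using C(1) by (intro exI[of _ "1 + 2 * C"]) auto
qed

text \<open>The Cauchy-Schwarz inequality twice, once for the moduli and once for their
  squares.\<close>

lemma cmod_sum_power4_le:
  assumes "finite K"
  shows "cmod (\<Sum>k\<in>K. z k) ^ 4 \<le> real (card K) ^ 3 * (\<Sum>k\<in>K. cmod (z k) ^ 4)"
proof -
  let ?n = "real (card K)"
  have "cmod (\<Sum>k\<in>K. z k) ^ 4 \<le> (\<Sum>k\<in>K. cmod (z k)) ^ 4"
    by (intro power_mono norm_sum) auto
  also have "\<dots> = ((\<Sum>k\<in>K. cmod (z k))\<^sup>2)\<^sup>2" by (simp flip: power_mult)
  also have "\<dots> \<le> ((\<Sum>k\<in>K. (cmod (z k))\<^sup>2) * ?n)\<^sup>2"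
    by (intro power_mono sum_squared_le_sum_of_squares) auto
  also have "\<dots> = (\<Sum>k\<in>K. (cmod (z k))\<^sup>2)\<^sup>2 * ?n\<^sup>2" by (simp add: power_mult_distrib)
  also have "\<dots> \<le> ((\<Sum>k\<in>K. ((cmod (z k))\<^sup>2)\<^sup>2) * ?n) * ?n\<^sup>2"
    by (intro mult_right_mono sum_squared_le_sum_of_squares) auto
  also have "\<dots> = ?n ^ 3 * (\<Sum>k\<in>K. cmod (z k) ^ 4)"
    by (simp add: power2_eq_square power3_eq_cube power4_eq_xxxx mult_ac)
  finally show ?thesis .
qed

lemma nil_smooth_integrable_power4: "f \<in> nil_smooth \<Longrightarrow> integrable nil_measure (\<lambda>x. cmod (f x) ^ 4)"
  by (intro integrable_nil_continuous continuous_intros nil_smooth_continuous)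

text \<open>The components \<open>F k\<close> of different weights are orthogonal, so their squared
  norms add up to that of f and their fourth powers sum to at most the fourth power of its norm.
  Only the pointwise fourth-power inequality loses the cube of the number of weights.\<close>

lemma eigenspace_L4_bound:
  assumes f: "f \<in> eigenspace \<mu>" "f \<in> nil_smooth" and \<mu>: "\<mu> \<ge> 0"
  shows "(LINT x|nil_measure. cmod (f x) ^ 4) \<le>
    real (card (mode_indices \<mu>)) ^ 3 * ((1 + 2 * \<mu>)\<^sup>2 * nil_rnorm 2 f ^ 4)"
proof -
  obtain S where S: "\<And>k. finite (S k)" "\<And>k. S k \<subseteq> mode \<mu> k" "\<And>k. nil_orthonormal (S k)"
    and onb: "eigenspace_onb \<mu> (\<Union>k\<in>mode_indices \<mu>. S k)" using eigenspace_basis by blast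
  let ?K = "mode_indices \<mu>"
  define U where "U = (\<Union>k\<in>?K. S k)"
  have U: "finite U" "U \<subseteq> nil_smooth" "nil_orthonormal U"
    using onb unfolding U_def[symmetric] by (auto simp: eigenspace_onb_def nil_orthonormal_def)
  have UL: "U \<subseteq> nil_Lp 2" using U(2) nil_smooth_Lp by auto
  obtain c where c: "AE x in nil_measure. f x = (\<Sum>e\<in>U. c e * e x)"
    using onb f(1) unfolding U_def[symmetric] eigenspace_onb_def by blast
  define F where "F k x = (\<Sum>e\<in>S k. c e * e x)" for k x
  have Fm: "F k \<in> mode \<mu> k" for k unfolding F_def using S(2) by (intro mode_sum mode_cmult) auto
  have disj: "S k \<inter> S k' = {}" if "k \<noteq> k'" for k k'
  proof -
    have False if "e \<in> S k" "e \<in> S k'" for e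
    proof -
      have "nil_inner e e = 0" using mode_orthogonal \<open>k \<noteq> k'\<close> S(2) that by blast
      moreover have "nil_inner e e = 1" using S(3)[of k] that by (auto simp: nil_orthonormal_def)
      ultimately show False by simp
    qed
    then show ?thesis by blast
  qed
  have sumU: "(\<Sum>e\<in>U. g e) = (\<Sum>k\<in>?K. \<Sum>e\<in>S k. g e)" for g :: "_ \<Rightarrow> 'x::comm_monoid_add"
    unfolding U_def using finite_mode_indices S(1) disj by (intro sum.UNION_disjoint) auto
  have meas: "(\<lambda>x. \<Sum>e\<in>U. c e * e x) \<in> nil_Lp 2" using UL by (intro nil_L2_sum nil_L2_cmult) auto
  have "nil_rnorm 2 f = nil_rnorm 2 (\<lambda>x. \<Sum>e\<in>U. c e * e x)"
    by (rule nil_rnorm_cong_AE[OF c nil_smooth_borel[OF f(2)] nil_LpD(2)[OF meas]])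
  then have "(nil_rnorm 2 f)\<^sup>2 = (\<Sum>e\<in>U. (cmod (c e))\<^sup>2)"
    by (simp add: orthonormal_norm[OF U(1) UL U(3)])
  also have "\<dots> = (\<Sum>k\<in>?K. (nil_rnorm 2 (F k))\<^sup>2)"
    unfolding sumU F_def using S mode_L2
    by (intro sum.cong refl orthonormal_norm[symmetric]) blast+
  finally have norm: "(\<Sum>k\<in>?K. (nil_rnorm 2 (F k))\<^sup>2) = (nil_rnorm 2 f)\<^sup>2" by simp
  have le: "(nil_rnorm 2 (F k))\<^sup>2 \<le> (nil_rnorm 2 f)\<^sup>2" if "k \<in> ?K" for k
    unfolding norm[symmetric] using finite_mode_indices that by (intro member_le_sum) auto
  have "(\<Sum>k\<in>?K. nil_rnorm 2 (F k) ^ 4) = (\<Sum>k\<in>?K. (nil_rnorm 2 (F k))\<^sup>2 * (nil_rnorm 2 (F k))\<^sup>2)"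
    by (simp flip: power_add)
  also have "\<dots> \<le> (\<Sum>k\<in>?K. (nil_rnorm 2 f)\<^sup>2 * (nil_rnorm 2 (F k))\<^sup>2)"
    by (intro sum_mono mult_right_mono le) auto
  also have "\<dots> = nil_rnorm 2 f ^ 4"
    by (simp add: sum_distrib_left[symmetric] norm flip: power_add)
  finally have sum4: "(\<Sum>k\<in>?K. nil_rnorm 2 (F k) ^ 4) \<le> nil_rnorm 2 f ^ 4" .
  have "(LINT x|nil_measure. cmod (f x) ^ 4) \<le> (LINT x|nil_measure. real (card ?K) ^ 3 * (\<Sum>k\<in>?K. cmod (F k x) ^ 4))"
  proof (rule integral_mono_AE)
    show "integrable nil_measure (\<lambda>x. cmod (f x) ^ 4)" by (rule nil_smooth_integrable_power4[OF f(2)])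
    show "integrable nil_measure (\<lambda>x. real (card ?K) ^ 3 * (\<Sum>k\<in>?K. cmod (F k x) ^ 4))"
      using nil_smooth_integrable_power4[OF mode_smooth[OF Fm]] by auto
    show "AE x in nil_measure. cmod (f x) ^ 4 \<le> real (card ?K) ^ 3 * (\<Sum>k\<in>?K. cmod (F k x) ^ 4)"
      using c
    proof eventually_elim
      case (elim x)
      have "f x = (\<Sum>k\<in>?K. F k x)" unfolding elim sumU F_def ..
      then show ?case using cmod_sum_power4_le[OF finite_mode_indices, of "\<lambda>k. F k x" \<mu>] by simp
    qed
  qed
  also have "\<dots> = real (card ?K) ^ 3 * (\<Sum>k\<in>?K. LINT x|nil_measure. cmod (F k x) ^ 4)"
    using nil_smooth_integrable_power4[OF mode_smooth[OF Fm]]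
    by (simp add: Bochner_Integration.integral_sum)
  also have "\<dots> \<le> real (card ?K) ^ 3 * (\<Sum>k\<in>?K. (1 + 2 * \<mu>)\<^sup>2 * nil_rnorm 2 (F k) ^ 4)"
    using Fm \<mu> by (intro mult_left_mono sum_mono eigenfunction_L4_bound) (auto simp: mode_def)
  also have "\<dots> \<le> real (card ?K) ^ 3 * ((1 + 2 * \<mu>)\<^sup>2 * nil_rnorm 2 f ^ 4)"
    unfolding sum_distrib_left[symmetric] by (intro mult_left_mono sum4) auto
  finally show ?thesis .
qed

text \<open>Every explicit eigenvalue is 0 or at least 1, so f is orthogonal to the whole complete
  system.\<close>

lemma eigenspace_trivial:
  assumes f: "f \<in> eigenspace \<mu>" and \<mu>: "0 < \<mu>" "\<mu> < 1"
  shows "AE x in nil_measure. f x = 0"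
proof (rule nil_completeness[OF eigenspace_L2[OF f]])
  have \<mu>2: "0 < \<mu>\<^sup>2" "\<mu>\<^sup>2 < 1" using \<mu> by (auto simp: power_less_one_iff)
  show "nil_inner f (fourier_char l n 0) = 0" for l n
  proof (rule eigenspace_orthogonal[OF f torus_char_smooth sublaplacian_torus_char])
    show "4 * pi\<^sup>2 * ((of_int l)\<^sup>2 + (of_int n)\<^sup>2) \<noteq> \<mu>\<^sup>2"
    proof (cases "l = 0 \<and> n = 0")
      case False
      have sq: "1 \<le> (real_of_int m)\<^sup>2" if "m \<noteq> 0" for m
      proof -
        have "1 \<le> \<bar>real_of_int m\<bar>" using that by linarith
        then show ?thesis using one_le_power[of "\<bar>real_of_int m\<bar>" 2] by simp
      qed
      have "1 \<le> (real_of_int l)\<^sup>2 + (of_int n)\<^sup>2"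
        using False sq[of l] sq[of n] zero_le_power2[of "real_of_int l"] zero_le_power2[of "real_of_int n"] by linarith
      moreover have "1 \<le> 4 * pi\<^sup>2" using power_mono[OF two_pi_ge_1, of 2] by (simp add: power_mult_distrib)
      ultimately have "1 * 1 \<le> 4 * pi\<^sup>2 * ((real_of_int l)\<^sup>2 + (of_int n)\<^sup>2)" by (intro mult_mono) auto
      then show ?thesis using \<mu>2 by linarith
    qed (use \<mu>2 in auto)
  qed
  show "nil_inner f (theta k i (hermite (2 * pi * \<bar>of_int k\<bar>) j)) = 0" if k: "k \<noteq> 0" for k i j
  proof (rule eigenspace_orthogonal[OF f theta_smooth[OF k] sublaplacian_theta[OF k]])
    show "2 * pi * \<bar>of_int k\<bar> * (2 * real j + 1) \<noteq> \<mu>\<^sup>2"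
      using mode_index_bound(3)[OF _ k, of j \<mu>] \<mu>2 by linarith
  qed
qed

section \<open>The spectral projector\<close>

lemma eigenspaceI_AE:
  assumes "g \<in> nil_smooth" "AE x in nil_measure. sublaplacian g x = of_real (\<mu>\<^sup>2) * g x"
  shows "g \<in> eigenspace \<mu>"
proof -
  have gL: "g \<in> nil_Lp 2" using assms(1) by (simp add: nil_smooth_Lp)
  have L: "(\<lambda>x. sublaplacian g x - of_real (\<mu>\<^sup>2) * g x) \<in> nil_Lp 2"
    using nil_smooth_Lp[OF sublaplacian_smooth[OF assms(1)], of 2] by (intro nil_L2_diff nil_L2_cmult gL) simp
  have zero: "nil_norm 2 (\<lambda>x. 0) = 0" by (simp add: nil_norm_eq nil_L2_zero nil_rnorm_2_eq)
  have "AE x in nil_measure. sublaplacian g x - of_real (\<mu>\<^sup>2) * g x = 0"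
    using assms(2) by eventually_elim simp
  from nil_rnorm_cong_AE[OF this nil_LpD(2)[OF L] nil_LpD(2)[OF nil_L2_zero], of 2]
  have "nil_norm 2 (\<lambda>x. sublaplacian g x - of_real (\<mu>\<^sup>2) * g x) = 0"
    using zero unfolding nil_norm_eq[OF L] nil_norm_eq[OF nil_L2_zero] by (simp only:)
  then show ?thesis
    unfolding eigenspace_def sublaplacian_closure_def mem_Collect_eq
    using zero by (intro conjI exI[of _ "\<lambda>_. g"] allI gL nil_L2_cmult assms(1)) simp_all
qed

text \<open>Test with the defect \<psi> itself: computing the limit directly and after moving the
  operator onto \<psi> shows that \<psi> has inner product zero with itself. So membership in the
  closed eigenspace gives the differential equation for smooth functions.\<close>

lemma eigenspace_smooth_AE:
  assumes g: "g \<in> eigenspace \<mu>" "g \<in> nil_smooth"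
  shows "AE x in nil_measure. sublaplacian g x = of_real (\<mu>\<^sup>2) * g x"
proof -
  from g(1) obtain \<phi> where \<phi>: "\<And>n. \<phi> n \<in> nil_smooth"
    "(\<lambda>n. nil_norm 2 (\<lambda>x. \<phi> n x - g x)) \<longlonglongrightarrow> 0"
    "(\<lambda>n. nil_norm 2 (\<lambda>x. sublaplacian (\<phi> n) x - of_real (\<mu>\<^sup>2) * g x)) \<longlonglongrightarrow> 0"
    by (auto simp: eigenspace_def sublaplacian_closure_def)
  have L: "h \<in> nil_Lp 2" if "h \<in> nil_smooth" for h using that by (simp add: nil_smooth_Lp)
  define \<psi> where "\<psi> x = sublaplacian g x + (- of_real (\<mu>\<^sup>2)) * g x" for x
  have \<psi>: "\<psi> \<in> nil_smooth"
    unfolding \<psi>_def by (intro nil_smooth_add nil_smooth_cmult sublaplacian_smooth g(2))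
  have "(\<lambda>n. nil_inner (sublaplacian (\<phi> n)) \<psi>) \<longlonglongrightarrow> nil_inner (\<lambda>x. of_real (\<mu>\<^sup>2) * g x) \<psi>"
    by (intro nil_inner_tendsto L sublaplacian_smooth \<phi> nil_L2_cmult g(2) \<psi>)
  moreover have "(\<lambda>n. nil_inner (sublaplacian (\<phi> n)) \<psi>) \<longlonglongrightarrow> nil_inner g (sublaplacian \<psi>)"
    unfolding sublaplacian_symmetric[OF \<phi>(1) \<psi>]
    by (intro nil_inner_tendsto L sublaplacian_smooth \<phi> g(2) \<psi>)
  ultimately have "nil_inner (\<lambda>x. of_real (\<mu>\<^sup>2) * g x) \<psi> = nil_inner g (sublaplacian \<psi>)"
    by (rule LIMSEQ_unique)
  then have eq: "nil_inner (sublaplacian g) \<psi> = of_real (\<mu>\<^sup>2) * nil_inner g \<psi>"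
    by (simp only: sublaplacian_symmetric[OF g(2) \<psi>] nil_inner_cmult_left)
  have "nil_inner \<psi> h = nil_inner (sublaplacian g) h + nil_inner (\<lambda>x. (- of_real (\<mu>\<^sup>2)) * g x) h" if "h \<in> nil_Lp 2" for h
    unfolding \<psi>_def by (intro nil_inner_add_left L sublaplacian_smooth nil_L2_cmult g(2) that)
  from this[OF L[OF \<psi>]]
  have "nil_inner \<psi> \<psi> = nil_inner (sublaplacian g) \<psi> + nil_inner (\<lambda>x. (- of_real (\<mu>\<^sup>2)) * g x) \<psi>" .
  also have "\<dots> = 0" unfolding nil_inner_cmult_left eq by simp
  finally have "nil_rnorm 2 \<psi> = 0" by (simp add: nil_inner_self flip: of_real_power)
  then have "AE x in nil_measure. \<psi> x = 0" by (rule nil_rnorm_2_eq_0[OF L[OF \<psi>]])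
  then show ?thesis by eventually_elim (simp add: \<psi>_def)
qed

text \<open>Smoothness of the summands allows the differential equation to be added up directly, in
  place of approximating sequences.\<close>

lemma eigenspace_sum:
  assumes "finite S" "S \<subseteq> eigenspace \<mu> \<inter> nil_smooth"
  shows "(\<lambda>x. \<Sum>e\<in>S. c e * e x) \<in> eigenspace \<mu>"
proof (rule eigenspaceI_AE)
  show "(\<lambda>x. \<Sum>e\<in>S. c e * e x) \<in> nil_smooth"
    using assms(2) by (intro nil_smooth_sum nil_smooth_cmult) auto
  have L: "sublaplacian (\<lambda>x. \<Sum>e\<in>S. c e * e x) = (\<lambda>x. \<Sum>e\<in>S. c e * sublaplacian e x)"
    using assms
  proof (induction S)
    case (insert e S)
    have "(\<lambda>x. \<Sum>e\<in>S. c e * e x) \<in> nil_smooth"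
      using insert.prems by (intro nil_smooth_sum nil_smooth_cmult) auto
    then show ?case
      using insert by (simp add: sublaplacian_add sublaplacian_cmult nil_smooth_cmult)
  qed (simp add: sublaplacian_zero)
  have "AE x in nil_measure. \<forall>e\<in>S. sublaplacian e x = of_real (\<mu>\<^sup>2) * e x"
    using assms eigenspace_smooth_AE by (intro AE_finite_allI) auto
  then show "AE x in nil_measure. sublaplacian (\<lambda>x. \<Sum>e\<in>S. c e * e x) x = of_real (\<mu>\<^sup>2) * (\<Sum>e\<in>S. c e * e x)"
    by eventually_elim (simp add: L sum_distrib_left mult.left_commute)
qed

section \<open>Duality of the two operator norms\<close>

lemma nil_rnorm_cmult: "p > 0 \<Longrightarrow> nil_rnorm p (\<lambda>x. c * f x) = cmod c * nil_rnorm p f"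
  by (simp add: nil_rnorm_def norm_mult powr_mult powr_powr)

lemma nil_rnorm_4: "f \<in> nil_smooth \<Longrightarrow> nil_rnorm 4 f ^ 4 = (LINT x|nil_measure. cmod (f x) ^ 4)"
proof -
  have "(LINT x|nil_measure. cmod (f x) ^ 4) \<ge> 0" by simp
  then have "((LINT x|nil_measure. cmod (f x) ^ 4) powr (1 / 4)) ^ 4 = (LINT x|nil_measure. cmod (f x) ^ 4)"
    by (cases "(LINT x|nil_measure. cmod (f x) ^ 4) = 0") (auto simp: powr_powr simp flip: powr_numeral)
  then show ?thesis by (simp add: nil_rnorm_def)
qed

text \<open>A common formula for both operators: for an orthonormal basis it agrees almost
  everywhere with \<open>spec_proj\<close> on L^2, and for the chosen basis it is
  \<open>spec_proj_ext\<close>.\<close>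

definition projector :: "(heis \<Rightarrow> complex) set \<Rightarrow> (heis \<Rightarrow> complex) \<Rightarrow> heis \<Rightarrow> complex" where
  "projector S f = (\<lambda>x. \<Sum>e\<in>S. nil_inner f e * e x)"

context
  fixes \<mu> :: real and S :: "(heis \<Rightarrow> complex) set"
  assumes onb: "eigenspace_onb \<mu> S"
begin

lemma onb_finite: "finite S" and onb_smooth: "S \<subseteq> nil_smooth" and onb_eigen: "S \<subseteq> eigenspace \<mu> \<inter> nil_smooth"
  and onb_orthonormal: "nil_orthonormal S"
  using onb by (auto simp: eigenspace_onb_def nil_orthonormal_def)

lemma onb_L2: "S \<subseteq> nil_Lp 2"
  using onb_smooth nil_smooth_Lp by auto

lemma projector_smooth: "projector S f \<in> nil_smooth"
  unfolding projector_def using onb_smooth by (intro nil_smooth_sum nil_smooth_cmult) auto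

lemma projector_L2: "projector S f \<in> nil_Lp 2"
  by (simp add: nil_smooth_Lp projector_smooth)

lemma projector_eigenspace: "projector S f \<in> eigenspace \<mu>"
  unfolding projector_def by (rule eigenspace_sum[OF onb_finite onb_eigen])

lemma eigenspace_expansion:
  assumes "h \<in> eigenspace \<mu>"
  shows "AE x in nil_measure. h x = projector S h x"
proof -
  obtain c where c: "AE x in nil_measure. h x = (\<Sum>e\<in>S. c e * e x)"
    using onb assms by (auto simp: eigenspace_onb_def)
  have L: "(\<lambda>x. \<Sum>e\<in>S. c e * e x) \<in> nil_Lp 2" using onb_L2 by (intro nil_L2_sum nil_L2_cmult) auto
  have "nil_inner h e = c e" if e: "e \<in> S" for e
  proof -
    have "nil_inner h e = nil_inner (\<lambda>x. \<Sum>e\<in>S. c e * e x) e"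
      using e onb_L2 by (intro nil_inner_cong_AE[OF c]) (auto intro: nil_LpD(2) eigenspace_L2[OF assms] L)
    then show ?thesis by (simp add: orthonormal_coeff[OF onb_finite onb_L2 onb_orthonormal e])
  qed
  then show ?thesis using c by (simp add: projector_def cong: sum.cong)
qed

lemma projector_coeff: "e \<in> S \<Longrightarrow> nil_inner (projector S f) e = nil_inner f e"
  unfolding projector_def by (rule orthonormal_coeff[OF onb_finite onb_L2 onb_orthonormal])

lemma projector_idem: "projector S (projector S f) = projector S f"
  by (simp add: projector_def[of S "projector S f"] projector_coeff cong: sum.cong) (simp add: projector_def)

lemma projector_cmult: "projector S (\<lambda>x. c * f x) = (\<lambda>x. c * projector S f x)"
  by (simp add: projector_def nil_inner_cmult_left sum_distrib_left mult.assoc)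

lemma nil_inner_projector:
  assumes pq: "p > 1" "q > 1" "1 / p + 1 / q = 1" and f: "f \<in> nil_Lp p"
  shows "nil_inner f (projector S g) = (\<Sum>e\<in>S. nil_inner f e * cnj (nil_inner g e))"
proof -
  have "nil_inner f (projector S g) = (\<Sum>e\<in>S. nil_inner f (\<lambda>x. nil_inner g e * e x))"
    unfolding projector_def using onb_smooth pq f
    by (intro nil_inner_sum_right[OF pq]) (auto intro!: nil_smooth_Lp nil_smooth_cmult)
  then show ?thesis unfolding nil_inner_cmult_right by (simp add: mult.commute)
qed

text \<open>\<open>projector S f\<close> witnesses that the choice in \<open>spec_proj\<close> is
  possible. Any admissible choice has the same coefficients in the basis, hence agrees with it
  almost everywhere.\<close>

lemma spec_proj_AE:
  assumes f: "f \<in> nil_Lp 2"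
  shows "spec_proj \<mu> f \<in> eigenspace \<mu>" and "AE x in nil_measure. spec_proj \<mu> f x = projector S f x"
proof -
  define Q where "Q g \<longleftrightarrow> g \<in> eigenspace \<mu> \<and> (\<forall>h\<in>eigenspace \<mu>. nil_inner (\<lambda>x. f x - g x) h = 0)" for g
  have "nil_inner (\<lambda>x. f x - projector S f x) h = 0" if h: "h \<in> eigenspace \<mu>" for h
  proof -
    have dL: "(\<lambda>x. f x - projector S f x) \<in> nil_Lp 2" by (rule nil_L2_diff[OF f projector_L2])
    have "nil_inner h (\<lambda>x. f x - projector S f x) = nil_inner (projector S h) (\<lambda>x. f x - projector S f x)"
      by (rule nil_inner_cong_AE[OF eigenspace_expansion[OF h]])
        (rule nil_LpD(2)[OF eigenspace_L2[OF h]] nil_LpD(2)[OF projector_L2] nil_LpD(2)[OF dL])+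
    then have "nil_inner (\<lambda>x. f x - projector S f x) h = nil_inner (\<lambda>x. f x - projector S f x) (projector S h)"
      by (metis nil_inner_cnj)
    also have "\<dots> = (\<Sum>e\<in>S. nil_inner (\<lambda>x. f x - projector S f x) e * cnj (nil_inner h e))"
      by (rule nil_inner_projector[OF _ _ _ dL, of 2]) auto
    also have "\<dots> = 0"
      using onb_L2 by (intro sum.neutral) (auto simp: nil_inner_diff_left f projector_L2 projector_coeff)
    finally show ?thesis .
  qed
  then have "Q (projector S f)" by (simp add: Q_def projector_eigenspace)
  then have "Q (SOME g. Q g)" by (rule someI[of Q])
  then have Q: "Q (spec_proj \<mu> f)" unfolding spec_proj_def Q_def[symmetric] .
  then show E: "spec_proj \<mu> f \<in> eigenspace \<mu>" by (simp add: Q_def)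
  have "nil_inner (spec_proj \<mu> f) e = nil_inner f e" if "e \<in> S" for e
  proof -
    have "nil_inner (\<lambda>x. f x - spec_proj \<mu> f x) e = 0" using Q that onb_eigen by (auto simp: Q_def)
    moreover have "nil_inner (\<lambda>x. f x - spec_proj \<mu> f x) e = nil_inner f e - nil_inner (spec_proj \<mu> f) e"
      using that onb_L2 by (intro nil_inner_diff_left f eigenspace_L2[OF E]) auto
    ultimately show ?thesis by simp
  qed
  then have "projector S (spec_proj \<mu> f) = projector S f" by (simp add: projector_def cong: sum.cong)
  then show "AE x in nil_measure. spec_proj \<mu> f x = projector S f x"
    using eigenspace_expansion[OF E] by simp
qed

lemma nil_norm_spec_proj:
  assumes f: "f \<in> nil_Lp 2"
  shows "nil_norm 4 (spec_proj \<mu> f) = ennreal (nil_rnorm 4 (projector S f))"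
proof -
  note E = spec_proj_AE(1)[OF f] and AE = spec_proj_AE(2)[OF f]
  note b1 = nil_LpD(2)[OF eigenspace_L2[OF E]] and b2 = nil_smooth_borel[OF projector_smooth[of f]]
  have i4: "integrable nil_measure (\<lambda>x. cmod (projector S f x) powr 4)"
    using nil_LpD(4)[OF nil_smooth_Lp[OF projector_smooth, of 4]] by simp
  have "integrable nil_measure (\<lambda>x. cmod (spec_proj \<mu> f x) powr 4)"
  proof (rule integrable_cong_AE_imp[OF i4])
    show "AE x in nil_measure. cmod (projector S f x) powr 4 = cmod (spec_proj \<mu> f x) powr 4"
      using AE by eventually_elim simp
    note [measurable] = borel_measurable_nil[OF b1]
    show "(\<lambda>x. cmod (spec_proj \<mu> f x) powr 4) \<in> borel_measurable nil_measure" by measurable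
  qed
  then have "spec_proj \<mu> f \<in> nil_Lp 4"
    using nil_LpD(1)[OF eigenspace_L2[OF E]] b1 unfolding nil_Lp_def mem_Collect_eq by (intro conjI)
  then have "nil_norm 4 (spec_proj \<mu> f) = ennreal (nil_rnorm 4 (spec_proj \<mu> f))" by (rule nil_norm_eq)
  also have "nil_rnorm 4 (spec_proj \<mu> f) = nil_rnorm 4 (projector S f)"
    by (rule nil_rnorm_cong_AE[OF AE b1 b2])
  finally show ?thesis .
qed

text \<open>The squared norm of the projection P f is the inner product of f with P f, which Hoelder
  bounds by the L^4 norm of P f. Dividing by the L^2 norm gives the unit vector u.\<close>

lemma projector_norm_le_dual:
  assumes f: "f \<in> nil_Lp (4/3)" "nil_rnorm (4/3) f \<le> 1" and ne: "nil_rnorm 2 (projector S f) > 0"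
  defines "u \<equiv> (\<lambda>x. of_real (1 / nil_rnorm 2 (projector S f)) * projector S f x)"
  shows "u \<in> nil_smooth" "nil_rnorm 2 u = 1" "projector S u = u" "nil_rnorm 2 (projector S f) \<le> nil_rnorm 4 u"
proof -
  let ?g = "projector S f" let ?N = "nil_rnorm 2 (projector S f)"
  show "u \<in> nil_smooth" unfolding u_def by (intro nil_smooth_cmult projector_smooth)
  show "nil_rnorm 2 u = 1" unfolding u_def using ne by (simp only: nil_rnorm_cmult zero_less_numeral norm_of_real) simp
  show "projector S u = u" unfolding u_def projector_cmult projector_idem ..
  have "of_real (?N\<^sup>2) = nil_inner ?g ?g" by (rule nil_inner_self[symmetric])
  also have "\<dots> = (\<Sum>e\<in>S. nil_inner f e * cnj (nil_inner f e))"
    by (subst nil_inner_projector[of 2 2]) (auto simp: projector_L2 projector_coeff intro!: sum.cong)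
  also have "\<dots> = nil_inner f ?g"
    by (rule nil_inner_projector[symmetric, of "4/3" 4]) (auto simp: f)
  finally have "?N\<^sup>2 = cmod (nil_inner f ?g)" by (metis abs_of_nonneg norm_of_real zero_le_power2)
  also have "\<dots> \<le> nil_rnorm (4/3) f * nil_rnorm 4 ?g"
    by (rule nil_Hoelder) (auto simp: f nil_smooth_Lp projector_smooth)
  also have "\<dots> \<le> 1 * nil_rnorm 4 ?g" by (rule mult_right_mono[OF f(2)]) simp
  finally have "?N \<le> nil_rnorm 4 ?g / ?N" using ne by (simp add: field_simps power2_eq_square)
  then show "?N \<le> nil_rnorm 4 u"
    unfolding u_def using ne by (simp only: nil_rnorm_cmult zero_less_numeral norm_of_real) simp
qed

text \<open>With g = P f and v = g |g|^2, self-adjointness turns the inner product of g and v into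
  that of f and P v. This gives N^4 \<le> the L^2 norm of P v; dividing by N^3 normalises v in
  L^(4/3).\<close>

lemma projector_norm_le_dual':
  assumes f: "f \<in> nil_Lp 2" "nil_rnorm 2 f \<le> 1" and ne: "nil_rnorm 4 (projector S f) > 0"
  obtains w where "w \<in> nil_Lp (4/3)" "nil_rnorm (4/3) w = 1"
    "nil_rnorm 4 (projector S f) \<le> nil_rnorm 2 (projector S w)"
proof -
  let ?g = "projector S f" let ?N = "nil_rnorm 4 (projector S f)"
  have g: "?g \<in> nil_smooth" by (rule projector_smooth)
  note cg = nil_smooth_continuous[OF g]
  \<comment> \<open>The extremal function for Hoelder's inequality between L^4 and L^(4/3): it has
    norm \<open>?N ^ 3\<close> and inner product \<open>?N ^ 4\<close> with the projection.\<close>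
  define v where "v x = ?g x * of_real ((cmod (?g x))\<^sup>2)" for x
  have cmod_v: "cmod (v x) = cmod (?g x) ^ 3" for x
    by (simp add: v_def norm_mult power2_eq_square power3_eq_cube)
  have inv: "nil_invariant v"
    using nil_LpD(1)[OF projector_L2, of f] by (simp add: nil_invariant_def v_def)
  have vL: "v \<in> nil_Lp p" if "p > 0" for p
    by (rule nil_Lp_continuous[OF inv _ that]) (unfold v_def, intro continuous_intros cg)
  have pow: "cmod (v x) powr (4/3) = cmod (?g x) ^ 4" for x
    unfolding cmod_v by (cases "?g x = 0") (auto simp: powr_powr simp flip: powr_numeral)
  have I: "(LINT x|nil_measure. cmod (?g x) ^ 4) = ?N ^ 4" by (rule nil_rnorm_4[OF g, symmetric])
  have v_norm: "nil_rnorm (4/3) v = ?N ^ 3"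
    using ne unfolding nil_rnorm_def[of "4/3"] pow I by (simp add: powr_powr flip: powr_numeral)
  have "nil_inner ?g v = (LINT x|nil_measure. of_real (cmod (?g x) ^ 4))"
    unfolding nil_inner_def
  proof (intro Bochner_Integration.integral_cong refl)
    fix x
    have "?g x * cnj (v x) = (?g x * cnj (?g x)) * of_real ((cmod (?g x))\<^sup>2)" by (simp add: v_def)
    also have "?g x * cnj (?g x) = of_real ((cmod (?g x))\<^sup>2)" by (simp add: complex_norm_square del: of_real_power)
    finally show "?g x * cnj (v x) = of_real (cmod (?g x) ^ 4)"
      by (simp flip: of_real_mult of_real_power power_add)
  qed
  also have "\<dots> = of_real (?N ^ 4)" by (simp only: integral_complex_of_real I)
  finally have gv: "nil_inner ?g v = of_real (?N ^ 4)" .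
  have "nil_inner ?g v = cnj (nil_inner v ?g)" by (rule nil_inner_cnj)
  also have "nil_inner v ?g = (\<Sum>e\<in>S. nil_inner v e * cnj (nil_inner f e))"
    by (rule nil_inner_projector[of 2 2]) (auto simp: vL)
  also have "cnj \<dots> = (\<Sum>e\<in>S. nil_inner f e * cnj (nil_inner v e))" by (simp add: mult.commute)
  also have "\<dots> = nil_inner f (projector S v)"
    by (rule nil_inner_projector[symmetric, of 2 2]) (auto simp: f)
  finally have "cmod (nil_inner f (projector S v)) = ?N ^ 4" unfolding gv by (metis norm_of_real abs_of_nonneg nil_rnorm_nonneg zero_le_power)
  moreover have "cmod (nil_inner f (projector S v)) \<le> nil_rnorm 2 f * nil_rnorm 2 (projector S v)"
    by (rule nil_Cauchy_Schwarz[OF f(1) projector_L2])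
  moreover have "\<dots> \<le> 1 * nil_rnorm 2 (projector S v)" by (rule mult_right_mono[OF f(2)]) simp
  ultimately have le: "?N ^ 4 \<le> nil_rnorm 2 (projector S v)" by simp
  define w where "w x = of_real (1 / ?N ^ 3) * v x" for x
  have cm: "cmod (of_real (1 / ?N ^ 3)) = 1 / ?N ^ 3" using ne by (simp add: norm_divide norm_power)
  show thesis
  proof (rule that[of w])
    have "nil_invariant w" unfolding w_def by (rule nil_invariant_cmult[OF inv])
    then show "w \<in> nil_Lp (4/3)"
      by (rule nil_Lp_continuous) (unfold w_def v_def, use ne in \<open>auto intro!: continuous_intros cg\<close>)
    show "nil_rnorm (4/3) w = 1"
    proof -
      have "nil_rnorm (4/3) w = 1 / ?N ^ 3 * ?N ^ 3"
        unfolding w_def by (subst nil_rnorm_cmult, simp, simp only: cm v_norm)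
      moreover have "?N ^ 3 \<noteq> 0" using ne by simp
      ultimately show ?thesis by simp
    qed
    have "nil_rnorm 2 (projector S w) = 1 / ?N ^ 3 * nil_rnorm 2 (projector S v)"
      unfolding w_def projector_cmult by (simp only: nil_rnorm_cmult cm zero_less_numeral)
    moreover have "?N = 1 / ?N ^ 3 * ?N ^ 4" using ne by (simp add: field_simps power4_eq_xxxx power3_eq_cube)
    moreover have "1 / ?N ^ 3 * ?N ^ 4 \<le> 1 / ?N ^ 3 * nil_rnorm 2 (projector S v)"
      using ne by (intro mult_left_mono le) auto
    ultimately show "?N \<le> nil_rnorm 2 (projector S w)" by simp
  qed
qed

lemma nil_unit_ball: "{f \<in> nil_Lp p. nil_norm p f \<le> 1} = {f \<in> nil_Lp p. nil_rnorm p f \<le> 1}"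
  by (auto simp: nil_norm_eq)

text \<open>Each competitor on one side is beaten by one on the other, supplied by the two duality
  lemmas. A projection of norm zero cannot be normalised, but then its inequality is
  trivial.\<close>

lemma projector_opnorm_eq:
  "nil_opnorm 2 4 (spec_proj \<mu>) = nil_opnorm (4/3) 2 (projector S)"
proof (rule antisym)
  show "nil_opnorm 2 4 (spec_proj \<mu>) \<le> nil_opnorm (4/3) 2 (projector S)"
    unfolding nil_opnorm_def nil_unit_ball
  proof (rule SUP_least)
    fix f assume "f \<in> {f \<in> nil_Lp 2. nil_rnorm 2 f \<le> 1}"
    then have f: "f \<in> nil_Lp 2" "nil_rnorm 2 f \<le> 1" by auto
    show "nil_norm 4 (spec_proj \<mu> f) \<le> (SUP f\<in>{f \<in> nil_Lp (4/3). nil_rnorm (4/3) f \<le> 1}. nil_norm 2 (projector S f))"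
    proof (cases "nil_rnorm 4 (projector S f) > 0")
      case True
      then obtain w where w: "w \<in> nil_Lp (4/3)" "nil_rnorm (4/3) w = 1"
        "nil_rnorm 4 (projector S f) \<le> nil_rnorm 2 (projector S w)"
        using projector_norm_le_dual'[OF f] by blast
      have "nil_norm 4 (spec_proj \<mu> f) \<le> nil_norm 2 (projector S w)"
        using w(3) by (simp add: nil_norm_spec_proj f nil_norm_eq projector_L2 ennreal_leI)
      also have "\<dots> \<le> (SUP f\<in>{f \<in> nil_Lp (4/3). nil_rnorm (4/3) f \<le> 1}. nil_norm 2 (projector S f))"
        using w by (intro SUP_upper) auto
      finally show ?thesis .
    next
      case False
      then have "nil_rnorm 4 (projector S f) = 0" using nil_rnorm_nonneg[of 4 "projector S f"] by linarith
      then show ?thesis by (simp add: nil_norm_spec_proj f)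
    qed
  qed
  show "nil_opnorm (4/3) 2 (projector S) \<le> nil_opnorm 2 4 (spec_proj \<mu>)"
    unfolding nil_opnorm_def nil_unit_ball
  proof (rule SUP_least)
    fix f assume "f \<in> {f \<in> nil_Lp (4/3). nil_rnorm (4/3) f \<le> 1}"
    then have f: "f \<in> nil_Lp (4/3)" "nil_rnorm (4/3) f \<le> 1" by auto
    show "nil_norm 2 (projector S f) \<le> (SUP f\<in>{f \<in> nil_Lp 2. nil_rnorm 2 f \<le> 1}. nil_norm 4 (spec_proj \<mu> f))"
    proof (cases "nil_rnorm 2 (projector S f) > 0")
      case True
      define u where "u = (\<lambda>x. of_real (1 / nil_rnorm 2 (projector S f)) * projector S f x)"
      note u = projector_norm_le_dual[OF f True, folded u_def]
      have uL: "u \<in> nil_Lp 2" using u(1) by (simp add: nil_smooth_Lp)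
      have "nil_norm 2 (projector S f) \<le> nil_norm 4 (spec_proj \<mu> u)"
        using u(4) by (simp add: nil_norm_spec_proj uL u(3) nil_norm_eq projector_L2 ennreal_leI)
      also have "\<dots> \<le> (SUP f\<in>{f \<in> nil_Lp 2. nil_rnorm 2 f \<le> 1}. nil_norm 4 (spec_proj \<mu> f))"
        using uL u(2) by (intro SUP_upper) auto
      finally show ?thesis .
    next
      case False
      then have "nil_rnorm 2 (projector S f) = 0" using nil_rnorm_nonneg[of 2 "projector S f"] by linarith
      then show ?thesis by (simp add: nil_norm_eq projector_L2)
    qed
  qed
qed

lemma projector_opnorm_le:
  assumes M: "M \<ge> 0" "\<And>g. g \<in> eigenspace \<mu> \<Longrightarrow> g \<in> nil_smooth \<Longrightarrow> nil_rnorm 4 g \<le> M * nil_rnorm 2 g"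
  shows "nil_opnorm (4/3) 2 (projector S) \<le> ennreal M"
  unfolding nil_opnorm_def nil_unit_ball
proof (rule SUP_least)
  fix f assume "f \<in> {f \<in> nil_Lp (4/3). nil_rnorm (4/3) f \<le> 1}"
  then have f: "f \<in> nil_Lp (4/3)" "nil_rnorm (4/3) f \<le> 1" by auto
  have "nil_rnorm 2 (projector S f) \<le> M"
  proof (cases "nil_rnorm 2 (projector S f) > 0")
    case True
    define u where "u = (\<lambda>x. of_real (1 / nil_rnorm 2 (projector S f)) * projector S f x)"
    note u = projector_norm_le_dual[OF f True, folded u_def]
    have "u \<in> eigenspace \<mu>" using projector_eigenspace[of u] u(3) by simp
    from M(2)[OF this u(1)] show ?thesis using u(2,4) by simp
  qed (use M in linarith)
  then show "nil_norm 2 (projector S f) \<le> ennreal M"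
    by (simp add: nil_norm_eq projector_L2 ennreal_leI)
qed

end

text \<open>For \<mu> < 1 the left side is zero. Otherwise fourth powers are compared, and 1 + 2
  \<mu> \<le> 3 \<mu> leaves a pure power of \<mu>.\<close>

lemma eigenspace_norm_bound:
  assumes \<epsilon>: "\<epsilon> > 0"
  shows "\<exists>C>0. \<forall>\<mu>>0. \<forall>g\<in>eigenspace \<mu> \<inter> nil_smooth. nil_rnorm 4 g \<le> C * \<mu> powr (1/2 + \<epsilon>) * nil_rnorm 2 g"
proof -
  \<comment> \<open>The cube of the number of weights must amount to \<mu>^(4 \<epsilon>) before the
    fourth root is taken, hence the exponent 4 \<epsilon> / 3.\<close>
  obtain D where D: "D > 0" "\<And>\<mu>. \<mu> \<ge> 1 \<Longrightarrow> real (card (mode_indices \<mu>)) \<le> D * \<mu> powr (\<epsilon> * 4/3)"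
    using card_mode_indices[of "\<epsilon> * 4/3"] \<epsilon> by auto
  \<comment> \<open>\<open>D ^ 3\<close> comes from counting the weights, 9 from the square of 3
    \<mu>.\<close>
  define C where "C = (D ^ 3 * 9) powr (1 / 4)"
  have C: "C > 0" using D by (simp add: C_def)
  have "nil_rnorm 4 g \<le> C * \<mu> powr (1/2 + \<epsilon>) * nil_rnorm 2 g"
    if \<mu>: "\<mu> > 0" and g: "g \<in> eigenspace \<mu>" "g \<in> nil_smooth" for \<mu> g
  proof (cases "\<mu> < 1")
    case True
    have "nil_rnorm 4 g = nil_rnorm 4 (\<lambda>x. 0)"
      by (rule nil_rnorm_cong_AE[OF eigenspace_trivial[OF g(1) \<mu> True] nil_smooth_borel[OF g(2)]]) simp
    then show ?thesis using C by (simp add: nil_rnorm_def)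
  next
    case False
    then have \<mu>1: "\<mu> \<ge> 1" by simp
    have "nil_rnorm 4 g ^ 4 \<le> real (card (mode_indices \<mu>)) ^ 3 * ((1 + 2 * \<mu>)\<^sup>2 * nil_rnorm 2 g ^ 4)"
      unfolding nil_rnorm_4[OF g(2)] using \<mu> by (intro eigenspace_L4_bound g) auto
    also have "\<dots> \<le> (D * \<mu> powr (\<epsilon> * 4/3)) ^ 3 * ((3 * \<mu>)\<^sup>2 * nil_rnorm 2 g ^ 4)"
      using \<mu>1 D by (intro mult_mono power_mono) auto
    also have "\<dots> = (C * \<mu> powr (1/2 + \<epsilon>) * nil_rnorm 2 g) ^ 4"
    proof -
      have "C ^ 4 = D ^ 3 * 9"
        using D(1) by (simp add: C_def powr_powr flip: powr_numeral)
      moreover have "(\<mu> powr (\<epsilon> * 4/3)) ^ 3 * \<mu>\<^sup>2 = (\<mu> powr (1/2 + \<epsilon>)) ^ 4"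
      proof -
        have "(\<mu> powr (\<epsilon> * 4/3)) ^ 3 = \<mu> powr (\<epsilon> * 4/3 * real 3)" "\<mu>\<^sup>2 = \<mu> powr real 2"
          using \<mu> by (simp_all only: powr_powr[symmetric] powr_realpow powr_gt_zero simp_thms)
        then have "(\<mu> powr (\<epsilon> * 4/3)) ^ 3 * \<mu>\<^sup>2 = \<mu> powr (\<epsilon> * 4/3 * real 3) * \<mu> powr real 2"
          by (simp only:)
        also have "\<dots> = \<mu> powr ((1/2 + \<epsilon>) * real 4)"
          by (simp only: powr_add[symmetric]) (rule arg_cong[where f = "(powr) \<mu>"], simp)
        also have "\<dots> = (\<mu> powr (1/2 + \<epsilon>)) ^ 4"
          using \<mu> by (simp only: powr_powr[symmetric] powr_realpow powr_gt_zero simp_thms)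
        finally show ?thesis .
      qed
      ultimately show ?thesis
        by (simp add: power_mult_distrib mult_ac)
    qed
    finally show ?thesis
      by (rule power_le_imp_le_base[of _ 3, simplified])
        (use C in simp)
  qed
  then show ?thesis using C by blast
qed

lemma spec_proj_ext_eq: "spec_proj_ext \<mu> = projector (SOME S. eigenspace_onb \<mu> S)"
  by (simp add: fun_eq_iff spec_proj_ext_def projector_def)

theorem theorem1p1:
  shows "\<forall>\<epsilon>::real. \<epsilon> > 0 \<longrightarrow> (\<exists>C::real. C > 0 \<and> (\<forall>\<mu>::real. \<mu> > 0 \<longrightarrow>
    nil_opnorm 2 4 (spec_proj \<mu>) = nil_opnorm (4/3) 2 (spec_proj_ext \<mu>) \<and>
    nil_opnorm (4/3) 2 (spec_proj_ext \<mu>) \<le> ennreal (C * \<mu> powr (1/2 + \<epsilon>))))"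
proof (intro allI impI)
  fix \<epsilon> :: real assume "\<epsilon> > 0"
  from eigenspace_norm_bound[OF this] obtain C where C: "C > 0"
    "\<And>\<mu> g. \<mu> > 0 \<Longrightarrow> g \<in> eigenspace \<mu> \<Longrightarrow> g \<in> nil_smooth \<Longrightarrow> nil_rnorm 4 g \<le> C * \<mu> powr (1/2 + \<epsilon>) * nil_rnorm 2 g"
    by blast
  \<comment> \<open>The basis chosen in \<open>spec_proj_ext\<close> is a genuine one because some
    basis exists.\<close>
  have onb: "eigenspace_onb \<mu> (SOME S. eigenspace_onb \<mu> S)" for \<mu>
    using eigenspace_basis[of \<mu>] by (metis someI_ex)
  show "\<exists>C::real. C > 0 \<and> (\<forall>\<mu>::real. \<mu> > 0 \<longrightarrow>
    nil_opnorm 2 4 (spec_proj \<mu>) = nil_opnorm (4/3) 2 (spec_proj_ext \<mu>) \<and>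
    nil_opnorm (4/3) 2 (spec_proj_ext \<mu>) \<le> ennreal (C * \<mu> powr (1/2 + \<epsilon>)))"
  proof (intro exI[of _ C] conjI allI impI C(1))
    fix \<mu> :: real assume \<mu>: "\<mu> > 0"
    show "nil_opnorm 2 4 (spec_proj \<mu>) = nil_opnorm (4/3) 2 (spec_proj_ext \<mu>)"
      unfolding spec_proj_ext_eq by (rule projector_opnorm_eq[OF onb])
    show "nil_opnorm (4/3) 2 (spec_proj_ext \<mu>) \<le> ennreal (C * \<mu> powr (1/2 + \<epsilon>))"
      unfolding spec_proj_ext_eq using C \<mu> by (intro projector_opnorm_le[OF onb]) auto
  qed
qed

end
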